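(* For every integer $n\geq1$, $\mathrm{unc}(n,3)<(1.56)\,3^{n^2-n-1}(1.59)^n$, and for every prime power $q\geq4$, \[ \mathrm{unc}(n,q)<c^*(q)\,q^{n^2-n-1}\bigl(1+q^{-1}+2q^{-2}\bigr)^n . \] Moreover $1<c^*(q)<1.56$ for all prime powers $q\geq3$.
   Context: $\mathrm{M}(n,q)$ is the algebra of $n\times n$ matrices over $\mathbb{F}_q$. For $X\in\mathrm{M}(n,q)$ let $V=\mathbb{F}_q^{1\times n}$ be an $\mathbb{F}_q[t]$-module with $t$ acting as $X$; for monic irreducible $g$, $V(g)=\ker g(X)^n$. $X$ is uncyclic if $V(g)$ is a non-cyclic $\mathbb{F}_q[X]$-module for every monic irreducible divisor $g$ of $c_X(t)$; $\mathrm{unc}(n,q)$ is the number of uncyclic matrices in $\mathrm{M}(n,q)$. For real $Q>1$: $\omega(m,Q)=\prod_{i=1}^m(1-Q^{-i})$, $\omega(\infty,Q)=\prod_{i=1}^\infty(1-Q^{-i})$, $c_0(\infty,Q)=Q^2\bigl(1-\prod_{i=2}^\infty(1-Q^{-i})\bigr)$, and \[ c^*(q)=c_0(\infty,q)+q\,\frac{\omega(4,q)\,c_0(\infty,q^2)}{\omega(\infty,q^2)}\Bigl(q\log(1-q^{-2})-\log(1-q^{-1})\Bigr). \] *)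

theory Defs
  imports "HOL-Analysis.Analysis" "Jordan_Normal_Form.Char_Poly"
begin

definition mat_poly_eval :: "'a :: field mat \<Rightarrow> 'a poly \<Rightarrow> 'a mat" where
  "mat_poly_eval X p = mat (dim_row X) (dim_col X)
     (\<lambda>(i,j). \<Sum>k\<le>degree p. coeff p k * (X ^\<^sub>m k) $$ (i,j))"

definition row_mult :: "'a :: field vec \<Rightarrow> 'a mat \<Rightarrow> 'a vec" where
  "row_mult v A = vec (dim_col A) (\<lambda>j. \<Sum>i<dim_vec v. v $ i * A $$ (i,j))"

(* V(g) = ker g(X)^n, with V = F^{1 x n} and t acting as right multiplication by X *)
definition gen_eigenspace :: "'a :: field mat \<Rightarrow> 'a poly \<Rightarrow> 'a vec set" where
  "gen_eigenspace X g = {v \<in> carrier_vec (dim_row X).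
      row_mult v (mat_poly_eval X (g ^ dim_row X)) = 0\<^sub>v (dim_row X)}"

definition cyclic_submodule :: "'a :: field mat \<Rightarrow> 'a vec set \<Rightarrow> bool" where
  "cyclic_submodule X W \<longleftrightarrow> (\<exists>v\<in>W. \<forall>w\<in>W. \<exists>p. w = row_mult v (mat_poly_eval X p))"

definition uncyclic :: "'a :: field mat \<Rightarrow> bool" where
  "uncyclic X \<longleftrightarrow> (\<forall>g. monic g \<and> irreducible g \<and> g dvd char_poly X
      \<longrightarrow> \<not> cyclic_submodule X (gen_eigenspace X g))"

definition unc :: "nat \<Rightarrow> 'a :: {field,finite} itself \<Rightarrow> nat" where
  "unc n _ = card {X :: 'a mat. X \<in> carrier_mat n n \<and> uncyclic X}"

definition omega :: "nat \<Rightarrow> real \<Rightarrow> real" where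
  "omega m Q = (\<Prod>i=1..m. 1 - inverse (Q ^ i))"

definition omega_inf :: "real \<Rightarrow> real" where
  "omega_inf Q = (\<Prod>i. 1 - inverse (Q ^ (i+1)))"

definition c0_inf :: "real \<Rightarrow> real" where
  "c0_inf Q = Q^2 * (1 - (\<Prod>i. 1 - inverse (Q ^ (i+2))))"

definition cstar :: "real \<Rightarrow> real" where
  "cstar q = c0_inf q + q * (omega 4 q * c0_inf (q^2) / omega_inf (q^2))
      * (q * ln (1 - inverse (q^2)) - ln (1 - inverse q))"

definition prime_power :: "nat \<Rightarrow> bool" where
  "prime_power q \<longleftrightarrow> (\<exists>p k. prime p \<and> k \<ge> 1 \<and> q = p ^ k)"

end

theory Submission
  imports Defs
begin

text \<open>If \<open>X\<close> is uncyclic, then for each monic irreducible \<open>g\<close> with \<open>Q = q\<^bsup>deg g\<^esup>\<close> the kernel of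
  \<open>g(X)\<close> is zero or has at least \<open>Q\<^sup>2\<close> elements, since a primary module with simple socle is cyclic.
  Divide the number of \<open>n \<times> n\<close> matrices satisfying this condition by \<open>q\<^bsup>-n\<^esup> |GL(n,q)|\<close> and admit the
  irreducible polynomials one at a time.  If \<open>g\<close> is new, then either it does not occur in \<open>X\<close>, or there
  are at least \<open>(Q\<^sup>2 - 1) (Q\<^sup>2 - Q)\<close> pairs of vectors spanning a copy of \<open>(F[t]/g)\<^sup>2\<close>; fixing such a pair leaves
  a quotient of dimension \<open>n - 2 deg g\<close> on which only the \<open>g\<close>-primary part is unrestricted.  That part is
  counted by splitting off the cyclic submodules \<open>F[t]/g\<^sup>i\<close>.  The resulting recursion shows that the
  normalised count is at most \<open>s (1 + s/2)\<^bsup>n-2\<^esup>\<close>, where \<open>s\<close> is the sum over \<open>g\<close> of terms close to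
  \<open>Q\<^bsup>-2\<^esup>\<close>, and \<open>s\<close> is about \<open>1/q + 3/q\<^sup>2\<close>.\<close>

section \<open>Polynomials acting on row vectors\<close>

text \<open>Only upper bounds are wanted, so each count is an injection and the recursion is an
  inequality. Dividing by |GL(n,q)| fits because l independent rows and an off-diagonal block of
  size l times n-l account exactly for |GL(n,q)| / |GL(n-l,q)|. The growth factor comes from the
  recursion: the new value at n is at most the old one plus b times the sum of the old values up to
  n-2. With y = 1 + s/2 the sum of s y^(m-2) over m = 2..N is 2 (y^(N-1) - 1), so partial sums are
  at most 2 y^N - 1, and raising s to s + b pays for the added terms. For q = 3 the bound found for
  1 + s/2 is about 1.578, above 1 + 1/3 + 2/9 but below 1.59; for q >= 4 it is below 1 + 1/q +
  2/q^2.\<close>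

abbreviation scl :: "'a::comm_semiring_0 \<Rightarrow> 'a poly \<Rightarrow> 'a poly" where
  "scl \<equiv> Polynomial.smult"

text \<open>Row vectors of length \<open>n\<close> are encoded as polynomials of degree less than \<open>n\<close>, so that
  all lengths live in one type.\<close>
definition cspace :: "nat \<Rightarrow> 'a::zero poly set" where
  "cspace n = {v. \<forall>i\<ge>n. coeff v i = 0}"

definition lin :: "('a::comm_semiring_0 poly \<Rightarrow> 'a poly) \<Rightarrow> bool" where
  "lin T \<longleftrightarrow> (\<forall>u v. T (u + v) = T u + T v) \<and> (\<forall>c v. T (scl c v) = scl c (T v))"

definition subsp :: "'a::comm_semiring_0 poly set \<Rightarrow> bool" where
  "subsp S \<longleftrightarrow> 0 \<in> S \<and> (\<forall>u\<in>S. \<forall>v\<in>S. u + v \<in> S) \<and> (\<forall>c. \<forall>v\<in>S. scl c v \<in> S)"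

text \<open>This is \<open>p(T)\<close> applied to \<open>v\<close>: the polynomial \<open>p\<close>
  acting in the module whose indeterminate acts as \<open>T\<close>.\<close>

definition pact :: "('a::comm_ring_1 poly \<Rightarrow> 'a poly) \<Rightarrow> 'a poly \<Rightarrow> 'a poly \<Rightarrow> 'a poly" where
  "pact T p v = (\<Sum>k\<le>degree p. scl (coeff p k) ((T ^^ k) v))"

lemma scl_sum: "scl (c::'a::comm_ring_1) (sum f A) = (\<Sum>x\<in>A. scl c (f x))"
  by (induction A rule: infinite_finite_induct) (auto simp: smult_add_right)

lemma lin_add: "lin T \<Longrightarrow> T (u + v) = T u + T v"
  and lin_scl: "lin T \<Longrightarrow> T (scl c v) = scl c (T v)"
  by (auto simp: lin_def)

lemma lin_0: "lin T \<Longrightarrow> T (0::'a::comm_ring_1 poly) = 0"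
  using lin_scl[of T 0 0] by simp

lemma lin_uminus: "lin T \<Longrightarrow> T (- v) = - T (v::'a::comm_ring_1 poly)"
  using lin_scl[of T "-1" v] by simp

lemma lin_diff: "lin T \<Longrightarrow> T (u - v) = T u - T (v::'a::comm_ring_1 poly)"
  using lin_add[of T u "- v"] by (simp add: lin_uminus)

lemma lin_sum: "lin T \<Longrightarrow> T (sum f A) = (\<Sum>x\<in>A. T (f x :: 'a::comm_ring_1 poly))"
  by (induction A rule: infinite_finite_induct) (auto simp: lin_0 lin_add)

lemma lin_funpow: "lin T \<Longrightarrow> lin (T ^^ k)"
  by (induction k) (auto simp: lin_def)

lemma subspD:
  assumes "subsp S"
  shows "0 \<in> S" "u \<in> S \<Longrightarrow> v \<in> S \<Longrightarrow> u + v \<in> S" "v \<in> S \<Longrightarrow> scl c v \<in> S"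
  using assms by (auto simp: subsp_def)

lemma subsp_diff: "subsp S \<Longrightarrow> u \<in> S \<Longrightarrow> v \<in> S \<Longrightarrow> u - v \<in> (S :: 'a::comm_ring_1 poly set)"
  using subspD(2)[of S u "- v"] subspD(3)[of S v "-1"] by simp

lemma subsp_sum: "subsp S \<Longrightarrow> (\<And>x. x \<in> A \<Longrightarrow> f x \<in> S) \<Longrightarrow> sum f A \<in> S"
  by (induction A rule: infinite_finite_induct) (auto simp: subspD)

lemma subsp_cspace: "subsp (cspace n :: 'a::comm_ring_1 poly set)"
  by (auto simp: subsp_def cspace_def)

lemma pact_eq:
  assumes "degree p \<le> m"
  shows "pact T p v = (\<Sum>k\<le>m. scl (coeff p k) ((T ^^ k) v))"
  unfolding pact_def
  by (rule sum.mono_neutral_left) (use assms in \<open>auto simp: coeff_eq_0\<close>)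

lemma pact_0 [simp]: "pact T 0 v = 0"
  by (simp add: pact_def)

lemma pact_pCons:
  assumes "lin T"
  shows "pact T (pCons a p) v = scl a v + T (pact T p v)"
proof -
  have "pact T (pCons a p) v = (\<Sum>k\<le>Suc (degree p). scl (coeff (pCons a p) k) ((T ^^ k) v))"
    by (rule pact_eq) (simp add: degree_pCons_le)
  also have "\<dots> = scl a v + (\<Sum>k\<le>degree p. scl (coeff p k) (T ((T ^^ k) v)))"
    by (subst sum.atMost_Suc_shift) simp
  also have "(\<Sum>k\<le>degree p. scl (coeff p k) (T ((T ^^ k) v))) = T (pact T p v)"
    using assms by (simp add: pact_def lin_sum lin_scl)
  finally show ?thesis .
qed

lemma pact_add: "pact T (p + q) v = pact T p v + pact T q v"
proof -
  define m where "m = max (degree p) (degree q)"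
  have "degree (p + q) \<le> m" "degree p \<le> m" "degree q \<le> m"
    by (auto simp: m_def intro: degree_add_le)
  then show ?thesis by (simp add: pact_eq[of _ m] sum.distrib smult_add_left)
qed

lemma pact_smult: "pact T (Polynomial.smult c p) v = scl c (pact T p v)"
proof -
  have "degree (Polynomial.smult c p) \<le> degree p" by (rule degree_smult_le)
  then show ?thesis by (simp add: pact_eq[of _ "degree p"] scl_sum)
qed

lemma pact_uminus: "pact T (- p) v = - pact T p v"
  using pact_smult[of T "-1" p v] by simp

lemma pact_diff: "pact T (p - q) v = pact T p v - pact T q v"
  using pact_add[of T p "- q" v] by (simp add: pact_uminus)

lemma lin_pact:
  assumes "lin T"
  shows "lin (pact T p)"
  unfolding lin_def pact_def
  using lin_funpow[OF assms] by (auto simp: lin_add lin_scl sum.distrib scl_sum mult.commute smult_add_right)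

lemma pact_1 [simp]: "pact T 1 v = v"
  by (simp add: pact_def)

lemma pact_mult:
  assumes "lin T"
  shows "pact T (p * q) v = pact T p (pact T q v)"
proof (induction p)
  case (pCons a p)
  have "pact T (pCons a p * q) v = pact T (Polynomial.smult a q + pCons 0 (p * q)) v" by simp
  also have "\<dots> = scl a (pact T q v) + T (pact T (p * q) v)"
    by (simp only: pact_add pact_smult pact_pCons[OF assms]) simp
  also have "\<dots> = pact T (pCons a p) (pact T q v)" using pCons assms by (simp add: pact_pCons)
  finally show ?case .
qed simp

lemma pact_closed:
  assumes "subsp S" "T ` S \<subseteq> S" "v \<in> S"
  shows "pact T p v \<in> S"
proof -
  have "(T ^^ k) v \<in> S" for k using assms(2,3) by (induction k) auto
  then show ?thesis unfolding pact_def using assms(1) by (intro subsp_sum subspD(3))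
qed

text \<open>Quotient maps commute with the two operators only on the module \<open>S\<close>, so the
  orbit of \<open>v\<close> has to stay in \<open>S\<close>.\<close>

lemma pact_intertwine:
  assumes "lin P" "lin T" "T ` S \<subseteq> S" "\<And>v. v \<in> S \<Longrightarrow> P (T v) = T' (P v)" "v \<in> S"
  shows "P (pact T p v) = pact T' p (P v)"
proof -
  have S: "(T ^^ k) v \<in> S" for k using assms(3,5) by (induction k) auto
  have "P ((T ^^ k) v) = (T' ^^ k) (P v)" for k
    by (induction k) (auto simp: S assms)
  then show ?thesis using assms(1) by (simp add: pact_def lin_sum lin_scl)
qed

lemma pact_monom: "lin T \<Longrightarrow> pact T (monom c k) v = scl c ((T ^^ k) v)"
  by (induction k) (simp_all add: monom_0 monom_Suc pact_pCons lin_0 lin_scl)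

lemma pact_dvd_0: "lin T \<Longrightarrow> pact T p v = 0 \<Longrightarrow> p dvd q \<Longrightarrow> pact T q v = 0"
  by (auto elim!: dvdE simp: pact_mult mult.commute[of p] lin_0[OF lin_pact])

text \<open>In a finite set the orbit of \<open>v\<close> repeats, so some nonzero
  \<open>t^j - t^i\<close> kills \<open>v\<close>. A nonzero killer of least degree divides all
  others by division with remainder; monic normalisation makes it unique.\<close>

lemma ex1_annihilator:
  fixes v :: "'a::field poly"
  assumes T: "lin T" and S: "finite S" "T ` S \<subseteq> S" "v \<in> S"
  shows "\<exists>!h. monic h \<and> (\<forall>p. pact T p v = 0 \<longleftrightarrow> h dvd p)"
proof -
  have Sk: "(T ^^ k) v \<in> S" for k using S(2,3) by (induction k) auto
  have "\<not> inj (\<lambda>k. (T ^^ k) v)"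
  proof
    assume "inj (\<lambda>k. (T ^^ k) v)"
    moreover have "finite (range (\<lambda>k. (T ^^ k) v))"
      using Sk by (intro finite_subset[OF _ S(1)]) auto
    ultimately show False using finite_imageD infinite_UNIV_nat by blast
  qed
  then obtain i j where "i \<noteq> j" "(T ^^ i) v = (T ^^ j) v"
    unfolding inj_def by blast
  then obtain i j where ij: "i < j" "(T ^^ i) v = (T ^^ j) v"
    by (cases i j rule: linorder_cases) auto
  define p0 where "p0 = monom (1::'a) j - monom 1 i"
  have "pact T p0 v = 0" using ij T by (simp add: p0_def pact_diff pact_monom)
  moreover have "coeff p0 j \<noteq> 0" using ij by (simp add: p0_def)
  then have "p0 \<noteq> 0" by auto
  ultimately have ex: "\<exists>p. p \<noteq> 0 \<and> pact T p v = 0" by blast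
  define m where "m = (ARG_MIN degree p. p \<noteq> 0 \<and> pact T p v = 0)"
  have m: "m \<noteq> 0" "pact T m v = 0"
    and mmin: "\<And>p. p \<noteq> 0 \<Longrightarrow> pact T p v = 0 \<Longrightarrow> degree m \<le> degree p"
  proof -
    obtain k where "k \<noteq> 0 \<and> pact T k v = 0" using ex by blast
    then have "(m \<noteq> 0 \<and> pact T m v = 0) \<and> (\<forall>p. p \<noteq> 0 \<and> pact T p v = 0 \<longrightarrow> degree m \<le> degree p)"
      unfolding m_def by (rule arg_min_nat_lemma)
    then show "m \<noteq> 0" "pact T m v = 0"
      "\<And>p. p \<noteq> 0 \<Longrightarrow> pact T p v = 0 \<Longrightarrow> degree m \<le> degree p" by blast+
  qed
  have dvd: "pact T p v = 0 \<longleftrightarrow> m dvd p" for p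
  proof
    assume p: "pact T p v = 0"
    have "pact T (p mod m) v = 0"
      using p m T by (simp add: minus_div_mult_eq_mod[symmetric] pact_diff pact_mult lin_0[OF lin_pact])
    then have "p mod m = 0"
      using mmin[of "p mod m"] degree_mod_less[of m p] m(1) by fastforce
    then show "m dvd p" by (simp add: dvd_eq_mod_eq_0)
  qed (use m T pact_dvd_0 in blast)
  define h where "h = Polynomial.smult (inverse (lead_coeff m)) m"
  have h: "monic h" "\<And>p. h dvd p \<longleftrightarrow> m dvd p" 
  proof -
    have c: "inverse (lead_coeff m) \<noteq> 0" using m(1) by simp
    have "lead_coeff h = inverse (lead_coeff m) * lead_coeff m"
      unfolding h_def by (rule lead_coeff_smult)
    then show "monic h" using m(1) by (simp only: left_inverse leading_coeff_0_iff not_False_eq_True)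
    show "h dvd p \<longleftrightarrow> m dvd p" for p
      unfolding h_def using c by (simp only: smult_dvd_iff if_False)
  qed
  show ?thesis
  proof (rule ex1I[of _ h])
    fix h' assume h': "monic h' \<and> (\<forall>p. pact T p v = 0 \<longleftrightarrow> h' dvd p)"
    then have h'': "pact T p v = 0 \<longleftrightarrow> h' dvd p" for p by simp
    have "h' dvd p \<longleftrightarrow> h dvd p" for p using dvd[of p] h(2)[of p] h''[of p] by simp
    from this[of h] this[of h'] have "h' dvd h" "h dvd h'" by simp_all
    moreover have "lead_coeff h' = lead_coeff h" using h' h(1) by simp
    ultimately show "h' = h" by (intro poly_dvd_antisym)
  next
    show "monic h \<and> (\<forall>p. pact T p v = 0 \<longleftrightarrow> h dvd p)"
      using h(1) by (intro conjI allI) (simp_all only: dvd h(2))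
  qed
qed

definition annp :: "('a::field poly \<Rightarrow> 'a poly) \<Rightarrow> 'a poly \<Rightarrow> 'a poly" where
  "annp T v = (THE h. monic h \<and> (\<forall>p. pact T p v = 0 \<longleftrightarrow> h dvd p))"

lemma annp:
  fixes v :: "'a::field poly"
  assumes "lin T" "finite S" "T ` S \<subseteq> S" "v \<in> S"
  shows "monic (annp T v)" "pact T p v = 0 \<longleftrightarrow> annp T v dvd p"
proof -
  have "monic (annp T v) \<and> (\<forall>p. pact T p v = 0 \<longleftrightarrow> annp T v dvd p)"
    unfolding annp_def by (rule theI') (rule ex1_annihilator[OF assms])
  then show "monic (annp T v)" "pact T p v = 0 \<longleftrightarrow> annp T v dvd p" by blast+
qed

lemma coeff_sum_monom: "coeff (\<Sum>i<n. monom (f i) i) j = (if j < n then f j else 0)"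
  by (simp add: coeff_sum)

section \<open>Cardinality of the space of row vectors\<close>

lemma bij_betw_cspace: 
  "bij_betw (\<lambda>v. restrict (coeff v) {..<n}) (cspace n :: 'a::comm_monoid_add poly set) ({..<n} \<rightarrow>\<^sub>E UNIV)"
proof (rule bij_betwI[where g = "\<lambda>f. \<Sum>i<n. monom (f i) i"])
  show "(\<lambda>v. restrict (coeff v) {..<n}) \<in> (cspace n :: 'a poly set) \<rightarrow> {..<n} \<rightarrow>\<^sub>E UNIV" by simp
  show "(\<lambda>f. \<Sum>i<n. monom (f i) i) \<in> ({..<n} \<rightarrow>\<^sub>E UNIV) \<rightarrow> (cspace n :: 'a poly set)"
    by (simp add: cspace_def coeff_sum_monom)
  show "(\<Sum>i<n. monom (restrict (coeff v) {..<n} i) i) = v" if "v \<in> cspace n" for v :: "'a poly"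
    by (rule poly_eqI) (use that in \<open>simp add: cspace_def coeff_sum_monom\<close>)
  show "restrict (coeff (\<Sum>i<n. monom (f i) i)) {..<n} = f" if "f \<in> {..<n} \<rightarrow>\<^sub>E UNIV" for f :: "nat \<Rightarrow> 'a"
    by (rule PiE_ext[OF _ that]) (simp_all add: coeff_sum_monom)
qed

lemma finite_cspace [simp]: "finite (cspace n :: 'a::{comm_monoid_add,finite} poly set)"
  using bij_betw_finite[OF bij_betw_cspace[where 'a='a]] by (simp add: finite_PiE)

lemma card_cspace: "card (cspace n :: 'a::{comm_monoid_add,finite} poly set) = CARD('a) ^ n"
  using bij_betw_same_card[OF bij_betw_cspace[where 'a='a]] by (simp add: card_PiE)

lemma cspace_iff: "p \<in> cspace d \<longleftrightarrow> p = 0 \<or> degree p < d"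
  by (auto simp: cspace_def coeff_eq_0) (metis leading_coeff_0_iff not_less)

section \<open>Counting matrices with a prescribed invariant subspace\<close>

text \<open>Two readings are used: the linear combination of the vectors \<open>E\<close> with
  coefficients read from \<open>c\<close>, and the product of the row vector \<open>c\<close> with
  the matrix whose rows are \<open>E\<close>. Coefficients from \<open>l\<close> on are ignored, so
  the map is linear on the whole type.\<close>

definition lcomb :: "nat \<Rightarrow> (nat \<Rightarrow> 'a::comm_ring_1 poly) \<Rightarrow> 'a poly \<Rightarrow> 'a poly" where
  "lcomb l E c = (\<Sum>i<l. scl (coeff c i) (E i))"

text \<open>Rows from \<open>l\<close> on are 0 so that a family is determined by its first
  \<open>l\<close> rows and can be counted. \<open>row_fams n n\<close> plays the part of the
  \<open>n\<close> by \<open>n\<close> matrices.\<close>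

definition row_fams :: "nat \<Rightarrow> nat \<Rightarrow> (nat \<Rightarrow> 'a::zero poly) set" where
  "row_fams l n = {E. (\<forall>i<l. E i \<in> cspace n) \<and> (\<forall>i\<ge>l. E i = 0)}"

definition indep :: "nat \<Rightarrow> (nat \<Rightarrow> 'a::comm_ring_1 poly) \<Rightarrow> bool" where
  "indep l E \<longleftrightarrow> (\<forall>c\<in>cspace l. lcomb l E c = 0 \<longrightarrow> c = 0)"

definition indeps :: "nat \<Rightarrow> nat \<Rightarrow> (nat \<Rightarrow> 'a::comm_ring_1 poly) set" where
  "indeps l n = {E \<in> row_fams l n. indep l E}"

abbreviation span_rows :: "nat \<Rightarrow> (nat \<Rightarrow> 'a::comm_ring_1 poly) \<Rightarrow> 'a poly set" where
  "span_rows l E \<equiv> lcomb l E ` cspace l"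

text \<open>\<open>P\<close> puts coordinates on the quotient of \<open>cspace n\<close> by the span
  of \<open>E\<close>, so that a quotient is again a space of row vectors.\<close>

definition is_quot :: "nat \<Rightarrow> nat \<Rightarrow> (nat \<Rightarrow> 'a::comm_ring_1 poly) \<Rightarrow> ('a poly \<Rightarrow> 'a poly) \<Rightarrow> bool" where
  "is_quot n l E P \<longleftrightarrow> lin P \<and> P ` cspace n = cspace (n - l) \<and>
     (\<forall>v\<in>cspace n. P v = 0 \<longleftrightarrow> v \<in> span_rows l E)"

lemma lin_lcomb: "lin (lcomb l E)"
  by (auto simp: lin_def lcomb_def smult_add_left sum.distrib scl_sum)

lemma lcomb_closed: "subsp S \<Longrightarrow> (\<And>i. i < l \<Longrightarrow> E i \<in> S) \<Longrightarrow> lcomb l E c \<in> S"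
  unfolding lcomb_def by (rule subsp_sum) (auto intro: subspD)

lemma lcomb_rows: "E \<in> row_fams l n \<Longrightarrow> lcomb l E c \<in> cspace n"
  by (rule lcomb_closed[OF subsp_cspace]) (auto simp: row_fams_def)

lemma monom_cspace: "i < l \<Longrightarrow> monom c i \<in> cspace l"
  by (auto simp: cspace_def)

lemma lcomb_monom: 
  assumes "i < l"
  shows "lcomb l E (monom 1 i) = E i"
proof -
  have "lcomb l E (monom 1 i) = (\<Sum>j<l. if i = j then E j else 0)"
    unfolding lcomb_def by (rule sum.cong) auto
  then show ?thesis using assms by simp
qed

lemma lcomb_unit:
  assumes "c \<in> cspace m" "\<And>j. j < m \<Longrightarrow> F j = monom 1 j"
  shows "lcomb m F c = c"
proof (rule poly_eqI)
  fix k
  have "lcomb m F c = (\<Sum>j<m. monom (coeff c j) j)"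
    unfolding lcomb_def by (rule sum.cong) (auto simp: assms(2) smult_monom)
  then show "coeff (lcomb m F c) k = coeff c k"
    using assms(1) by (simp add: coeff_sum_monom cspace_def)
qed

lemma lin_lcomb_commute: "lin P \<Longrightarrow> P (lcomb l E c) = lcomb l (P \<circ> E) c"
  by (simp add: lcomb_def lin_sum lin_scl)

lemma lcomb_cong: "(\<And>i. i < l \<Longrightarrow> E i = E' i) \<Longrightarrow> lcomb l E c = lcomb l E' c"
  by (simp add: lcomb_def)

lemma inj_on_lcomb: "indep l E \<Longrightarrow> inj_on (lcomb l E) (cspace l)"
proof (rule inj_onI)
  fix x y assume i: "indep l E" and xy: "x \<in> cspace l" "y \<in> cspace l" "lcomb l E x = lcomb l E y"
  have "lcomb l E (x - y) = 0" using xy(3) lin_lcomb[of l E] by (simp add: lin_diff)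
  moreover have "x - y \<in> cspace l" using xy subsp_cspace subsp_diff by blast
  ultimately show "x = y" using i by (auto simp: indep_def)
qed

lemma card_span_rows:
  "indep l (E :: nat \<Rightarrow> 'a::{field,finite} poly) \<Longrightarrow> card (span_rows l E) = CARD('a) ^ l"
  by (simp add: card_image inj_on_lcomb card_cspace)

lemma card_field_gt_1: "CARD('a::{field,finite}) > 1"
  using card_mono[of UNIV "{0, 1 :: 'a}"] by simp

lemma indep_le:
  assumes "(E :: nat \<Rightarrow> 'a::{field,finite} poly) \<in> indeps l n"
  shows "l \<le> n" "CARD('a) ^ l \<le> CARD('a) ^ n"
proof -
  have "span_rows l E \<subseteq> cspace n" using assms lcomb_rows by (auto simp: indeps_def)
  then have "card (span_rows l E) \<le> card (cspace n :: 'a poly set)"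
    by (intro card_mono) auto
  then show *: "CARD('a) ^ l \<le> CARD('a) ^ n"
    using assms by (simp add: indeps_def card_span_rows card_cspace)
  show "l \<le> n" using * card_field_gt_1[where 'a='a] by simp
qed

lemma rows_bij:
  "bij_betw (\<lambda>E. restrict E {..<l}) (row_fams l n) ({..<l} \<rightarrow>\<^sub>E cspace n)"
proof (rule bij_betwI[where g = "\<lambda>E i. if i < l then E i else 0"])
  show "(\<lambda>E. restrict E {..<l}) \<in> row_fams l n \<rightarrow> {..<l} \<rightarrow>\<^sub>E cspace n"
    by (intro Pi_I) (simp add: row_fams_def)
  show "(\<lambda>E i. if i < l then E i else 0) \<in> ({..<l} \<rightarrow>\<^sub>E cspace n) \<rightarrow> row_fams l n"
    by (intro Pi_I) (auto simp: row_fams_def dest: PiE_mem)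
  show "(\<lambda>i. if i < l then restrict E {..<l} i else 0) = E" if "E \<in> row_fams l n" for E
    by (rule ext) (use that in \<open>simp add: row_fams_def\<close>)
  show "restrict (\<lambda>i. if i < l then E i else 0) {..<l} = E" if "E \<in> {..<l} \<rightarrow>\<^sub>E cspace n" for E
  proof -
    have "restrict (\<lambda>i. if i < l then E i else 0) {..<l} = restrict E {..<l}"
      by (rule restrict_ext) simp
    then show ?thesis using PiE_restrict[OF that] by simp
  qed
qed

lemma finite_rows [simp]: "finite (row_fams l n :: (nat \<Rightarrow> 'a::{comm_monoid_add,finite} poly) set)"
  using bij_betw_finite[OF rows_bij[where 'a='a]] by (simp add: finite_PiE)

lemma finite_indeps [simp]: "finite (indeps l n :: (nat \<Rightarrow> 'a::{field,finite} poly) set)"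
  by (simp add: indeps_def)

lemma lcomb_Suc: "lcomb (Suc l) E c = lcomb l E c + scl (coeff c l) (E l)"
  by (simp add: lcomb_def)

lemma lcomb_cutoff: "lcomb l E (poly_cutoff l c) = lcomb l E c"
  by (simp add: lcomb_def coeff_poly_cutoff)

lemma poly_cutoff_cspace: "poly_cutoff l c \<in> cspace l"
  by (simp add: cspace_def coeff_poly_cutoff)

lemma lin_poly_cutoff: "lin (poly_cutoff n)"
  by (auto simp: lin_def poly_eq_iff coeff_poly_cutoff)

lemma indeps_restrict:
  assumes "E \<in> indeps (Suc l) n"
  shows "E(l := 0) \<in> indeps l n" "E l \<in> cspace n - span_rows l (E(l := 0))"
proof -
  have E: "E \<in> row_fams (Suc l) n" "indep (Suc l) E" using assms by (auto simp: indeps_def)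
  have eq: "lcomb l (E(l := 0)) c = lcomb l E c" for c by (rule lcomb_cong) auto
  have "c = 0" if "c \<in> cspace l" "lcomb l E c = 0" for c
  proof -
    have "c \<in> cspace (Suc l)" "coeff c l = 0" using that by (auto simp: cspace_def)
    then show ?thesis using that E(2) by (simp add: indep_def lcomb_Suc)
  qed
  then show "E(l := 0) \<in> indeps l n"
    using E(1) by (auto simp: indeps_def indep_def eq row_fams_def)
  have False if "c \<in> cspace l" "E l = lcomb l E c" for c
  proof -
    have c: "c \<in> cspace (Suc l)" "coeff c l = 0" using that by (auto simp: cspace_def)
    have "lcomb (Suc l) E (c - monom 1 l) = lcomb (Suc l) E c - lcomb (Suc l) E (monom 1 l)"
      by (rule lin_diff[OF lin_lcomb])
    also have "\<dots> = 0" using that(2) c(2) by (subst lcomb_monom) (simp_all add: lcomb_Suc)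
    finally have "lcomb (Suc l) E (c - monom 1 l) = 0" .
    moreover have "c - monom 1 l \<in> cspace (Suc l)"
      using c(1) by (simp add: subsp_diff[OF subsp_cspace] monom_cspace)
    ultimately have "c - monom 1 l = 0" using E(2) unfolding indep_def by blast
    then have "coeff (c - monom 1 l) l = 0" by simp
    then show False using c by simp
  qed
  then show "E l \<in> cspace n - span_rows l (E(l := 0))"
    using E(1) by (auto simp: eq row_fams_def)
qed

lemma indeps_extend:
  assumes "E \<in> indeps l n" "w \<in> cspace n - span_rows l (E :: nat \<Rightarrow> 'a::field poly)"
  shows "E(l := w) \<in> indeps (Suc l) n"
proof -
  have E: "E \<in> row_fams l n" "indep l E" using assms by (auto simp: indeps_def)
  have eq: "lcomb l (E(l := w)) c = lcomb l E c" for c by (rule lcomb_cong) auto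
  have "c = 0" if c: "c \<in> cspace (Suc l)" "lcomb l E c + scl (coeff c l) w = 0" for c
  proof (cases "coeff c l = 0")
    case True
    then have "c \<in> cspace l" using c(1) unfolding cspace_def
      by (intro CollectI allI impI) (metis (mono_tags, lifting) le_neq_implies_less mem_Collect_eq Suc_leI)
    then show ?thesis using c(2) True E(2) by (simp add: indep_def)
  next
    case False
    have "w = scl (inverse (coeff c l)) (scl (coeff c l) w)" using False by simp
    also have "scl (coeff c l) w = - lcomb l E c" using c(2) by (simp add: eq_neg_iff_add_eq_0 add.commute)
    also have "scl (inverse (coeff c l)) (- lcomb l E c) = lcomb l E (poly_cutoff l (scl (- inverse (coeff c l)) c))"
      by (simp add: lcomb_cutoff lin_uminus[OF lin_lcomb] lin_scl[OF lin_lcomb])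
    finally have "w \<in> span_rows l E" using poly_cutoff_cspace by blast
    then show ?thesis using assms(2) by blast
  qed
  then show ?thesis using E(1) assms(2)
    by (auto simp: indeps_def row_fams_def indep_def lcomb_Suc eq less_Suc_eq)
qed

text \<open>The number of ordered independent \<open>l\<close>-tuples in dimension \<open>n\<close>
  over a field with \<open>q\<close> elements; \<open>indep_count q n n\<close> is the order of
  GL(n,q). For \<open>l > n\<close> the factor \<open>i = n\<close> makes it 0.\<close>

definition indep_count :: "nat \<Rightarrow> nat \<Rightarrow> nat \<Rightarrow> real" where
  "indep_count q n l = (\<Prod>i<l. real q ^ n - real q ^ i)"

lemma card_indeps_le:
  "real (card (indeps l n :: (nat \<Rightarrow> 'a::{field,finite} poly) set)) \<le> indep_count CARD('a) n l"
proof (induction l)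
  case 0
  have "row_fams 0 n = {\<lambda>_. 0 :: 'a poly}" by (auto simp: row_fams_def)
  then have "indeps 0 n \<subseteq> {\<lambda>_. 0 :: 'a poly}" by (auto simp: indeps_def)
  then have "card (indeps 0 n :: (nat \<Rightarrow> 'a poly) set) \<le> 1"
    using card_mono[of "{\<lambda>_. 0 :: 'a poly}" "indeps 0 n"] by simp
  then show ?case by (simp add: indep_count_def)
next
  case (Suc l)
  let ?I = "indeps l n :: (nat \<Rightarrow> 'a poly) set"
  let ?S = "SIGMA E:?I. cspace n - span_rows l E"
  have "inj_on (\<lambda>E. (E(l := 0), E l)) (indeps (Suc l) n :: (nat \<Rightarrow> 'a poly) set)"
    by (rule inj_onI) (metis fun_upd_triv fun_upd_upd prod.inject)
  then have "card (indeps (Suc l) n :: (nat \<Rightarrow> 'a poly) set) \<le> card ?S"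
  proof (rule card_inj_on_le)
    show "(\<lambda>E. (E(l := 0), E l)) ` indeps (Suc l) n \<subseteq> ?S"
      using indeps_restrict by (intro image_subsetI SigmaI) blast+
  qed (auto intro!: finite_SigmaI)
  also have "card ?S = (\<Sum>E\<in>?I. card (cspace n - span_rows l E))"
    by (rule card_SigmaI) auto
  finally have "real (card (indeps (Suc l) n :: (nat \<Rightarrow> 'a poly) set)) \<le> (\<Sum>E\<in>?I. real (card (cspace n - span_rows l E)))"
    by (metis of_nat_le_iff of_nat_sum)
  also have "\<dots> = (\<Sum>E\<in>?I. real CARD('a) ^ n - real CARD('a) ^ l)"
  proof (rule sum.cong[OF refl])
    fix E assume E: "E \<in> ?I"
    have "card (cspace n - span_rows l E) = card (cspace n :: 'a poly set) - card (span_rows l E)"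
      by (rule card_Diff_subset) (use E lcomb_rows in \<open>auto simp: indeps_def\<close>)
    then show "real (card (cspace n - span_rows l E)) = real CARD('a) ^ n - real CARD('a) ^ l"
      using E indep_le(2)[OF E] by (simp add: card_cspace card_span_rows indeps_def of_nat_diff)
  qed
  also have "\<dots> = real (card ?I) * (real CARD('a) ^ n - real CARD('a) ^ l)" by simp
  \<comment> \<open>Multiplying the induction hypothesis needs a nonnegative factor, which a
    nonempty set of families provides. If there is none, the right side only has to be nonnegative:
    by its factors for \<open>l < n\<close>, by a zero factor otherwise.\<close>
  also have "\<dots> \<le> indep_count CARD('a) n (Suc l)"
  proof (cases "?I = {}")
    case True
    have "indep_count CARD('a) n (Suc l) \<ge> 0"
    proof (cases "l < n")
      case True
      then show ?thesis unfolding indep_count_def by (intro prod_nonneg) (auto intro!: power_increasing)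
    next
      case False
      then have "indep_count CARD('a) n (Suc l) = 0" unfolding indep_count_def by (intro prod_zero) auto
      then show ?thesis by simp
    qed
    then show ?thesis using True by simp
  next
    case False
    then have "real CARD('a) ^ l \<le> real CARD('a) ^ n" using indep_le(2) by (metis ex_in_conv of_nat_le_iff of_nat_power)
    then show ?thesis using Suc unfolding indep_count_def by (simp add: mult_right_mono)
  qed
  finally show ?case .
qed

text \<open>The span of \<open>m < n\<close> independent vectors has only \<open>q^m < q^n\<close>
  elements, so there is a vector outside it.\<close>

lemma ex_indeps_full:
  fixes E :: "nat \<Rightarrow> 'a::{field,finite} poly"
  assumes "E \<in> indeps l n"
  shows "\<exists>E'\<in>indeps n n. \<forall>i<l. E' i = E i"
proof -
  have "\<exists>E'\<in>indeps m n. \<forall>i<l. E' i = E i" if "l \<le> m" "m \<le> n" for m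
    using that
  proof (induction m rule: dec_induct)
    case base
    then show ?case using assms by blast
  next
    case (step m)
    then obtain E' where E': "E' \<in> indeps m n" "\<forall>i<l. E' i = E i" by auto
    have "card (span_rows m E') < card (cspace n :: 'a poly set)"
      using E'(1) step card_field_gt_1[where 'a='a] by (simp add: card_cspace card_span_rows indeps_def)
    then have "\<not> cspace n \<subseteq> span_rows m E'"
      using card_mono[of "span_rows m E'" "cspace n"] by auto
    then obtain w where "w \<in> cspace n - span_rows m E'" by blast
    then have "E'(m := w) \<in> indeps (Suc m) n" using E' indeps_extend by blast
    then show ?case using E'(2) step by (intro bexI[of _ "E'(m := w)"]) auto
  qed
  then show ?thesis using indep_le(1)[OF assms] by blast
qed

text \<open>Extend \<open>E\<close> to a basis, pass to coordinates and drop the first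
  \<open>l\<close> of them; the added basis vectors are the lifts \<open>F\<close> of the unit
  vectors.\<close>

lemma ex_quot:
  fixes E :: "nat \<Rightarrow> 'a::{field,finite} poly"
  assumes E: "E \<in> indeps l n"
  shows "\<exists>P F. is_quot n l E P \<and> (\<forall>j<n-l. F j \<in> cspace n \<and> P (F j) = monom 1 j)"
proof -
  note ln = indep_le(1)[OF E]
  obtain E' where E': "E' \<in> indeps n n" "\<forall>i<l. E' i = E i"
    using ex_indeps_full[OF E] by blast
  define L where "L = lcomb n E'"
  have inj: "inj_on L (cspace n)" using E' unfolding L_def by (intro inj_on_lcomb) (simp add: indeps_def)
  have "L ` cspace n \<subseteq> cspace n" using E' lcomb_rows by (auto simp: L_def indeps_def)
  then have bij: "bij_betw L (cspace n) (cspace n)"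
    using inj by (metis bij_betw_def card_image card_subset_eq finite_cspace)
  define G where "G = inv_into (cspace n) L"
  have GL: "G (L c) = c" if "c \<in> cspace n" for c
    unfolding G_def using inj that by simp
  have LG: "L (G v) = v" "G v \<in> cspace n" if "v \<in> cspace n" for v
    unfolding G_def using that bij by (auto simp: bij_betw_def f_inv_into_f inv_into_into)
  have linL: "lin L" unfolding L_def by (rule lin_lcomb)
  have Gadd: "G (u + v) = G u + G v" if "u \<in> cspace n" "v \<in> cspace n" for u v
  proof -
    have "L (G u + G v) = u + v" using that LG linL by (simp add: lin_add)
    moreover have "G u + G v \<in> cspace n" using that LG subspD(2)[OF subsp_cspace] by blast
    ultimately show ?thesis using GL by metis
  qed
  have Gscl: "G (scl c v) = scl c (G v)" if "v \<in> cspace n" for c v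
  proof -
    have "L (scl c (G v)) = scl c v" using that LG linL by (simp add: lin_scl)
    moreover have "scl c (G v) \<in> cspace n" using that LG subspD(3)[OF subsp_cspace] by blast
    ultimately show ?thesis using GL by metis
  qed
  \<comment> \<open>\<open>G\<close> is additive only on \<open>cspace n\<close>, while
    \<open>is_quot\<close> asks for linearity on the whole type; hence the truncation before
    \<open>G\<close>.\<close>
  define P where "P v = poly_shift l (G (poly_cutoff n v))" for v
  have cut: "poly_cutoff n v = v" if "v \<in> cspace n" for v :: "'a poly"
    using that by (intro poly_eqI) (simp add: coeff_poly_cutoff cspace_def)
  have PL: "P (L c) = poly_shift l c" if "c \<in> cspace n" for c
  proof -
    have "L c \<in> cspace n" using that bij bij_betwE by blast
    then show ?thesis using GL[OF that] by (simp add: P_def cut)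
  qed
  have linP: "lin P"
    unfolding lin_def P_def
  proof (intro conjI allI)
    fix u v c
    have "G (poly_cutoff n (u + v)) = G (poly_cutoff n u) + G (poly_cutoff n v)"
      by (simp only: lin_add[OF lin_poly_cutoff] Gadd[OF poly_cutoff_cspace poly_cutoff_cspace])
    then show "poly_shift l (G (poly_cutoff n (u + v))) = poly_shift l (G (poly_cutoff n u)) + poly_shift l (G (poly_cutoff n v))"
      by (simp add: poly_eq_iff coeff_poly_shift)
    have "G (poly_cutoff n (scl c v)) = scl c (G (poly_cutoff n v))"
      by (simp only: lin_scl[OF lin_poly_cutoff] Gscl[OF poly_cutoff_cspace])
    then show "poly_shift l (G (poly_cutoff n (scl c v))) = scl c (poly_shift l (G (poly_cutoff n v)))"
      by (simp add: poly_eq_iff coeff_poly_shift)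
  qed
  have Pim: "P v \<in> cspace (n - l)" if "v \<in> cspace n" for v
    using LG(2)[OF that] unfolding P_def cut[OF that] by (auto simp: cspace_def coeff_poly_shift)
  define F where "F j = E' (l + j)" for j
  have F: "F j \<in> cspace n \<and> P (F j) = monom 1 j" if "j < n - l" for j
  proof
    show "F j \<in> cspace n" using E'(1) that by (auto simp: F_def indeps_def row_fams_def)
    have "F j = L (monom 1 (l + j))" using that by (simp add: F_def L_def lcomb_monom)
    then have "P (F j) = poly_shift l (monom 1 (l + j))" using that by (simp add: PL monom_cspace)
    then show "P (F j) = monom 1 j" by (simp add: poly_eq_iff coeff_poly_shift)
  qed
  have surj: "P ` cspace n = cspace (n - l)"
  proof
    show "cspace (n - l) \<subseteq> P ` cspace n"
    proof
      fix c :: "'a poly" assume c: "c \<in> cspace (n - l)"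
      have "P (lcomb (n - l) F c) = lcomb (n - l) (P \<circ> F) c" by (rule lin_lcomb_commute[OF linP])
      also have "\<dots> = c" by (rule lcomb_unit[OF c]) (simp add: F)
      finally show "c \<in> P ` cspace n"
        using lcomb_closed[OF subsp_cspace, of "n - l" F n c] F by force
    qed
  qed (use Pim in blast)
  have LlE: "L c = lcomb l E c" if "c \<in> cspace l" for c
  proof -
    have "L c = (\<Sum>i<l. scl (coeff c i) (E' i))" unfolding L_def lcomb_def
      by (rule sum.mono_neutral_right) (use ln that in \<open>auto simp: cspace_def\<close>)
    also have "\<dots> = lcomb l E c" unfolding lcomb_def by (rule sum.cong) (use E'(2) in auto)
    finally show ?thesis .
  qed
  have sub: "c \<in> cspace n" if "c \<in> cspace l" for c :: "'a poly"
    using that ln by (auto simp: cspace_def)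
  have "P v = 0 \<longleftrightarrow> v \<in> span_rows l E" if v: "v \<in> cspace n" for v
  proof
    assume "P v = 0"
    then have "poly_shift l (G v) = 0" by (simp add: P_def cut v)
    then have *: "coeff (G v) (i + l) = 0" for i by (metis coeff_0 coeff_poly_shift)
    have "coeff (G v) i = 0" if "l \<le> i" for i using *[of "i - l"] that by simp
    then have Gl: "G v \<in> cspace l" by (simp add: cspace_def)
    have "v = lcomb l E (G v)" using LG(1)[OF v] LlE[OF Gl] by simp
    then show "v \<in> span_rows l E" using Gl by blast
  next
    assume "v \<in> span_rows l E"
    then obtain c where c: "c \<in> cspace l" "v = lcomb l E c" by blast
    then have "P v = poly_shift l c" using PL[OF sub[OF c(1)]] LlE[OF c(1)] by simp
    then show "P v = 0" using c(1) by (simp add: poly_eq_iff coeff_poly_shift cspace_def)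
  qed
  then have "is_quot n l E P" using linP surj unfolding is_quot_def by blast
  then show ?thesis using F by blast
qed

text \<open>In a basis that begins with \<open>E\<close> the matrix \<open>X\<close> is block
  triangular. \<open>det\<close> fixes the block on the span of \<open>E\<close>, \<open>quo\<close>
  puts the quotient block into \<open>BB\<close>, and the off-diagonal block consists of
  \<open>n - l\<close> vectors of the span, which gives \<open>q^(l (n-l))\<close>. The factor
  \<open>indep_count\<close> bounds the number of families \<open>E\<close>.\<close>

lemma count_pairs:
  fixes Z :: "((nat \<Rightarrow> 'a::{field,finite} poly) \<times> (nat \<Rightarrow> 'a poly)) set"
  assumes Z: "Z \<subseteq> row_fams n n \<times> indeps l n"
    and inv: "\<And>X E. (X, E) \<in> Z \<Longrightarrow> lcomb n X ` span_rows l E \<subseteq> span_rows l E"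
    and det: "\<And>X X' E i. (X, E) \<in> Z \<Longrightarrow> (X', E) \<in> Z \<Longrightarrow> i < l \<Longrightarrow> lcomb n X (E i) = lcomb n X' (E i)"
    and quo: "\<And>X E P B. (X, E) \<in> Z \<Longrightarrow> is_quot n l E P \<Longrightarrow> B \<in> row_fams (n - l) (n - l) \<Longrightarrow>
      (\<forall>v\<in>cspace n. P (lcomb n X v) = lcomb (n - l) B (P v)) \<Longrightarrow> B \<in> BB"
    and fin: "finite BB"
  shows "real (card Z) \<le> indep_count CARD('a) n l * real CARD('a) ^ (l * (n - l)) * real (card BB)"
proof -
  let ?q = "CARD('a)"
  have fiber: "card {X. (X, E) \<in> Z} \<le> ?q ^ (l * (n - l)) * card BB" if E: "E \<in> indeps l n" for E
  proof -
    let ?A = "{X. (X, E) \<in> Z}" and ?W = "span_rows l E"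
    obtain P F where P: "is_quot n l E P" and F: "\<And>j. j < n - l \<Longrightarrow> F j \<in> cspace n"
      "\<And>j. j < n - l \<Longrightarrow> P (F j) = monom 1 j" using ex_quot[OF E] by blast
    have linP: "lin P" using P by (simp add: is_quot_def)
    have PF: "P (lcomb (n - l) F c) = c" if "c \<in> cspace (n - l)" for c
      using lin_lcomb_commute[OF linP, of "n - l" F c] lcomb_unit[OF that, of "P \<circ> F"] F by simp
    have Fc: "lcomb (n - l) F c \<in> cspace n" for c
      using F by (intro lcomb_closed[OF subsp_cspace]) auto
    have Pc: "P v \<in> cspace (n - l)" if "v \<in> cspace n" for v using P that by (auto simp: is_quot_def)
    have dec: "v - lcomb (n - l) F (P v) \<in> ?W" if v: "v \<in> cspace n" for v
    proof -
      have "P (v - lcomb (n - l) F (P v)) = 0" using PF[OF Pc[OF v]] linP by (simp add: lin_diff)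
      moreover have "v - lcomb (n - l) F (P v) \<in> cspace n" using v Fc by (intro subsp_diff[OF subsp_cspace])
      ultimately show ?thesis using P by (simp add: is_quot_def)
    qed
    define B where "B X j = (if j < n - l then P (lcomb n X (F j)) else 0)" for X j
    \<comment> \<open>The off-diagonal block: the difference between the image of a lift and the
      lift of the image in the quotient.\<close>
    define R where "R X = restrict (\<lambda>j. lcomb n X (F j) - lcomb (n - l) F (B X j)) {..<n-l}" for X
    have Xr: "lcomb n X v \<in> cspace n" if "X \<in> ?A" for X v using that Z by (auto intro: lcomb_rows)
    have BX: "B X \<in> BB" if X: "X \<in> ?A" for X
    proof (rule quo[OF _ P])
      show "(X, E) \<in> Z" using X by simp
      show "B X \<in> row_fams (n - l) (n - l)" using Xr[OF X] Pc by (auto simp: row_fams_def B_def)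
      show "\<forall>v\<in>cspace n. P (lcomb n X v) = lcomb (n - l) (B X) (P v)"
      proof
        fix v :: "'a poly" assume v: "v \<in> cspace n"
        define w where "w = v - lcomb (n - l) F (P v)"
        have "w \<in> ?W" using dec[OF v] by (simp add: w_def)
        then have "lcomb n X w \<in> ?W" using inv X by blast
        then have w0: "P (lcomb n X w) = 0" using P Xr[OF X] by (simp add: is_quot_def)
        have "v = lcomb (n - l) F (P v) + w" by (simp add: w_def)
        then have "P (lcomb n X v) = P (lcomb n X (lcomb (n - l) F (P v))) + P (lcomb n X w)"
          using lin_add[OF lin_lcomb] lin_add[OF linP] by metis
        also have "\<dots> = P (lcomb (n - l) (lcomb n X \<circ> F) (P v))"
          using w0 lin_lcomb_commute[OF lin_lcomb, of n X "n - l" F "P v"] by simp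
        also have "\<dots> = lcomb (n - l) (P \<circ> (lcomb n X \<circ> F)) (P v)"
          by (rule lin_lcomb_commute[OF linP])
        also have "\<dots> = lcomb (n - l) (B X) (P v)" by (rule lcomb_cong) (simp add: B_def)
        finally show "P (lcomb n X v) = lcomb (n - l) (B X) (P v)" .
      qed
    qed
    have RX: "R X \<in> {..<n-l} \<rightarrow>\<^sub>E ?W" if X: "X \<in> ?A" for X
      unfolding R_def using dec[OF Xr[OF X]] by (intro restrict_PiE_iff[THEN iffD2]) (auto simp: B_def)
    have inj: "inj_on (\<lambda>X. (B X, R X)) ?A"
    proof (rule inj_onI)
      fix X X' assume X: "X \<in> ?A" and X': "X' \<in> ?A" and "(B X, R X) = (B X', R X')"
      then have BR: "B X = B X'" "R X = R X'" by auto
      have eqF: "lcomb n X (F j) = lcomb n X' (F j)" if "j < n - l" for j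
        using fun_cong[OF BR(2), of j] that BR(1) by (simp add: R_def)
      have eqE: "lcomb n X (E i) = lcomb n X' (E i)" if "i < l" for i
        using det[of X E X' i] X X' that by blast
      have eqW: "lcomb n X (lcomb l E c) = lcomb n X' (lcomb l E c)" for c
      proof -
        have "lcomb n X (lcomb l E c) = lcomb l (lcomb n X \<circ> E) c" by (rule lin_lcomb_commute[OF lin_lcomb])
        also have "\<dots> = lcomb l (lcomb n X' \<circ> E) c"
          by (rule lcomb_cong) (simp only: comp_apply eqE)
        finally show ?thesis using lin_lcomb_commute[OF lin_lcomb, of n X' l E c] by simp
      qed
      have eq: "lcomb n X v = lcomb n X' v" if v: "v \<in> cspace n" for v
      proof -
        obtain c where c: "v - lcomb (n - l) F (P v) = lcomb l E c" using dec[OF v] by blast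
        then have v': "v = lcomb (n - l) F (P v) + lcomb l E c" by (simp add: algebra_simps)
        have "lcomb n X (lcomb (n - l) F (P v)) = lcomb (n - l) (lcomb n X \<circ> F) (P v)"
          by (rule lin_lcomb_commute[OF lin_lcomb])
        also have "\<dots> = lcomb (n - l) (lcomb n X' \<circ> F) (P v)" 
          by (rule lcomb_cong) (simp only: comp_apply eqF)
        also have "\<dots> = lcomb n X' (lcomb (n - l) F (P v))"
          by (rule lin_lcomb_commute[OF lin_lcomb, symmetric])
        finally show ?thesis
          by (subst (1 2) v') (simp only: lin_add[OF lin_lcomb] eqW)
      qed
      have "X i = X' i" for i
      proof (cases "i < n")
        case True
        then show ?thesis using eq[of "monom 1 i"] by (simp add: lcomb_monom monom_cspace)
      next
        case False
        moreover have "X \<in> row_fams n n" "X' \<in> row_fams n n" using X X' Z by auto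
        ultimately show ?thesis by (simp add: row_fams_def)
      qed
      then show "X = X'" by (rule ext)
    qed
    have "card ?A \<le> card (BB \<times> ({..<n-l} \<rightarrow>\<^sub>E ?W))"
    proof (rule card_inj_on_le[OF inj])
      show "(\<lambda>X. (B X, R X)) ` ?A \<subseteq> BB \<times> ({..<n-l} \<rightarrow>\<^sub>E ?W)" using BX RX by blast
      show "finite (BB \<times> ({..<n-l} \<rightarrow>\<^sub>E ?W))" using fin by (intro finite_cartesian_product finite_PiE) auto
    qed
    also have "\<dots> = card BB * (?q ^ l) ^ (n - l)"
      using E by (simp add: card_cartesian_product card_PiE card_span_rows indeps_def)
    finally show ?thesis by (simp add: power_mult mult.commute)
  qed
  let ?I = "indeps l n :: (nat \<Rightarrow> 'a poly) set"
  have finZ: "finite {X. (X, E) \<in> Z}" for E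
    by (rule finite_subset[of _ "row_fams n n"]) (use Z in auto)
  have "card Z \<le> card (SIGMA E:?I. {X. (X, E) \<in> Z})"
  proof (rule card_inj_on_le[of prod.swap])
    show "prod.swap ` Z \<subseteq> (SIGMA E:?I. {X. (X, E) \<in> Z})" using Z by auto
    show "finite (SIGMA E:?I. {X. (X, E) \<in> Z})" using finZ by (intro finite_SigmaI) auto
  qed simp
  also have "\<dots> = (\<Sum>E\<in>?I. card {X. (X, E) \<in> Z})" by (rule card_SigmaI) (auto intro: finZ)
  also have "\<dots> \<le> (\<Sum>E\<in>?I. ?q ^ (l * (n - l)) * card BB)" by (intro sum_mono fiber)
  also have "\<dots> = card ?I * (?q ^ (l * (n - l)) * card BB)" by simp
  finally have "real (card Z) \<le> real (card ?I * (?q ^ (l * (n - l)) * card BB))"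
    by (simp only: of_nat_le_iff)
  also have "\<dots> = real (card ?I) * (real ?q ^ (l * (n - l)) * real (card BB))" by simp
  also have "\<dots> \<le> indep_count ?q n l * (real ?q ^ (l * (n - l)) * real (card BB))"
    by (intro mult_right_mono card_indeps_le) simp
  finally show ?thesis by (simp add: mult.assoc)
qed

section \<open>Kernels, primary parts and quotients\<close>

definition mirr :: "'a::field poly \<Rightarrow> bool" where
  "mirr g \<longleftrightarrow> monic g \<and> irreducible g"

lemma mirr_degree: "mirr g \<Longrightarrow> degree g > 0"
  using is_unit_iff_degree[of g] unfolding mirr_def irreducible_def by auto

lemma mirr_neq_0: "mirr g \<Longrightarrow> g \<noteq> 0"
  unfolding mirr_def by auto

text \<open>A nonzero \<open>d\<close> of least degree in the ideal generated by \<open>g\<close>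
  and \<open>p\<close> divides both. Irreducibility of \<open>g\<close> leaves a unit or an
  associate of \<open>g\<close>, and the latter would make \<open>g\<close> divide
  \<open>p\<close>.\<close>

lemma mirr_bezout:
  fixes g p :: "'a::field poly"
  assumes g: "mirr g" and p: "\<not> g dvd p"
  shows "\<exists>a b. a * g + b * p = 1"
proof -
  define I where "I x \<longleftrightarrow> x \<noteq> 0 \<and> (\<exists>a b. x = a * g + b * p)" for x
  have "I g" unfolding I_def using mirr_neq_0[OF g] by (intro conjI exI[of _ 1] exI[of _ 0]) simp_all
  then obtain d where d: "I d" "\<And>y. I y \<Longrightarrow> degree d \<le> degree y"
    using ex_has_least_nat[of I g degree] by blast
  obtain a b where ab: "d = a * g + b * p" using d(1) unfolding I_def by blast
  have d0: "d \<noteq> 0" using d(1) unfolding I_def by blast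
  have dvd: "d dvd x" if x: "x = a' * g + b' * p" for x a' b'
  proof (rule ccontr)
    assume nd: "\<not> d dvd x"
    have "x mod d = x - x div d * d" by (rule minus_div_mult_eq_mod[symmetric])
    also have "\<dots> = (a' - x div d * a) * g + (b' - x div d * b) * p"
      unfolding x ab by (simp add: algebra_simps)
    finally have "\<exists>a b. x mod d = a * g + b * p" by blast
    moreover have "x mod d \<noteq> 0" using nd by (simp add: dvd_eq_mod_eq_0)
    ultimately have "I (x mod d)" unfolding I_def by blast
    then have "degree d \<le> degree (x mod d)" by (rule d(2))
    then show False using degree_mod_less_degree[OF d0 nd] by simp
  qed
  have "d dvd g" by (rule dvd[of g 1 0]) simp
  moreover have dp: "d dvd p" by (rule dvd[of p 0 1]) simp
  ultimately have "d dvd 1"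
  proof -
    assume dg: "d dvd g"
    then obtain k where k: "g = d * k" by (rule dvdE)
    then consider "d dvd 1" | "k dvd 1" using g unfolding mirr_def irreducible_def by blast
    then show ?thesis
    proof cases
      case 2
      then have "g dvd d" using k by (simp add: dvd_mult_unit_iff mult_unit_dvd_iff)
      then show ?thesis using p dp dvd_trans by blast
    qed
  qed
  then obtain e where e: "1 = d * e" by (rule dvdE)
  have "(e * a) * g + (e * b) * p = 1" unfolding e ab by (simp add: algebra_simps)
  then show ?thesis by blast
qed

lemma mirr_bezout_pow:
  fixes g p :: "'a::field poly"
  assumes "mirr g" "\<not> g dvd p"
  shows "\<exists>a b. a * g ^ N + b * p = 1"
proof (induction N)
  case 0
  show ?case by (intro exI[of _ 1] exI[of _ 0]) simp
next
  case (Suc N)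
  then obtain a b where ab: "a * g ^ N + b * p = 1" by blast
  obtain a' b' where ab': "a' * g + b' * p = 1" using mirr_bezout[OF assms] by blast
  have "(a * a') * g ^ Suc N + (a * g ^ N * b' + b) * p = a * g ^ N * (a' * g + b' * p) + b * p"
    by (simp add: algebra_simps)
  also have "\<dots> = 1" using ab ab' by simp
  finally show ?case by blast
qed

lemma mirr_not_dvd:
  assumes "mirr g" "mirr g'" "g \<noteq> g'"
  shows "\<not> g dvd g'"
proof
  assume "g dvd g'"
  then obtain k where k: "g' = g * k" by (rule dvdE)
  have "\<not> g dvd 1" using assms(1) unfolding mirr_def irreducible_def by blast
  then have "k dvd 1" using k assms(2) unfolding mirr_def irreducible_def by blast
  then have "g' dvd g" using k by (simp add: mult_unit_dvd_iff)
  then have "g = g'" using \<open>g dvd g'\<close> assms by (intro poly_dvd_antisym) (simp_all add: mirr_def)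
  then show False using assms(3) by simp
qed

lemma monic_unit: "monic h \<Longrightarrow> h dvd 1 \<Longrightarrow> h = (1 :: 'a::field poly)"
  by (rule poly_dvd_antisym) simp_all

text \<open>Either \<open>g\<close> can be cancelled from \<open>h\<close>, which lowers the
  exponent, or a Bezout relation makes \<open>h\<close> divide 1.\<close>

lemma monic_dvd_mirr_power:
  fixes g h :: "'a::field poly"
  assumes g: "mirr g"
  shows "monic h \<Longrightarrow> h dvd g ^ N \<Longrightarrow> \<exists>i\<le>N. h = g ^ i"
proof (induction N arbitrary: h)
  case 0
  then show ?case using monic_unit[of h] by simp
next
  case (Suc N)
  show ?case
  proof (cases "g dvd h")
    case True
    then obtain k where k: "h = g * k" by (rule dvdE)
    have "lead_coeff h = lead_coeff g * lead_coeff k" unfolding k by (rule lead_coeff_mult)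
    then have "monic k" using Suc.prems(1) g by (simp add: mirr_def)
    moreover have "k dvd g ^ N" using Suc.prems(2) k mirr_neq_0[OF g] by simp
    ultimately obtain i where "i \<le> N" "k = g ^ i" using Suc.IH by blast
    then show ?thesis using k by (intro exI[of _ "Suc i"]) simp
  next
    case False
    then obtain a b where "a * g ^ Suc N + b * h = 1" using mirr_bezout_pow[OF g] by blast
    moreover have "h dvd a * g ^ Suc N + b * h" using Suc.prems(2) by (intro dvd_add dvd_mult) simp_all
    ultimately have "h = 1" using monic_unit[OF Suc.prems(1)] by simp
    then show ?thesis by (intro exI[of _ 0]) simp
  qed
qed

lemma ex_mirr_dvd:
  fixes p :: "'a::field poly"
  shows "degree p > 0 \<Longrightarrow> \<exists>g. mirr g \<and> g dvd p"
proof (induction "degree p" arbitrary: p rule: less_induct)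
  case less
  show ?case
  proof (cases "irreducible p")
    case True
    define c where "c = inverse (lead_coeff p)"
    have c: "c \<noteq> 0" using less.prems by (auto simp: c_def)
    have "lead_coeff (Polynomial.smult c p) = c * lead_coeff p" by (rule lead_coeff_smult)
    then have "monic (Polynomial.smult c p)" using c unfolding c_def by simp
    moreover have "irreducible (Polynomial.smult c p)" using True c by simp
    moreover have "Polynomial.smult c p dvd p" using c by (simp add: smult_dvd_iff)
    ultimately show ?thesis unfolding mirr_def by blast
  next
    case False
    have "p \<noteq> 0" "\<not> p dvd 1" using less.prems by (auto simp: is_unit_iff_degree)
    then obtain a b where ab: "p = a * b" "\<not> a dvd 1" "\<not> b dvd 1"
      using False unfolding irreducible_def by blast
    then have nz: "a \<noteq> 0" "b \<noteq> 0" using \<open>p \<noteq> 0\<close> by auto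
    then have "degree a > 0" "degree b > 0" using ab by (simp_all add: is_unit_iff_degree)
    moreover from this have "degree a < degree p" using ab nz by (simp add: degree_mult_eq)
    ultimately obtain g where "mirr g" "g dvd a" using less.hyps by blast
    then show ?thesis using ab(1) by (meson dvd_mult2)
  qed
qed

definition kern :: "('a::comm_ring_1 poly \<Rightarrow> 'a poly) \<Rightarrow> 'a poly set \<Rightarrow> 'a poly \<Rightarrow> 'a poly set" where
  "kern T V p = {v \<in> V. pact T p v = 0}"

text \<open>A free exponent makes the primary part comparable with that of a quotient of smaller
  dimension; \<open>gen_eigenspace\<close> instead ties the exponent to the dimension.\<close>

definition prim :: "('a::comm_ring_1 poly \<Rightarrow> 'a poly) \<Rightarrow> 'a poly set \<Rightarrow> 'a poly \<Rightarrow> 'a poly set" where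
  "prim T V g = {v \<in> V. \<exists>N. pact T (g ^ N) v = 0}"

definition cyclic_span :: "('a::comm_ring_1 poly \<Rightarrow> 'a poly) \<Rightarrow> 'a poly \<Rightarrow> 'a poly set" where
  "cyclic_span T v = range (\<lambda>p. pact T p v)"

text \<open>With \<open>d\<close> the degree of the annihilator of \<open>v\<close> this is a basis
  of the cyclic submodule generated by \<open>v\<close>. The value 0 from \<open>d\<close> on fits
  the convention of \<open>row_fams\<close>.\<close>

definition krylov :: "('a::comm_ring_1 poly \<Rightarrow> 'a poly) \<Rightarrow> nat \<Rightarrow> 'a poly \<Rightarrow> nat \<Rightarrow> 'a poly" where
  "krylov T d v = (\<lambda>i. if i < d then (T ^^ i) v else 0)"

text \<open>The chains of \<open>v\<close> and \<open>w\<close> one after the other; for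
  \<open>d > 0\<close> the entries 0 and \<open>d\<close> recover \<open>v\<close> and
  \<open>w\<close>.\<close>

definition krylov2 :: "('a::comm_ring_1 poly \<Rightarrow> 'a poly) \<Rightarrow> nat \<Rightarrow> 'a poly \<Rightarrow> 'a poly \<Rightarrow> nat \<Rightarrow> 'a poly" where
  "krylov2 T d v w = (\<lambda>i. if i < d then (T ^^ i) v else if i < 2 * d then (T ^^ (i - d)) w else 0)"

text \<open>A finite module over the polynomial ring, with the indeterminate acting as
  \<open>T\<close>.\<close>

locale fmod =
  fixes T :: "'a::{field,finite} poly \<Rightarrow> 'a poly" and V :: "'a poly set"
  assumes lin: "lin T" and fin: "finite V" and subsp: "subsp V" and inv: "T ` V \<subseteq> V"
begin

lemmas annp_monic = annp(1)[OF lin fin inv] and annp_dvd = annp(2)[OF lin fin inv]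

lemma pact_in: "v \<in> V \<Longrightarrow> pact T p v \<in> V"
  by (rule pact_closed[OF subsp inv])

lemma pact_0v: "pact T p 0 = 0"
  by (rule lin_0[OF lin_pact[OF lin]])

lemma pact_commute: "pact T p (pact T r v) = pact T r (pact T p v)"
  by (simp only: pact_mult[OF lin, symmetric] mult.commute)

lemma cyclic_span_sub: "v \<in> V \<Longrightarrow> cyclic_span T v \<subseteq> V"
  unfolding cyclic_span_def using pact_in by blast

lemma coprime_kern:
  assumes g: "mirr g" "\<not> g dvd p" and v: "pact T (g ^ N) v = 0" "pact T p v = 0"
  shows "v = 0"
proof -
  obtain a b where ab: "a * g ^ N + b * p = 1" using mirr_bezout_pow[OF g] by blast
  have "v = pact T (a * g ^ N + b * p) v" by (simp add: ab)
  also have "\<dots> = 0" by (simp add: pact_add pact_mult[OF lin] v pact_0v)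
  finally show ?thesis .
qed

lemma annp_prim:
  assumes g: "mirr g" and v: "v \<in> prim T V g"
  shows "\<exists>i. annp T v = g ^ i" "v \<noteq> 0 \<Longrightarrow> \<exists>i\<ge>1. annp T v = g ^ i"
proof -
  obtain N where N: "v \<in> V" "pact T (g ^ N) v = 0" using v unfolding prim_def by blast
  then have "annp T v dvd g ^ N" using annp_dvd by blast
  then show *: "\<exists>i. annp T v = g ^ i" using monic_dvd_mirr_power[OF g annp_monic[OF N(1)]] by blast
  assume "v \<noteq> 0"
  then have "\<not> annp T v dvd 1" using annp_dvd[OF N(1), of 1] by simp
  then have "annp T v \<noteq> g ^ 0" by auto
  then show "\<exists>i\<ge>1. annp T v = g ^ i" using * by (metis One_nat_def Suc_leI neq0_conv)
qed

lemma annp_kern: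
  assumes g: "mirr g" and v: "v \<in> kern T V g" "v \<noteq> 0"
  shows "annp T v = g"
proof -
  have vV: "v \<in> V" and 0: "pact T g v = 0" using v unfolding kern_def by auto
  have "annp T v dvd g ^ 1" using annp_dvd[OF vV] 0 by simp
  then obtain i where i: "i \<le> 1" "annp T v = g ^ i"
    using monic_dvd_mirr_power[OF g annp_monic[OF vV]] by blast
  have "\<not> annp T v dvd 1" using annp_dvd[OF vV, of 1] v(2) by simp
  then have "i \<noteq> 0" using i(2) by (intro notI) simp
  then show ?thesis using i by (simp add: le_Suc_eq)
qed

lemma lcomb_krylov:
  assumes "c \<in> cspace d"
  shows "lcomb d (krylov T d v) c = pact T c v"
proof (cases d)
  case 0
  then have "c = 0" using assms by (simp add: cspace_iff)
  then show ?thesis using 0 by (simp add: lcomb_def)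
next
  case (Suc m)
  then have "degree c \<le> m" using assms by (auto simp: cspace_iff)
  then have "pact T c v = (\<Sum>k\<le>m. scl (coeff c k) ((T ^^ k) v))" by (rule pact_eq)
  also have "\<dots> = lcomb d (krylov T d v) c"
    unfolding lcomb_def krylov_def Suc lessThan_Suc_atMost by (rule sum.cong) auto
  finally show ?thesis by simp
qed

lemma funpow_in: "v \<in> V \<Longrightarrow> (T ^^ k) v \<in> V"
  by (induction k) (use inv in auto)

text \<open>Division with remainder by the annihilator: every multiple of \<open>v\<close> comes
  from a remainder of degree below \<open>d\<close>, and no nonzero remainder kills
  \<open>v\<close>.\<close>

lemma krylov_props:
  assumes v: "v \<in> V" and d: "degree (annp T v) = d"
  shows "indep d (krylov T d v)" "span_rows d (krylov T d v) = cyclic_span T v" "card (cyclic_span T v) = CARD('a) ^ d"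
proof -
  have nz: "annp T v \<noteq> 0" using annp_monic[OF v] by auto
  have "c = 0" if "c \<in> cspace d" "pact T c v = 0" for c
  proof (rule ccontr)
    assume "c \<noteq> 0"
    then have "degree c < d" using that(1) by (simp add: cspace_iff)
    moreover have "annp T v dvd c" using annp_dvd[OF v] that(2) by blast
    then have "degree (annp T v) \<le> degree c" using \<open>c \<noteq> 0\<close> by (rule dvd_imp_degree_le)
    ultimately show False using d by simp
  qed
  then show ind: "indep d (krylov T d v)" unfolding indep_def by (simp add: lcomb_krylov)
  have sp: "pact T p v \<in> span_rows d (krylov T d v)" for p
  proof -
    have "p mod annp T v \<in> cspace d" using degree_mod_less[OF nz, of p] d by (simp add: cspace_iff)
    moreover have "pact T (p mod annp T v) v = pact T p v - pact T (p div annp T v * annp T v) v"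
      by (simp only: minus_div_mult_eq_mod[symmetric] pact_diff)
    moreover have "pact T (p div annp T v * annp T v) v = 0" using annp_dvd[OF v] by simp
    ultimately have "pact T p v = lcomb d (krylov T d v) (p mod annp T v)" by (simp add: lcomb_krylov)
    then show ?thesis using \<open>p mod annp T v \<in> cspace d\<close> by blast
  qed
  have cy: "lcomb d (krylov T d v) c \<in> cyclic_span T v" if "c \<in> cspace d" for c
    using that unfolding cyclic_span_def by (simp add: lcomb_krylov)
  show eq: "span_rows d (krylov T d v) = cyclic_span T v"
  proof
    show "cyclic_span T v \<subseteq> span_rows d (krylov T d v)"
      unfolding cyclic_span_def by (rule image_subsetI) (rule sp)
  qed (rule image_subsetI, rule cy)
  show "card (cyclic_span T v) = CARD('a) ^ d" using card_span_rows[OF ind] eq by simp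
qed

lemma lcomb_krylov2:
  assumes "c \<in> cspace (2 * d)"
  shows "lcomb (2 * d) (krylov2 T d v w) c = pact T (poly_cutoff d c) v + pact T (poly_shift d c) w"
proof -
  have s: "poly_shift d c \<in> cspace d" using assms by (simp add: cspace_def coeff_poly_shift)
  have "lcomb (2 * d) (krylov2 T d v w) c =
      (\<Sum>i<d. scl (coeff c i) (krylov2 T d v w i)) + (\<Sum>i=d..<2*d. scl (coeff c i) (krylov2 T d v w i))"
    unfolding lcomb_def by (metis (no_types, lifting) add_leE atLeast0LessThan le_add1 mult_2 sum.atLeastLessThan_concat zero_le)
  also have "(\<Sum>i<d. scl (coeff c i) (krylov2 T d v w i)) = lcomb d (krylov T d v) (poly_cutoff d c)"
    unfolding lcomb_def by (rule sum.cong) (auto simp: krylov_def krylov2_def coeff_poly_cutoff)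
  also have "(\<Sum>i=d..<2*d. scl (coeff c i) (krylov2 T d v w i)) = lcomb d (krylov T d w) (poly_shift d c)"
    unfolding lcomb_def
    by (rule sum.reindex_bij_witness[of _ "\<lambda>i. i + d" "\<lambda>i. i - d"])
       (auto simp: krylov_def krylov2_def coeff_poly_shift)
  finally show ?thesis by (simp add: lcomb_krylov poly_cutoff_cspace s)
qed

text \<open>The kernel of \<open>g\<close> is a vector space over the field \<open>F[t]/g\<close>. A
  vector \<open>w\<close> outside the line of \<open>v\<close> is independent of it there, which
  gives \<open>2 d\<close> independent vectors over \<open>F\<close>.\<close>

lemma krylov2_props:
  assumes g: "mirr g" and v: "v \<in> kern T V g" "v \<noteq> 0" and w: "w \<in> kern T V g - cyclic_span T v" and d: "degree g = d"
  shows "indep (2 * d) (krylov2 T d v w)" "span_rows (2 * d) (krylov2 T d v w) \<subseteq> kern T V g"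
    "lcomb (2 * d) (krylov2 T d v w) c \<in> kern T V g"
proof -
  have vV: "v \<in> V" and wV: "w \<in> V" and v0: "pact T g v = 0" and w0: "pact T g w = 0"
    using v w unfolding kern_def by auto
  have in_kern: "pact T p u \<in> kern T V g" if "u \<in> kern T V g" for p u
    using that pact_in pact_commute[of g p u] pact_0v unfolding kern_def by simp
  have sub_kern: "subsp (kern T V g)"
    using subsp unfolding subsp_def kern_def
    by (simp add: lin_add[OF lin_pact[OF lin]] lin_scl[OF lin_pact[OF lin]] pact_0v)
  have *: "(T ^^ k) u \<in> kern T V g" if "u \<in> kern T V g" for k u
    using in_kern[OF that, of "monom 1 k"] by (simp add: pact_monom[OF lin])
  show in2: "lcomb (2 * d) (krylov2 T d v w) c \<in> kern T V g" for c
    by (rule lcomb_closed[OF sub_kern]) (use * v w in \<open>simp add: krylov2_def\<close>)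
  then show "span_rows (2 * d) (krylov2 T d v w) \<subseteq> kern T V g" by blast
  show "indep (2 * d) (krylov2 T d v w)" unfolding indep_def
  proof (intro ballI impI)
    fix c assume c: "c \<in> cspace (2 * d)" and 0: "lcomb (2 * d) (krylov2 T d v w) c = 0"
    define c1 c2 where "c1 = poly_cutoff d c" and "c2 = poly_shift d c"
    have c12: "c1 \<in> cspace d" "c2 \<in> cspace d"
      using c by (simp_all add: c1_def c2_def poly_cutoff_cspace) (simp add: cspace_def coeff_poly_shift)
    have eq: "pact T c1 v + pact T c2 w = 0" using 0 lcomb_krylov2[OF c] by (simp add: c1_def c2_def)
    have "c2 = 0"
    proof (rule ccontr)
      assume "c2 \<noteq> 0"
      then have "degree c2 < degree g" using c12(2) d by (simp add: cspace_iff)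
      then have "\<not> g dvd c2" using dvd_imp_degree_le[OF _ \<open>c2 \<noteq> 0\<close>, of g] by (meson not_le)
      \<comment> \<open>Modulo \<open>g\<close> the polynomial \<open>c2\<close> has the inverse
        \<open>b\<close>; solving the relation for \<open>w\<close> puts \<open>w\<close> on the
        line of \<open>v\<close>.\<close>
      then obtain a b where ab: "a * g + b * c2 = 1" using mirr_bezout[OF g] by blast
      have "w = pact T (a * g + b * c2) w" by (simp add: ab)
      also have "\<dots> = pact T b (pact T c2 w)" by (simp add: pact_add pact_mult[OF lin] w0 pact_0v)
      also have "pact T c2 w = pact T (- c1) v" using eq by (simp add: pact_uminus eq_neg_iff_add_eq_0 add.commute)
      also have "pact T b (pact T (- c1) v) = pact T (b * (- c1)) v" by (simp only: pact_mult[OF lin])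
      finally have "w \<in> cyclic_span T v" unfolding cyclic_span_def by blast
      then show False using w by blast
    qed
    then have "pact T c1 v = 0" using eq by simp
    then have "lcomb d (krylov T d v) c1 = 0" by (simp add: lcomb_krylov c12)
    then have "c1 = 0"
      using krylov_props(1)[OF vV, of d] annp_kern[OF g v] d c12(1) unfolding indep_def by auto
    show "c = 0"
    proof (rule poly_eqI)
      fix n
      show "coeff c n = coeff 0 n"
      proof (cases "n < d")
        case True
        then show ?thesis using \<open>c1 = 0\<close> unfolding c1_def by (metis coeff_poly_cutoff)
      next
        case False
        then have "coeff c n = coeff c2 (n - d)" unfolding c2_def by (simp add: coeff_poly_shift)
        then show ?thesis using \<open>c2 = 0\<close> by simp
      qed
    qed
  qed
qed

text \<open>Fewer than \<open>q^(2 deg g)\<close> elements means dimension at most one over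
  \<open>F[t]/g\<close>.\<close>

lemma small_kern_cyclic:
  assumes g: "mirr g" and v: "v \<in> kern T V g" "v \<noteq> 0"
    and K: "card (kern T V g) < CARD('a) ^ (2 * degree g)"
  shows "kern T V g \<subseteq> cyclic_span T v"
proof (rule ccontr)
  assume "\<not> kern T V g \<subseteq> cyclic_span T v"
  then obtain w where w: "w \<in> kern T V g - cyclic_span T v" by blast
  note c2 = krylov2_props[OF g v w refl]
  have "finite (kern T V g)" using fin unfolding kern_def by simp
  then have "CARD('a) ^ (2 * degree g) \<le> card (kern T V g)"
    using card_mono[OF _ c2(2)] card_span_rows[OF c2(1)] by simp
  then show False using K by simp
qed

text \<open>The generator is an \<open>x\<close> whose annihilator \<open>g^i\<close> has the
  largest degree. Then \<open>s = g^(i-1) x\<close> generates the kernel of \<open>g\<close>, and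
  whatever \<open>g^i\<close> kills is reached from the kernel upwards.\<close>

lemma prim_cyclic:
  assumes g: "mirr g" and ne: "card (kern T V g) \<noteq> 1"
    and K: "card (kern T V g) < CARD('a) ^ (2 * degree g)"
  shows "\<exists>x\<in>prim T V g. prim T V g \<subseteq> cyclic_span T x"
proof -
  have 0: "0 \<in> kern T V g" using subspD(1)[OF subsp] pact_0v unfolding kern_def by simp
  obtain v where v: "v \<in> kern T V g" "v \<noteq> 0"
  proof (rule ccontr)
    assume "\<not> thesis"
    then have "kern T V g = {0}" using that 0 by blast
    then show False using ne by simp
  qed
  have kp: "kern T V g \<subseteq> prim T V g" unfolding kern_def prim_def by (auto intro: exI[of _ 1])
  have finp: "finite (prim T V g)" using fin unfolding prim_def by simp
  define f where "f x = degree (annp T x)" for x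
  have "finite (f ` prim T V g)" "f ` prim T V g \<noteq> {}" using finp v(1) kp by auto
  then obtain x where x: "x \<in> prim T V g" "\<And>y. y \<in> prim T V g \<Longrightarrow> f y \<le> f x"
    using Max_in[of "f ` prim T V g"] Max_ge[of "f ` prim T V g"] by (metis imageE imageI)
  obtain i where i: "annp T x = g ^ i" using annp_prim(1)[OF g x(1)] by blast
  have dg: "degree g > 0" by (rule mirr_degree[OF g])
  have fx: "f x = i * degree g" unfolding f_def i using g by (simp add: degree_power_eq mirr_neq_0 mult.commute)
  have "f v = degree g" using annp_kern[OF g v] by (simp add: f_def)
  then have "degree g \<le> i * degree g" using x(2)[of v] kp v(1) fx by auto
  then have i1: "i \<ge> 1" using dg by (cases i) auto
  have xV: "x \<in> V" using x(1) unfolding prim_def by blast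
  define s where "s = pact T (g ^ (i - 1)) x"
  have "g * g ^ (i - 1) = g ^ i" using i1 by (simp add: power_eq_if)
  then have "pact T g s = pact T (g ^ i) x" unfolding s_def by (simp only: pact_mult[OF lin, symmetric])
  also have "\<dots> = 0" using annp_dvd[OF xV] i by simp
  finally have s: "s \<in> kern T V g" unfolding kern_def s_def using pact_in[OF xV] by simp
  have "s \<noteq> 0"
  proof
    assume "s = 0"
    then have "g ^ i dvd g ^ (i - 1)" using annp_dvd[OF xV] i unfolding s_def by metis
    then have "degree (g ^ i) \<le> degree (g ^ (i - 1))" using mirr_neq_0[OF g] by (intro dvd_imp_degree_le) simp_all
    then show False using dg i1 mirr_neq_0[OF g] by (simp add: degree_power_eq)
  qed
  then have kc: "kern T V g \<subseteq> cyclic_span T s" using small_kern_cyclic[OF g s _ K] by blast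
  \<comment> \<open>Induction on the exponent. If \<open>g^(j+1)\<close> kills \<open>y\<close>,
    then \<open>g^j y\<close> lies in the kernel of \<open>g\<close> and is a multiple of
    \<open>s\<close>, hence \<open>g^j\<close> times a multiple of \<open>x\<close>; subtracting
    that multiple from \<open>y\<close> leaves something killed by \<open>g^j\<close>.\<close>
  have main: "y \<in> cyclic_span T x" if "j \<le> i" "y \<in> V" "pact T (g ^ j) y = 0" for j y
    using that
  proof (induction j arbitrary: y)
    case 0
    then have "y = pact T 0 x" by simp
    then show ?case unfolding cyclic_span_def by blast
  next
    case (Suc j)
    have "pact T g (pact T (g ^ j) y) = 0" using Suc.prems(3) by (simp add: pact_mult[OF lin])
    then have "pact T (g ^ j) y \<in> kern T V g" using pact_in[OF Suc.prems(2)] unfolding kern_def by blast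
    then obtain p where "pact T (g ^ j) y = pact T p s" using kc unfolding cyclic_span_def by blast
    also have "\<dots> = pact T (g ^ j) (pact T (g ^ (i - 1 - j) * p) x)"
    proof -
      have "p * g ^ (i - 1) = g ^ j * (g ^ (i - 1 - j) * p)"
        using Suc.prems(1) by (simp add: mult.assoc[symmetric] power_add[symmetric] mult.commute)
      then show ?thesis unfolding s_def by (simp only: pact_mult[OF lin, symmetric])
    qed
    finally have *: "pact T (g ^ j) (y - pact T (g ^ (i - 1 - j) * p) x) = 0"
      by (simp add: lin_diff[OF lin_pact[OF lin]])
    have "y - pact T (g ^ (i - 1 - j) * p) x \<in> cyclic_span T x"
      by (rule Suc.IH) (use Suc.prems * pact_in[OF xV] subsp_diff[OF subsp] in auto)
    then obtain p' where "y - pact T (g ^ (i - 1 - j) * p) x = pact T p' x" unfolding cyclic_span_def by blast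
    then have "y = pact T (p' + g ^ (i - 1 - j) * p) x" by (simp add: pact_add algebra_simps)
    then show ?case unfolding cyclic_span_def by blast
  qed
  have "y \<in> cyclic_span T x" if y: "y \<in> prim T V g" for y
  proof (rule main[of i])
    show yV: "y \<in> V" using y unfolding prim_def by blast
    obtain j where j: "annp T y = g ^ j" using annp_prim(1)[OF g y] by blast
    have "f y = j * degree g" unfolding f_def j using g by (simp add: degree_power_eq mirr_neq_0 mult.commute)
    then have "j \<le> i" using x(2)[OF y] fx dg by simp
    then have "annp T y dvd g ^ i" unfolding j by (rule le_imp_power_dvd)
    then show "pact T (g ^ i) y = 0" using annp_dvd[OF yV] by blast
  qed simp
  then show ?thesis using x(1) by blast
qed

lemma ex_prime:
  assumes "v \<in> V" "v \<noteq> 0"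
  shows "\<exists>g. mirr g \<and> card (kern T V g) \<noteq> 1"
proof -
  have "\<not> annp T v dvd 1" using annp_dvd[OF assms(1), of 1] assms(2) by simp
  moreover have nz: "annp T v \<noteq> 0" using annp_monic[OF assms(1)] by auto
  ultimately have "degree (annp T v) > 0" by (simp add: is_unit_iff_degree)
  then obtain g where g: "mirr g" "g dvd annp T v" using ex_mirr_dvd by blast
  then obtain k where k: "annp T v = g * k" by (elim dvdE)
  define s where "s = pact T k v"
  have "pact T g s = pact T (annp T v) v" unfolding s_def k by (simp only: pact_mult[OF lin])
  then have "s \<in> kern T V g" using annp_dvd[OF assms(1)] pact_in[OF assms(1)] by (simp add: kern_def s_def)
  moreover have "s \<noteq> 0"
  proof
    assume "s = 0"
    then have "annp T v dvd k" using annp_dvd[OF assms(1)] unfolding s_def by blast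
    then have "degree (annp T v) \<le> degree k" using nz k by (intro dvd_imp_degree_le) auto
    moreover have "degree (annp T v) = degree g + degree k" unfolding k
      using nz k by (intro degree_mult_eq) auto
    ultimately show False using mirr_degree[OF g(1)] by simp
  qed
  moreover have "0 \<in> kern T V g" using subspD(1)[OF subsp] pact_0v unfolding kern_def by simp
  ultimately have "card (kern T V g) \<noteq> 1" by (metis card_1_singletonE singletonD)
  then show ?thesis using g(1) by blast
qed

end

text \<open>The quotient module \<open>V'\<close> of \<open>V\<close> by a \<open>g\<close>-primary
  submodule, which is given as the kernel of \<open>P\<close>.\<close>

locale fmod_quot = fmod T V for T :: "'a::{field,finite} poly \<Rightarrow> 'a poly" and V +
  fixes T' :: "'a poly \<Rightarrow> 'a poly" and V' :: "'a poly set" and P :: "'a poly \<Rightarrow> 'a poly" and g :: "'a poly"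
  assumes lin': "lin T'" and linP: "lin P" and PV: "P ` V = V'"
    and PT: "\<And>v. v \<in> V \<Longrightarrow> P (T v) = T' (P v)"
    and g: "mirr g" and Wg: "{v \<in> V. P v = 0} \<subseteq> prim T V g"
begin

lemma P_pact: "v \<in> V \<Longrightarrow> P (pact T p v) = pact T' p (P v)"
  by (rule pact_intertwine[OF linP lin inv PT])

lemma pact_0v': "pact T' p 0 = 0"
  by (rule lin_0[OF lin_pact[OF lin']])

text \<open>A \<open>g\<close>-primary element killed by \<open>g'\<close> is 0, so \<open>P\<close>
  is injective on the kernel of \<open>g'\<close>. A lift of a kernel element need not lie in the
  kernel, but a Bezout relation corrects it.\<close>

lemma card_kern_quot:
  assumes g': "mirr g'" "g' \<noteq> g"
  shows "card (kern T' V' g') = card (kern T V g')"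
proof -
  have ng: "\<not> g dvd g'" using mirr_not_dvd[OF g g'(1)] g'(2) by simp
  have "bij_betw P (kern T V g') (kern T' V' g')"
    unfolding bij_betw_def
  proof (intro conjI inj_onI subset_antisym subsetI)
    fix x y assume x: "x \<in> kern T V g'" and y: "y \<in> kern T V g'" and xy: "P x = P y"
    have V: "x \<in> V" "y \<in> V" and 0: "pact T g' x = 0" "pact T g' y = 0"
      using x y unfolding kern_def by auto
    have "P (x - y) = 0" using xy by (simp add: lin_diff[OF linP])
    then have "x - y \<in> prim T V g" using Wg subsp_diff[OF subsp V] by blast
    then obtain N where N: "pact T (g ^ N) (x - y) = 0" unfolding prim_def by blast
    have "pact T g' (x - y) = 0" using 0 by (simp add: lin_diff[OF lin_pact[OF lin]])
    then have "x - y = 0" using coprime_kern[OF g ng N] by blast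
    then show "x = y" by simp
  next
    fix y assume "y \<in> P ` kern T V g'"
    then obtain x where x: "x \<in> V" "pact T g' x = 0" "y = P x" unfolding kern_def by blast
    then have "pact T' g' y = 0" using P_pact[OF x(1), of g'] lin_0[OF linP] by simp
    then show "y \<in> kern T' V' g'" using x PV unfolding kern_def by blast
  next
    fix y assume "y \<in> kern T' V' g'"
    then have y: "y \<in> V'" "pact T' g' y = 0" unfolding kern_def by auto
    then obtain x where x: "x \<in> V" "y = P x" using PV by blast
    have "P (pact T g' x) = 0" using P_pact[OF x(1)] y x(2) by simp
    then have "pact T g' x \<in> prim T V g" using Wg pact_in[OF x(1)] by blast
    then obtain N where N: "pact T (g ^ N) (pact T g' x) = 0" unfolding prim_def by blast
    obtain a b where ab: "a * g ^ N + b * g' = 1" using mirr_bezout_pow[OF g ng] by blast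
    \<comment> \<open>Modulo \<open>g'\<close> the factor \<open>a g^N\<close> is 1, so it fixes
      \<open>y\<close>; and it kills the defect \<open>g' x\<close>, which is
      \<open>g\<close>-primary.\<close>
    define z where "z = pact T (a * g ^ N) x"
    have zV: "z \<in> V" unfolding z_def by (rule pact_in[OF x(1)])
    have "g' * (a * g ^ N) = a * (g ^ N * g')" by (simp add: algebra_simps)
    then have "pact T g' z = pact T a (pact T (g ^ N) (pact T g' x))"
      unfolding z_def by (simp only: pact_mult[OF lin, symmetric])
    then have "pact T g' z = 0" by (simp add: N pact_0v)
    then have "z \<in> kern T V g'" using zV unfolding kern_def by blast
    have "y = pact T' (a * g ^ N + b * g') y" by (simp add: ab)
    also have "\<dots> = pact T' (a * g ^ N) y + pact T' b (pact T' g' y)" by (simp only: pact_add pact_mult[OF lin'])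
    also have "\<dots> = P z" using P_pact[OF x(1), of "a * g ^ N"] x(2) y(2) pact_0v' unfolding z_def by simp
    finally show "y \<in> P ` kern T V g'" using \<open>z \<in> kern T V g'\<close> by blast
  qed
  then show ?thesis by (rule bij_betw_same_card[symmetric])
qed

text \<open>An element that is \<open>g\<close>-primary modulo a \<open>g\<close>-primary submodule
  is itself \<open>g\<close>-primary, so \<open>P\<close> maps one primary part onto the other; the
  fibres are cosets of the kernel of \<open>P\<close>.\<close>

lemma card_prim_quot: "card (prim T V g) = card {v \<in> V. P v = 0} * card (prim T' V' g)"
proof -
  let ?W = "{v \<in> V. P v = 0}"
  have im: "P ` prim T V g = prim T' V' g"
  proof (intro subset_antisym subsetI)
    fix y assume "y \<in> P ` prim T V g"
    then obtain x N where x: "x \<in> V" "pact T (g ^ N) x = 0" "y = P x" unfolding prim_def by blast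
    then have "pact T' (g ^ N) y = 0" using P_pact[OF x(1), of "g ^ N"] lin_0[OF linP] by simp
    then show "y \<in> prim T' V' g" using x PV unfolding prim_def by blast
  next
    fix y assume "y \<in> prim T' V' g"
    then obtain N where y: "y \<in> V'" "pact T' (g ^ N) y = 0" unfolding prim_def by blast
    then obtain x where x: "x \<in> V" "y = P x" using PV by blast
    have "P (pact T (g ^ N) x) = 0" using P_pact[OF x(1)] y x(2) by simp
    then have "pact T (g ^ N) x \<in> prim T V g" using Wg pact_in[OF x(1)] by blast
    then obtain M where "pact T (g ^ M) (pact T (g ^ N) x) = 0" unfolding prim_def by blast
    then have "pact T (g ^ (M + N)) x = 0" by (simp add: power_add pact_mult[OF lin])
    then have "x \<in> prim T V g" using x(1) unfolding prim_def by blast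
    then show "y \<in> P ` prim T V g" using x(2) by blast
  qed
  have padd: "x + w \<in> prim T V g" if px: "x \<in> prim T V g" and pw: "w \<in> prim T V g" for x w
  proof -
    obtain N where N: "x \<in> V" "pact T (g ^ N) x = 0" using px unfolding prim_def by blast
    obtain M where M: "w \<in> V" "pact T (g ^ M) w = 0" using pw unfolding prim_def by blast
    have "pact T (g ^ (N + M)) x = 0" "pact T (g ^ (N + M)) w = 0"
      using pact_dvd_0[OF lin N(2)] pact_dvd_0[OF lin M(2)] by (simp_all add: le_imp_power_dvd)
    then have "pact T (g ^ (N + M)) (x + w) = 0" by (simp add: lin_add[OF lin_pact[OF lin]])
    then show ?thesis using subspD(2)[OF subsp N(1) M(1)] unfolding prim_def by blast
  qed
  have fiber: "card {x \<in> prim T V g. P x = y} = card ?W" if y: "y \<in> prim T' V' g" for y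
  proof -
    obtain x where x: "x \<in> prim T V g" "P x = y" using y unfolding im[symmetric] by blast
    have xV: "x \<in> V" using x(1) unfolding prim_def by blast
    have "bij_betw (\<lambda>w. x + w) ?W {x \<in> prim T V g. P x = y}"
    proof (rule bij_betwI[where g = "\<lambda>u. u - x"])
      show "(\<lambda>w. x + w) \<in> ?W \<rightarrow> {x \<in> prim T V g. P x = y}"
      proof
        fix w assume w: "w \<in> ?W"
        then have "x + w \<in> prim T V g" using padd[OF x(1)] Wg by blast
        then show "x + w \<in> {x \<in> prim T V g. P x = y}" using w x(2) by (simp add: lin_add[OF linP])
      qed
      show "(\<lambda>u. u - x) \<in> {x \<in> prim T V g. P x = y} \<rightarrow> ?W"
      proof
        fix u assume u: "u \<in> {x \<in> prim T V g. P x = y}"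
        then have "u \<in> V" unfolding prim_def by blast
        then show "u - x \<in> ?W" using u x(2) subsp_diff[OF subsp _ xV] by (simp add: lin_diff[OF linP])
      qed
    qed simp_all
    then show ?thesis by (rule bij_betw_same_card[symmetric])
  qed
  have finp: "finite (prim T V g)" using fin unfolding prim_def by simp
  have "card (prim T V g) = (\<Sum>y\<in>prim T' V' g. card {x \<in> prim T V g. P x = y})"
    unfolding im[symmetric] by (rule sum.image_gen[OF finp, of "\<lambda>_. 1 :: nat", simplified])
  also have "\<dots> = card ?W * card (prim T' V' g)" by (simp add: fiber)
  finally show ?thesis .
qed

end

section \<open>Chains and pairs of chains\<close>

lemma fmod_rows:
  "X \<in> row_fams n n \<Longrightarrow> fmod (lcomb n X) (cspace n :: 'a::{field,finite} poly set)"
  by unfold_locales (auto simp: lin_lcomb subsp_cspace intro: lcomb_rows)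

section \<open>Classes of matrices described by kernel and primary part sizes\<close>

definition ker_size :: "nat \<Rightarrow> (nat \<Rightarrow> 'a::{field,finite} poly) \<Rightarrow> 'a poly \<Rightarrow> nat" where
  "ker_size n X g = card (kern (lcomb n X) (cspace n) g)"

definition prim_size :: "nat \<Rightarrow> (nat \<Rightarrow> 'a::{field,finite} poly) \<Rightarrow> 'a poly \<Rightarrow> nat" where
  "prim_size n X g = card (prim (lcomb n X) (cspace n) g)"

text \<open>A kernel with at least \<open>Q\<^sup>2\<close> elements means that the \<open>g\<close>-primary part is not cyclic.\<close>
definition large_or_trivial :: "'a::{field,finite} poly set \<Rightarrow> nat \<Rightarrow> (nat \<Rightarrow> 'a poly) \<Rightarrow> 'a poly \<Rightarrow> bool" where
  "large_or_trivial S n X g \<longleftrightarrow> ker_size n X g = 1 \<or> (g \<in> S \<and> CARD('a) ^ (2 * degree g) \<le> ker_size n X g)"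

definition large_kernels :: "'a::{field,finite} poly set \<Rightarrow> nat \<Rightarrow> (nat \<Rightarrow> 'a poly) set" where
  "large_kernels S n = {X \<in> row_fams n n. \<forall>g. mirr g \<longrightarrow> large_or_trivial S n X g}"

text \<open>The class that contains the quotients by \<open>g\<close>-primary subspaces:
  \<open>quot_sizes\<close> preserves kernel sizes only for irreducibles other than
  \<open>g\<close>.\<close>

definition large_kernels_off :: "'a::{field,finite} poly set \<Rightarrow> 'a poly \<Rightarrow> nat \<Rightarrow> (nat \<Rightarrow> 'a poly) set" where
  "large_kernels_off S g n = {X \<in> row_fams n n. \<forall>g'. mirr g' \<longrightarrow> g' \<noteq> g \<longrightarrow> large_or_trivial S n X g'}"

definition prim_class :: "'a::{field,finite} poly set \<Rightarrow> 'a poly \<Rightarrow> nat \<Rightarrow> nat \<Rightarrow> (nat \<Rightarrow> 'a poly) set" where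
  "prim_class S g n N = {X \<in> large_kernels_off S g n. prim_size n X g = N}"

lemma finite_large_kernels [simp]: "finite (large_kernels S n)" "finite (large_kernels_off S g n)" "finite (prim_class S g n N)"
  by (simp_all add: large_kernels_def large_kernels_off_def prim_class_def)

lemma fmod_quot_rows:
  assumes X: "X \<in> row_fams n n" and P: "is_quot n l E P"
    and B: "\<forall>v\<in>cspace n. P (lcomb n X v) = lcomb (n - l) B (P v)"
    and g: "mirr g" and W: "span_rows l E \<subseteq> prim (lcomb n X) (cspace n) g"
  shows "fmod_quot (lcomb n X) (cspace n) (lcomb (n - l) B) (cspace (n - l) :: 'a::{field,finite} poly set) P g"
proof -
  interpret fmod "lcomb n X" "cspace n" by (rule fmod_rows[OF X])
  show ?thesis
  proof (intro fmod_quot.intro fmod_rows[OF X] fmod_quot_axioms.intro)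
    show "{v \<in> cspace n. P v = 0} \<subseteq> prim (lcomb n X) (cspace n) g"
      using P W unfolding is_quot_def by blast
  qed (use P B g in \<open>auto simp: is_quot_def lin_lcomb\<close>)
qed

lemma quot_sizes:
  assumes E: "E \<in> indeps l n" and X: "X \<in> row_fams n n" and P: "is_quot n l E P"
    and B: "\<forall>v\<in>cspace n. P (lcomb n X v) = lcomb (n - l) B (P v)"
    and g: "mirr g" and W: "span_rows l E \<subseteq> prim (lcomb n X) (cspace n) (g :: 'a::{field,finite} poly)"
  shows "mirr g' \<Longrightarrow> g' \<noteq> g \<Longrightarrow> ker_size (n - l) B g' = ker_size n X g'"
    "prim_size n X g = CARD('a) ^ l * prim_size (n - l) B g"
proof -
  interpret fmod_quot "lcomb n X" "cspace n" "lcomb (n - l) B" "cspace (n - l)" P g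
    by (rule fmod_quot_rows[OF X P B g W])
  show "mirr g' \<Longrightarrow> g' \<noteq> g \<Longrightarrow> ker_size (n - l) B g' = ker_size n X g'"
    unfolding ker_size_def by (rule card_kern_quot)
  have Er: "E \<in> row_fams l n" using E by (simp add: indeps_def)
  have Pi: "P v = 0 \<longleftrightarrow> v \<in> span_rows l E" if "v \<in> cspace n" for v
    using P that unfolding is_quot_def by blast
  have "{v \<in> cspace n. P v = 0} = span_rows l E"
  proof (intro subset_antisym subsetI)
    fix v assume "v \<in> {v \<in> cspace n. P v = 0}"
    then show "v \<in> span_rows l E" using Pi[of v] by simp
  next
    fix v assume v: "v \<in> span_rows l E"
    then have "v \<in> cspace n" by (rule imageE) (simp only: lcomb_rows[OF Er])
    then show "v \<in> {v \<in> cspace n. P v = 0}" using Pi[of v] v by simp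
  qed
  then have "card {v \<in> cspace n. P v = 0} = CARD('a) ^ l" using E by (simp add: card_span_rows indeps_def)
  then show "prim_size n X g = CARD('a) ^ l * prim_size (n - l) B g"
    unfolding prim_size_def using card_prim_quot by simp
qed

lemma quot_large_kernels_off:
  assumes "E \<in> indeps l n" "X \<in> large_kernels_off S g n" "is_quot n l E P" "B \<in> row_fams (n - l) (n - l)"
    "\<forall>v\<in>cspace n. P (lcomb n X v) = lcomb (n - l) B (P v)"
    "mirr g" "span_rows l E \<subseteq> prim (lcomb n X) (cspace n) g"
  shows "B \<in> large_kernels_off S g (n - l)"
proof -
  have X: "X \<in> row_fams n n" using assms(2) by (simp add: large_kernels_off_def)
  have "large_or_trivial S (n - l) B g'" if "mirr g'" "g' \<noteq> g" for g'
  proof -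
    have "ker_size (n - l) B g' = ker_size n X g'"
      by (rule quot_sizes(1)[OF assms(1) X assms(3,5-7) that])
    moreover have "large_or_trivial S n X g'" using assms(2) that by (simp add: large_kernels_off_def)
    ultimately show ?thesis by (simp add: large_or_trivial_def)
  qed
  then show ?thesis using assms(4) by (simp add: large_kernels_off_def)
qed

text \<open>The monic \<open>h\<close> prescribes the image of the last vector of the chain: a
  companion block. So the operator on the span is determined by the chain and \<open>h\<close>, as
  \<open>count_pairs\<close> demands.\<close>

lemma krylov_image:
  assumes h: "monic h" "degree h = l" "pact T h v = 0" and j: "j < l"
  shows "T (krylov T l v j) = (if Suc j < l then krylov T l v (Suc j)
    else - (\<Sum>i<l. scl (coeff h i) (krylov T l v i)))"
proof (cases "Suc j < l")
  case True
  then show ?thesis by (simp add: krylov_def)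
next
  case False
  then have l: "l = Suc j" using j by simp
  have "0 = (\<Sum>k\<le>l. scl (coeff h k) ((T ^^ k) v))" using h(3) unfolding pact_def h(2) by simp
  also have "\<dots> = (\<Sum>k<l. scl (coeff h k) ((T ^^ k) v)) + (T ^^ l) v"
    using h by (simp add: lessThan_Suc_atMost[symmetric])
  finally have "(T ^^ l) v = - (\<Sum>k<l. scl (coeff h k) ((T ^^ k) v))"
    by (simp add: eq_neg_iff_add_eq_0 add.commute)
  also have "(\<Sum>k<l. scl (coeff h k) ((T ^^ k) v)) = (\<Sum>k<l. scl (coeff h k) (krylov T l v k))"
    by (rule sum.cong) (auto simp: krylov_def)
  finally show ?thesis using False l by (simp add: krylov_def)
qed

text \<open>Two companion blocks of \<open>h\<close>, one for each chain.\<close>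

lemma krylov2_image:
  assumes h: "monic h" "degree h = d" "pact T h v = 0" "pact T h w = 0" and j: "j < 2 * d"
  shows "T (krylov2 T d v w j) = (if Suc j < d \<or> d \<le> j \<and> Suc j < 2 * d then krylov2 T d v w (Suc j)
    else if j < d then - (\<Sum>i<d. scl (coeff h i) (krylov2 T d v w i))
    else - (\<Sum>i<d. scl (coeff h i) (krylov2 T d v w (i + d))))"
proof (cases "j < d")
  case True
  have "T (krylov2 T d v w j) = T (krylov T d v j)" using True by (simp add: krylov_def krylov2_def)
  also have "\<dots> = (if Suc j < d then krylov T d v (Suc j) else - (\<Sum>i<d. scl (coeff h i) (krylov T d v i)))"
    by (rule krylov_image[OF h(1-3) True])
  also have "(\<Sum>i<d. scl (coeff h i) (krylov T d v i)) = (\<Sum>i<d. scl (coeff h i) (krylov2 T d v w i))"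
    by (rule sum.cong) (auto simp: krylov_def krylov2_def)
  finally have *: "T (krylov2 T d v w j) = (if Suc j < d then krylov T d v (Suc j)
    else - (\<Sum>i<d. scl (coeff h i) (krylov2 T d v w i)))" .
  have e: "Suc j < d \<Longrightarrow> krylov T d v (Suc j) = krylov2 T d v w (Suc j)"
    by (simp add: krylov_def krylov2_def)
  have "\<not> d \<le> j" using True by simp
  then show ?thesis unfolding * using True e by simp
next
  case False
  then have jd: "j - d < d" using j by simp
  have "T (krylov2 T d v w j) = T (krylov T d w (j - d))" using False j jd by (simp add: krylov_def krylov2_def)
  also have "\<dots> = (if Suc (j - d) < d then krylov T d w (Suc (j - d)) else - (\<Sum>i<d. scl (coeff h i) (krylov T d w i)))"
    by (rule krylov_image[OF h(1,2,4) jd])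
  also have "(\<Sum>i<d. scl (coeff h i) (krylov T d w i)) = (\<Sum>i<d. scl (coeff h i) (krylov2 T d v w (i + d)))"
    by (rule sum.cong) (auto simp: krylov_def krylov2_def)
  finally have *: "T (krylov2 T d v w j) = (if Suc (j - d) < d then krylov T d w (Suc (j - d))
    else - (\<Sum>i<d. scl (coeff h i) (krylov2 T d v w (i + d))))" .
  have e: "Suc (j - d) < d \<Longrightarrow> krylov T d w (Suc (j - d)) = krylov2 T d v w (Suc j)"
    using False by (simp add: krylov_def krylov2_def Suc_diff_le)
  have "\<not> Suc j < d" "d \<le> j" "Suc (j - d) < d \<longleftrightarrow> Suc j < 2 * d" using False by linarith+
  then show ?thesis unfolding * using False e by simp
qed

lemma subsp_span_rows: "subsp (span_rows l E)"
  unfolding subsp_def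
proof (intro conjI ballI allI)
  show "0 \<in> span_rows l E"
    using lin_0[OF lin_lcomb[of l E]] subspD(1)[OF subsp_cspace[of l]] by (metis imageI)
  fix u v c assume "u \<in> span_rows l E"
  then obtain a where a: "a \<in> cspace l" "u = lcomb l E a" by blast
  have "scl c u = lcomb l E (scl c a)" using a lin_scl[OF lin_lcomb[of l E]] by simp
  then show "scl c u \<in> span_rows l E" using subspD(3)[OF subsp_cspace a(1)] by blast
  assume "v \<in> span_rows l E"
  then obtain b where b: "b \<in> cspace l" "v = lcomb l E b" by blast
  have "u + v = lcomb l E (a + b)" using a b lin_add[OF lin_lcomb[of l E]] by simp
  then show "u + v \<in> span_rows l E" using subspD(2)[OF subsp_cspace a(1) b(1)] by blast
qed

lemma subsp_uminus: "subsp S \<Longrightarrow> u \<in> S \<Longrightarrow> - u \<in> (S :: 'a::comm_ring_1 poly set)"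
  using subspD(3)[of S u "-1"] by simp

lemma row_in_span: "j < l \<Longrightarrow> E j \<in> span_rows l E"
  using lcomb_monom[of j l E] monom_cspace[of j l 1] by (metis imageI)

lemma span_invariant:
  assumes "lin T" "\<And>j. j < l \<Longrightarrow> T (E j) \<in> span_rows l E"
  shows "T ` span_rows l E \<subseteq> span_rows l E"
proof (intro subsetI)
  fix u assume "u \<in> T ` span_rows l E"
  then obtain c where "u = T (lcomb l E c)" by blast
  also have "\<dots> = lcomb l (T \<circ> E) c" by (rule lin_lcomb_commute[OF assms(1)])
  finally show "u \<in> span_rows l E"
    using lcomb_closed[OF subsp_span_rows, of l "T \<circ> E" l E c] assms(2) by simp
qed

text \<open>Replacing \<open>v\<close> by its chain loses nothing, because entry 0 is
  \<open>v\<close>, and turns the pairs into input for \<open>count_pairs\<close>. Passing to the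
  quotient divides the size \<open>N\<close> of the primary part by \<open>q^l\<close>.\<close>

lemma count_krylov:
  fixes g :: "'a::{field,finite} poly"
  assumes g: "mirr g" and i: "i \<ge> 1" and l_def: "l = degree g * i"
    and Y_def: "Y = {(X, v). X \<in> prim_class S g n N \<and> v \<in> cspace n \<and> annp (lcomb n X) v = g ^ i}"
  shows "real (card Y) \<le> (if CARD('a) ^ l dvd N \<and> l \<le> n then
      indep_count CARD('a) n l * real CARD('a) ^ (l * (n - l)) * real (card (prim_class S g (n - l) (N div CARD('a) ^ l))) else 0)"
proof -
  define Z where "Z = (\<lambda>(X, v). (X, krylov (lcomb n X) l v)) ` Y"
  have deg: "degree (g ^ i) = l" using g by (simp add: l_def degree_power_eq mirr_neq_0 mult.commute)
  have mon: "monic (g ^ i)" using g by (simp add: mirr_def monic_power)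
  have l0: "l > 0" using mirr_degree[OF g] i by (simp add: l_def)
  have inj: "inj_on (\<lambda>(X, v). (X, krylov (lcomb n X) l v)) Y"
  proof (rule inj_onI)
    fix z z' assume eq: "(case z of (X, v) \<Rightarrow> (X, krylov (lcomb n X) l v)) = (case z' of (X, v) \<Rightarrow> (X, krylov (lcomb n X) l v))"
    obtain X v X' v' where z: "z = (X, v)" "z' = (X', v')" by (cases z, cases z')
    have X: "X = X'" using eq unfolding z prod.case by (rule Pair_inject)
    have "krylov (lcomb n X) l v = krylov (lcomb n X') l v'" using eq unfolding z prod.case by (rule Pair_inject)
    then have "krylov (lcomb n X) l v 0 = krylov (lcomb n X') l v' 0" by simp
    then show "z = z'" using l0 z X by (simp add: krylov_def)
  qed
  have ZY: "\<exists>v. X \<in> large_kernels_off S g n \<and> X \<in> row_fams n n \<and> prim_size n X g = N \<and> v \<in> cspace n \<and> annp (lcomb n X) v = g ^ i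
      \<and> E = krylov (lcomb n X) l v" if "(X, E) \<in> Z" for X E
    using that unfolding Z_def Y_def prim_class_def large_kernels_off_def by auto
  have indE: "E \<in> indeps l n" and WE: "span_rows l E \<subseteq> prim (lcomb n X) (cspace n) g"
    and im: "\<And>j. j < l \<Longrightarrow> lcomb n X (E j) = (if Suc j < l then E (Suc j) else - (\<Sum>k<l. scl (coeff (g ^ i) k) (E k)))"
    and Xr: "X \<in> row_fams n n" and XA: "X \<in> large_kernels_off S g n" and XN: "prim_size n X g = N"
    if "(X, E) \<in> Z" for X E
  proof -
    obtain v where v: "X \<in> large_kernels_off S g n" "X \<in> row_fams n n" "prim_size n X g = N" "v \<in> cspace n"
      "annp (lcomb n X) v = g ^ i" "E = krylov (lcomb n X) l v" using ZY[OF \<open>(X, E) \<in> Z\<close>] by blast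
    then show "X \<in> row_fams n n" "X \<in> large_kernels_off S g n" "prim_size n X g = N" by blast+
    interpret fmod "lcomb n X" "cspace n" by (rule fmod_rows[OF v(2)])
    have dv: "degree (annp (lcomb n X) v) = l" using v(5) deg by simp
    note cp = krylov_props[OF v(4) dv]
    have 0: "pact (lcomb n X) (g ^ i) v = 0" using annp_dvd[OF v(4)] v(5) by simp
    show "E \<in> indeps l n"
      using cp(1) funpow_in[OF v(4)] unfolding indeps_def row_fams_def v(6) by (simp add: krylov_def)
    show "span_rows l E \<subseteq> prim (lcomb n X) (cspace n) g"
    proof
      fix u assume "u \<in> span_rows l E"
      then have "u \<in> cyclic_span (lcomb n X) v" using cp(2) v(6) by simp
      then obtain p where u: "u = pact (lcomb n X) p v" unfolding cyclic_span_def by blast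
      have "pact (lcomb n X) (g ^ i) u = 0" unfolding u using pact_commute 0 pact_0v by metis
      then show "u \<in> prim (lcomb n X) (cspace n) g" using pact_in[OF v(4)] u unfolding prim_def by blast
    qed
    show "lcomb n X (E j) = (if Suc j < l then E (Suc j) else - (\<Sum>k<l. scl (coeff (g ^ i) k) (E k)))" if "j < l" for j
      unfolding v(6) by (rule krylov_image[OF mon deg 0 that])
  qed
  define BB where "BB = {B \<in> large_kernels_off S g (n - l). N = CARD('a) ^ l * prim_size (n - l) B g}"
  have quo: "B \<in> BB"
    if Z: "(X, E) \<in> Z" and P: "is_quot n l E P" and Br: "B \<in> row_fams (n - l) (n - l)"
      and B: "\<forall>v\<in>cspace n. P (lcomb n X v) = lcomb (n - l) B (P v)" for X E P B
  proof -
    have "B \<in> large_kernels_off S g (n - l)"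
      by (rule quot_large_kernels_off[OF indE[OF Z] XA[OF Z] P Br B g WE[OF Z]])
    moreover have "N = CARD('a) ^ l * prim_size (n - l) B g"
      using quot_sizes(2)[OF indE[OF Z] Xr[OF Z] P B g WE[OF Z]] XN[OF Z] by simp
    ultimately show ?thesis by (simp add: BB_def)
  qed
  have finB: "finite BB" by (simp add: BB_def)
  have le: "real (card Z) \<le> indep_count CARD('a) n l * real CARD('a) ^ (l * (n - l)) * real (card BB)"
  proof (rule count_pairs[OF _ _ _ quo finB])
    show "Z \<subseteq> row_fams n n \<times> indeps l n" using indE Xr by auto
    show "lcomb n X ` span_rows l E \<subseteq> span_rows l E" if Z: "(X, E) \<in> Z" for X E
    proof (rule span_invariant[OF lin_lcomb])
      fix j assume "j < l"
      moreover have "- (\<Sum>k<l. scl (coeff (g ^ i) k) (E k)) \<in> span_rows l E"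
      proof (rule subsp_uminus[OF subsp_span_rows], rule subsp_sum[OF subsp_span_rows])
        show "scl (coeff (g ^ i) k) (E k) \<in> span_rows l E" if "k \<in> {..<l}" for k
          by (rule subspD(3)[OF subsp_span_rows row_in_span]) (use that in simp)
      qed
      ultimately show "lcomb n X (E j) \<in> span_rows l E"
        using im[OF Z, of j] row_in_span[of "Suc j" l E] by simp
    qed
    show "lcomb n X (E j) = lcomb n X' (E j)" if "(X, E) \<in> Z" "(X', E) \<in> Z" "j < l" for X X' E j
      using im[OF that(1,3)] im[OF that(2,3)] by simp
  qed
  have cYZ: "card Y = card Z" unfolding Z_def by (rule card_image[OF inj, symmetric])
  show ?thesis
  \<comment> \<open>The guard in the claim: if \<open>q^l\<close> does not divide \<open>N\<close>,
    then \<open>BB\<close> is empty; for \<open>l > n\<close> the factor \<open>indep_count\<close>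
    is 0.\<close>
  proof (cases "CARD('a) ^ l dvd N \<and> l \<le> n")
    case True
    then obtain M where M: "N = CARD('a) ^ l * M" by (elim conjE dvdE)
    then have "BB = prim_class S g (n - l) (N div CARD('a) ^ l)" unfolding BB_def prim_class_def by auto
    then show ?thesis using le cYZ True by simp
  next
    case False
    have "indep_count CARD('a) n l * real CARD('a) ^ (l * (n - l)) * real (card BB) = 0"
    proof (cases "l \<le> n")
      case True
      then have "BB = {}" using False unfolding BB_def by auto
      then show ?thesis by simp
    next
      case False
      then have "indep_count CARD('a) n l = 0" unfolding indep_count_def by (intro prod_zero) auto
      then show ?thesis by simp
    qed
    then show ?thesis using le cYZ unfolding if_not_P[OF False] by linarith
  qed
qed

lemma prim_0: 
  assumes "X \<in> row_fams n n"
  shows "0 \<in> prim (lcomb n X) (cspace n :: 'a::{field,finite} poly set) g"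
    "0 \<in> kern (lcomb n X) (cspace n :: 'a poly set) g"
    "kern (lcomb n X) (cspace n) g \<subseteq> prim (lcomb n X) (cspace n) g"
proof -
  interpret fmod "lcomb n X" "cspace n" by (rule fmod_rows[OF assms])
  have "pact (lcomb n X) (g ^ 0) 0 = 0" by simp
  then show "0 \<in> prim (lcomb n X) (cspace n) g"
    using subspD(1)[OF subsp] unfolding prim_def by blast
  show "0 \<in> kern (lcomb n X) (cspace n) g"
    using subspD(1)[OF subsp] pact_0v unfolding kern_def by simp
  have "pact (lcomb n X) (g ^ 1) v = 0" if "pact (lcomb n X) g v = 0" for v using that by simp
  then show "kern (lcomb n X) (cspace n) g \<subseteq> prim (lcomb n X) (cspace n) g"
    unfolding kern_def prim_def by blast
qed

lemma finite_kern_prim [simp]: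
  "finite (kern T (cspace n :: 'a::{field,finite} poly set) g)"
  "finite (prim T (cspace n :: 'a::{field,finite} poly set) g)"
  by (simp_all add: kern_def prim_def)

lemma prim_size_pos: "X \<in> row_fams n n \<Longrightarrow> prim_size n X g > 0"
  using prim_0(1)[of X n g] unfolding prim_size_def by (auto simp: card_gt_0_iff)

lemma prim_class_0: "prim_class S g n 0 = {}"
proof -
  have "prim_size n X g \<noteq> 0" if "X \<in> large_kernels_off S g n" for X
    using prim_size_pos[of X n g] that unfolding large_kernels_off_def by simp
  then show ?thesis unfolding prim_class_def by blast
qed

text \<open>Double counting of pairs of a matrix and a nonzero vector of its
  \<open>g\<close>-primary part: each matrix has \<open>N - 1\<close> such vectors, and each of them
  has annihilator \<open>g^i\<close> for some \<open>i\<close> from 1 to \<open>n\<close>, the case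
  of \<open>count_krylov\<close>.\<close>

lemma prim_class_step:
  fixes g :: "'a::{field,finite} poly"
  assumes g: "mirr g"
  shows "(real N - 1) * real (card (prim_class S g n N)) \<le> (\<Sum>i=1..n.
    if CARD('a) ^ (degree g * i) dvd N \<and> degree g * i \<le> n then
      indep_count CARD('a) n (degree g * i) * real CARD('a) ^ (degree g * i * (n - degree g * i)) *
      real (card (prim_class S g (n - degree g * i) (N div CARD('a) ^ (degree g * i)))) else 0)"
    (is "_ \<le> (\<Sum>i=1..n. ?f i)")
proof -
  define Y where "Y i = {(X, v). X \<in> prim_class S g n N \<and> v \<in> cspace n \<and> annp (lcomb n X) v = g ^ i}" for i
  define Y0 where "Y0 = (SIGMA X:prim_class S g n N. prim (lcomb n X) (cspace n) g - {0})"
  have Y0Y: "Y0 \<subseteq> (\<Union>i\<in>{1..n}. Y i)"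
  proof
    fix z assume "z \<in> Y0"
    then obtain X v where z: "z = (X, v)" "X \<in> prim_class S g n N" "v \<in> prim (lcomb n X) (cspace n) g" "v \<noteq> 0"
      unfolding Y0_def by auto
    have X: "X \<in> row_fams n n" using z(2) by (simp add: prim_class_def large_kernels_off_def)
    interpret fmod "lcomb n X" "cspace n" by (rule fmod_rows[OF X])
    have v: "v \<in> cspace n" using z(3) by (simp add: prim_def)
    obtain i where i: "i \<ge> 1" "annp (lcomb n X) v = g ^ i" using annp_prim(2)[OF g z(3,4)] by blast
    have deg: "degree (annp (lcomb n X) v) = degree g * i"
      unfolding i(2) using g by (simp add: degree_power_eq mirr_neq_0 mult.commute)
    have "card (cyclic_span (lcomb n X) v) \<le> card (cspace n :: 'a poly set)"
      by (intro card_mono finite_cspace cyclic_span_sub v)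
    then have "CARD('a) ^ (degree g * i) \<le> CARD('a) ^ n"
      using krylov_props(3)[OF v deg] by (simp add: card_cspace)
    then have "degree g * i \<le> n" using card_field_gt_1[where 'a='a] by simp
    moreover have "i \<le> degree g * i" using mirr_degree[OF g] by simp
    ultimately have "i \<le> n" by linarith
    then show "z \<in> (\<Union>i\<in>{1..n}. Y i)" using i z(1,2) v unfolding Y_def by auto
  qed
  have finY: "finite (Y i)" for i
    by (rule finite_subset[of _ "prim_class S g n N \<times> cspace n"]) (auto simp: Y_def)
  have "card Y0 = (\<Sum>X\<in>prim_class S g n N. card (prim (lcomb n X) (cspace n) g - {0}))"
    unfolding Y0_def by (rule card_SigmaI) auto
  also have "\<dots> = (\<Sum>X\<in>prim_class S g n N. N - 1)"
  proof (rule sum.cong[OF refl])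
    fix X assume "X \<in> prim_class S g n N"
    then have "X \<in> row_fams n n" "prim_size n X g = N" by (simp_all add: prim_class_def large_kernels_off_def)
    then show "card (prim (lcomb n X) (cspace n) g - {0}) = N - 1"
      using prim_0(1)[of X n g] by (simp add: prim_size_def card_Diff_singleton)
  qed
  also have "\<dots> = card (prim_class S g n N) * (N - 1)" by simp
  finally have c0: "card Y0 = card (prim_class S g n N) * (N - 1)" .
  have "card Y0 \<le> card (\<Union>i\<in>{1..n}. Y i)" by (rule card_mono[OF _ Y0Y]) (simp add: finY)
  also have "\<dots> \<le> (\<Sum>i=1..n. card (Y i))" by (rule card_UN_le) simp
  finally have "real (card Y0) \<le> (\<Sum>i=1..n. real (card (Y i)))"
    by (simp only: of_nat_le_iff of_nat_sum[symmetric])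
  also have "\<dots> \<le> (\<Sum>i=1..n. ?f i)"
    by (intro sum_mono count_krylov[OF g _ refl Y_def]) simp
  finally have le: "real (card (prim_class S g n N) * (N - 1)) \<le> (\<Sum>i=1..n. ?f i)" by (simp only: c0)
  show ?thesis
  proof (cases "N = 0")
    case True
    then have "prim_class S g n N = {}" by (simp only: prim_class_0)
    then show ?thesis using le by simp
  next
    case False
    then have "real (card (prim_class S g n N) * (N - 1)) = (real N - 1) * real (card (prim_class S g n N))"
      by (simp add: of_nat_diff mult.commute)
    then show ?thesis using le by (simp only:)
  qed
qed

text \<open>A kernel with at least \<open>Q^2\<close> elements offers at least
  \<open>Q^2 - 1\<close> choices of \<open>v\<close> and then \<open>Q^2 - Q\<close> choices of
  \<open>w\<close> outside the line of \<open>v\<close>. Each choice spans two companion blocks, and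
  \<open>count_pairs\<close> applies with no condition at \<open>g\<close> on the quotient.\<close>

lemma count_krylov2:
  fixes g :: "'a::{field,finite} poly"
  assumes g: "mirr g" and d: "degree g = d"
  defines "Q \<equiv> real CARD('a) ^ d"
  shows "real (card {X \<in> large_kernels (insert g S) n. CARD('a) ^ (2 * d) \<le> ker_size n X g}) * ((Q\<^sup>2 - 1) * (Q\<^sup>2 - Q))
    \<le> indep_count CARD('a) n (2 * d) * real CARD('a) ^ (2 * d * (n - 2 * d)) * real (card (large_kernels_off S g (n - 2 * d)))"
proof -
  define A where "A = {X \<in> large_kernels (insert g S) n. CARD('a) ^ (2 * d) \<le> ker_size n X g}"
  define kr where "kr X = kern (lcomb n X) (cspace n) g" for X :: "nat \<Rightarrow> 'a poly"
  define Y where "Y X = (SIGMA v:kr X - {0}. kr X - cyclic_span (lcomb n X) v)" for X :: "nat \<Rightarrow> 'a poly"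
  define e where "e X = (\<lambda>(v, w). krylov2 (lcomb n X) d v w)" for X :: "nat \<Rightarrow> 'a poly"
  define Z where "Z = (SIGMA X:A. e X ` Y X)"
  have mon: "monic g" using g by (simp add: mirr_def)
  have d0: "d > 0" using mirr_degree[OF g] d by simp
  have Ar: "X \<in> row_fams n n" if "X \<in> A" for X using that by (simp add: A_def large_kernels_def)
  have AA: "X \<in> large_kernels_off S g n" if "X \<in> A" for X using that by (auto simp: A_def large_kernels_def large_kernels_off_def large_or_trivial_def)
  have inj: "inj_on (e X) (Y X)" for X
  proof (rule inj_onI)
    fix z z' assume eq: "e X z = e X z'"
    obtain v w v' w' where z: "z = (v, w)" "z' = (v', w')" by (cases z, cases z')
    have "e X (v, w) 0 = e X (v', w') 0" "e X (v, w) d = e X (v', w') d" using eq z by simp_all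
    then show "z = z'" using d0 z by (simp add: e_def krylov2_def)
  qed
  have finY: "finite (Y X)" for X unfolding Y_def kr_def by (intro finite_SigmaI) auto
  have indE: "E \<in> indeps (2 * d) n" and WE: "span_rows (2 * d) E \<subseteq> prim (lcomb n X) (cspace n) g"
    and im: "\<And>j. j < 2 * d \<Longrightarrow> lcomb n X (E j) = (if Suc j < d \<or> d \<le> j \<and> Suc j < 2 * d then E (Suc j)
      else if j < d then - (\<Sum>i<d. scl (coeff g i) (E i)) else - (\<Sum>i<d. scl (coeff g i) (E (i + d))))"
    and XA: "X \<in> A"
    if "(X, E) \<in> Z" for X E
  proof -
    show XA: "X \<in> A" using \<open>(X, E) \<in> Z\<close> unfolding Z_def by blast
    have "E \<in> e X ` Y X" using \<open>(X, E) \<in> Z\<close> unfolding Z_def by (rule SigmaD2)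
    then obtain z where z: "E = e X z" "z \<in> Y X" by (rule imageE)
    obtain v w where vw: "z = (v, w)" by (cases z)
    have v: "v \<in> kr X" "v \<noteq> 0" and w: "w \<in> kr X - cyclic_span (lcomb n X) v"
      using z(2) unfolding vw Y_def by (simp_all only: mem_Sigma_iff Diff_iff singleton_iff simp_thms)
    have E: "E = krylov2 (lcomb n X) d v w" unfolding z(1) vw e_def by simp
    interpret fmod "lcomb n X" "cspace n" by (rule fmod_rows[OF Ar[OF XA]])
    note c2 = krylov2_props[OF g v(1)[unfolded kr_def] v(2) w[unfolded kr_def] d]
    have V: "v \<in> cspace n" "w \<in> cspace n" "pact (lcomb n X) g v = 0" "pact (lcomb n X) g w = 0"
      using v w by (auto simp: kr_def kern_def)
    show "E \<in> indeps (2 * d) n"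
      using c2(1) funpow_in[OF V(1)] funpow_in[OF V(2)] unfolding indeps_def row_fams_def E by (simp add: krylov2_def)
    show "span_rows (2 * d) E \<subseteq> prim (lcomb n X) (cspace n) g"
      using c2(2) prim_0(3)[OF Ar[OF XA]] unfolding E by (rule subset_trans)
    show "\<And>j. j < 2 * d \<Longrightarrow> lcomb n X (E j) = (if Suc j < d \<or> d \<le> j \<and> Suc j < 2 * d then E (Suc j)
      else if j < d then - (\<Sum>i<d. scl (coeff g i) (E i)) else - (\<Sum>i<d. scl (coeff g i) (E (i + d))))"
      unfolding E by (rule krylov2_image[OF mon d V(3,4)])
  qed
  have le: "real (card Z) \<le> indep_count CARD('a) n (2 * d) * real CARD('a) ^ (2 * d * (n - 2 * d)) *
      real (card (large_kernels_off S g (n - 2 * d)))"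
  proof (rule count_pairs)
    show "Z \<subseteq> row_fams n n \<times> indeps (2 * d) n" using indE Ar XA by auto
    show "lcomb n X ` span_rows (2 * d) E \<subseteq> span_rows (2 * d) E" if Z: "(X, E) \<in> Z" for X E
    proof (rule span_invariant[OF lin_lcomb])
      fix j assume j: "j < 2 * d"
      have s1: "- (\<Sum>i<d. scl (coeff g i) (E (i + m))) \<in> span_rows (2 * d) E" if "m \<le> d" for m
      proof -
        have "(\<Sum>i<d. scl (coeff g i) (E (i + m))) \<in> span_rows (2 * d) E"
        proof (rule subsp_sum[OF subsp_span_rows])
          show "scl (coeff g i) (E (i + m)) \<in> span_rows (2 * d) E" if "i \<in> {..<d}" for i
            by (rule subspD(3)[OF subsp_span_rows row_in_span]) (use that \<open>m \<le> d\<close> in simp)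
        qed
        then show ?thesis by (rule subsp_uminus[OF subsp_span_rows])
      qed
      show "lcomb n X (E j) \<in> span_rows (2 * d) E"
        using im[OF Z j] row_in_span[of "Suc j" "2 * d" E] s1[of 0] s1[of d] j by (simp split: if_splits)
    qed
    show "lcomb n X (E j) = lcomb n X' (E j)" if "(X, E) \<in> Z" "(X', E) \<in> Z" "j < 2 * d" for X X' E j
      using im[OF that(1,3)] im[OF that(2,3)] by simp
    show "B \<in> large_kernels_off S g (n - 2 * d)"
      if Z: "(X, E) \<in> Z" and P: "is_quot n (2 * d) E P" and Br: "B \<in> row_fams (n - 2 * d) (n - 2 * d)"
      and B: "\<forall>v\<in>cspace n. P (lcomb n X v) = lcomb (n - 2 * d) B (P v)" for X E P B
      by (rule quot_large_kernels_off[OF indE[OF Z] AA[OF XA[OF Z]] P Br B g WE[OF Z]])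
  qed simp
  have cardY: "(Q\<^sup>2 - 1) * (Q\<^sup>2 - Q) \<le> real (card (Y X))" if X: "X \<in> A" for X
  proof -
    interpret fmod "lcomb n X" "cspace n" by (rule fmod_rows[OF Ar[OF X]])
    define K where "K = card (kr X)"
    have fk: "finite (kr X)" by (simp add: kr_def)
    have K: "Q\<^sup>2 \<le> real K"
    proof -
      have "CARD('a) ^ (2 * d) \<le> K" using X by (simp add: A_def ker_size_def K_def kr_def)
      then have "real (CARD('a) ^ (2 * d)) \<le> real K" by (simp only: of_nat_le_iff)
      then show ?thesis by (simp add: Q_def power_mult[symmetric] mult.commute)
    qed
    have Q1: "Q \<ge> 1" using card_field_gt_1[where 'a='a] by (simp add: Q_def one_le_power)
    have cw: "Q\<^sup>2 - Q \<le> real (card (kr X - cyclic_span (lcomb n X) v))" if v: "v \<in> kr X - {0}" for v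
    proof -
      have vV: "v \<in> cspace n" using v by (simp add: kr_def kern_def)
      have "annp (lcomb n X) v = g" using annp_kern[OF g] v by (simp add: kr_def)
      then have c: "card (cyclic_span (lcomb n X) v) = CARD('a) ^ d" using krylov_props(3)[OF vV] d by simp
      have "card (kr X) - card (cyclic_span (lcomb n X) v) \<le> card (kr X - cyclic_span (lcomb n X) v)"
        by (rule diff_card_le_card_Diff) (rule finite_subset[OF cyclic_span_sub[OF vV] finite_cspace])
      then have "real K - real (CARD('a) ^ d) \<le> real (card (kr X - cyclic_span (lcomb n X) v))"
        unfolding c K_def by linarith
      then show ?thesis using K by (simp add: Q_def)
    qed
    have c0: "real (card (kr X - {0})) = real K - 1"
    proof -
      have "0 \<in> kr X" using prim_0(2)[OF Ar[OF X]] by (simp add: kr_def)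
      moreover from this have "K > 0" using fk by (auto simp: K_def card_gt_0_iff)
      ultimately show ?thesis using fk by (simp add: K_def card_Diff_singleton of_nat_diff)
    qed
    have "card (Y X) = (\<Sum>v\<in>kr X - {0}. card (kr X - cyclic_span (lcomb n X) v))"
      unfolding Y_def by (rule card_SigmaI) (use fk in auto)
    then have "real (card (Y X)) = (\<Sum>v\<in>kr X - {0}. real (card (kr X - cyclic_span (lcomb n X) v)))" by simp
    also have "\<dots> \<ge> (\<Sum>v\<in>kr X - {0}. Q\<^sup>2 - Q)" by (intro sum_mono cw)
    also have "(\<Sum>v\<in>kr X - {0}. Q\<^sup>2 - Q) = (real K - 1) * (Q\<^sup>2 - Q)" using c0 by simp
    finally have "(real K - 1) * (Q\<^sup>2 - Q) \<le> real (card (Y X))" .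
    moreover have "Q \<le> Q\<^sup>2" using Q1 by (simp add: power2_eq_square)
    then have "(Q\<^sup>2 - 1) * (Q\<^sup>2 - Q) \<le> (real K - 1) * (Q\<^sup>2 - Q)"
      using K by (intro mult_right_mono) auto
    ultimately show ?thesis by linarith
  qed
  have finA: "finite A" by (simp add: A_def)
  have "card Z = (\<Sum>X\<in>A. card (e X ` Y X))" unfolding Z_def
    by (rule card_SigmaI) (use finA finY in auto)
  also have "\<dots> = (\<Sum>X\<in>A. card (Y X))" by (intro sum.cong refl card_image inj)
  finally have "real (card Z) = (\<Sum>X\<in>A. real (card (Y X)))" by simp
  moreover have "(\<Sum>X\<in>A. (Q\<^sup>2 - 1) * (Q\<^sup>2 - Q)) \<le> (\<Sum>X\<in>A. real (card (Y X)))" by (intro sum_mono cardY)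
  ultimately have "real (card A) * ((Q\<^sup>2 - 1) * (Q\<^sup>2 - Q)) \<le> real (card Z)" by simp
  then show ?thesis using le unfolding A_def by linarith
qed

section \<open>Recursion over the irreducible polynomials\<close>

lemma omega_0 [simp]: "omega 0 Q = 1"
  by (simp add: omega_def)

lemma omega_Suc: "omega (Suc k) Q = omega k Q * (1 - inverse (Q ^ Suc k))"
  by (simp add: omega_def)

text \<open>Euler's pentagonal series in \<open>z = 1/Q\<close> begins with 1 - z - z^2, and these
  terms bound all partial products from below.\<close>

lemma omega_lower:
  assumes "Q > 1"
  shows "omega k Q \<ge> 1 - 1 / Q - 1 / Q\<^sup>2"
proof -
  define z where "z = 1 / Q"
  have z: "0 < z" "z < 1" using assms by (auto simp: z_def)
  have inv: "inverse (Q ^ m) = z ^ m" for m by (simp add: z_def power_divide inverse_eq_divide)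
  \<comment> \<open>The extra term \<open>z^(k+2)\<close> closes the induction: multiplying by the
    next factor leaves the surplus \<open>z^(k+4) - z^(2k+4)\<close>, which is nonnegative.\<close>
  have "omega (Suc k) Q \<ge> 1 - z - z\<^sup>2 + z ^ (k + 2)" for k
  proof (induction k)
    case 0
    then show ?case by (simp add: omega_def inv power2_eq_square) (simp add: z_def inverse_eq_divide)
  next
    case (Suc k)
    have f: "0 \<le> 1 - z ^ (k + 2)" using power_le_one[of z "k + 2"] z by linarith
    have "z ^ (2 * k + 4) \<le> z ^ (k + 4)" using z by (intro power_decreasing) auto
    moreover have "(1 - z - z\<^sup>2 + z ^ (k + 2)) * (1 - z ^ (k + 2))
        = 1 - z - z\<^sup>2 + z ^ (k + 3) + z ^ (k + 4) - z ^ (2 * k + 4)"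
    proof -
      have e: "z ^ (k + 2) = z ^ k * z\<^sup>2" "z ^ (k + 3) = z ^ k * z ^ 3" "z ^ (k + 4) = z ^ k * z ^ 4"
        "z ^ (2 * k + 4) = z ^ k * z ^ k * z ^ 4"
        by (simp_all only: power_add mult_2)
      show ?thesis unfolding e by (simp add: algebra_simps power2_eq_square power3_eq_cube power4_eq_xxxx)
    qed
    ultimately have "1 - z - z\<^sup>2 + z ^ (Suc k + 2) \<le> (1 - z - z\<^sup>2 + z ^ (k + 2)) * (1 - z ^ (k + 2))"
      by (simp add: numeral_eq_Suc)
    also have "\<dots> \<le> omega (Suc k) Q * (1 - z ^ (k + 2))" using Suc f by (rule mult_right_mono)
    also have "\<dots> = omega (Suc (Suc k)) Q" by (simp only: omega_Suc[of "Suc k"] inv add_2_eq_Suc')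
    finally show ?case .
  qed note * = this
  have "omega k Q \<ge> 1 - z - z\<^sup>2"
  proof (cases k)
    case 0
    show ?thesis unfolding 0 omega_0 using z zero_le_power2[of z] by linarith
  next
    case (Suc m)
    have "z ^ (m + 2) \<ge> 0" using z by simp
    then show ?thesis using *[of m] unfolding Suc by linarith
  qed
  then show ?thesis by (simp add: z_def power_divide)
qed

lemma omega_lower_pos:
  assumes "(Q :: real) \<ge> 2"
  shows "1 - 1 / Q - 1 / Q\<^sup>2 > 0"
proof -
  have "1 / Q \<le> 1 / 2" using assms by (simp add: field_simps)
  moreover have "1 / Q\<^sup>2 \<le> 1 / 4" 
    using power_mono[OF assms, of 2] by (intro frac_le) auto
  ultimately show ?thesis by linarith
qed

lemma omega_pos: "Q > 1 \<Longrightarrow> omega k Q > 0"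
  unfolding omega_def by (intro prod_pos) (auto simp: inverse_eq_divide power_gt1)

text \<open>The number of nilpotent \<open>k \<times> k\<close> matrices over a field with \<open>Q\<close> elements, divided by
  \<open>|GL(k,Q)|\<close>.\<close>
definition nilp_weight :: "real \<Rightarrow> nat \<Rightarrow> real" where
  "nilp_weight Q k = 1 / (Q ^ k * omega k Q)"

lemma nilp_weight_nonneg: "Q > 1 \<Longrightarrow> nilp_weight Q k \<ge> 0"
  unfolding nilp_weight_def using omega_pos[of Q k] by simp

text \<open>By induction, since \<open>Q^k * nilp_weight Q k = 1 / omega k Q\<close> equals
  \<open>(Q^(k+1) - 1) * nilp_weight Q (k+1)\<close>.\<close>

lemma sum_nilp_weight:
  assumes "Q > 1"
  shows "(\<Sum>j\<le>k. nilp_weight Q j) = Q ^ k * nilp_weight Q k"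
proof (induction k)
  case 0
  then show ?case by (simp add: nilp_weight_def)
next
  case (Suc k)
  have o: "omega k Q > 0" "omega (Suc k) Q > 0" using omega_pos[OF assms] by auto
  have Q: "Q ^ Suc k > 1" using assms by (rule power_gt1)
  have "Q ^ k * nilp_weight Q k = 1 / omega k Q" using assms by (simp add: nilp_weight_def)
  also have "\<dots> = (Q ^ Suc k - 1) * nilp_weight Q (Suc k)"
  proof -
    have "omega (Suc k) Q * Q ^ Suc k = omega k Q * (Q ^ Suc k - 1)"
      using assms by (simp add: omega_Suc field_simps)
    then show ?thesis using o assms Q by (simp add: nilp_weight_def field_simps)
  qed
  finally show ?case using Suc by (simp add: algebra_simps)
qed

text \<open>The weights satisfy with equality the recursion that \<open>prim_class_step\<close>
  yields after division by the group orders.\<close>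

lemma sum_nilp_weight_less:
  assumes "Q > 1"
  shows "(\<Sum>j<k. nilp_weight Q j) = (Q ^ k - 1) * nilp_weight Q k"
  using sum_nilp_weight[OF assms, of k] by (simp add: lessThan_Suc_atMost[symmetric] algebra_simps)

lemma indep_count_pos: "q > 1 \<Longrightarrow> indep_count q n n > 0"
  unfolding indep_count_def by (intro prod_pos) (auto intro!: power_strict_increasing)

text \<open>The product splits at \<open>i = l\<close>, and the later factors share
  \<open>q^l\<close>. Thus the prefactor in \<open>count_pairs\<close> is the ratio of the orders of
  GL(n,q) and GL(n-l,q).\<close>

lemma indep_count_split:
  assumes "l \<le> n"
  shows "indep_count q n n = indep_count q n l * real q ^ (l * (n - l)) * indep_count q (n - l) (n - l)"
proof -
  have "{..<n} = {..<l} \<union> {l..<n}" "{..<l} \<inter> {l..<n} = {}" using assms by auto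
  then have "indep_count q n n = indep_count q n l * (\<Prod>i=l..<n. real q ^ n - real q ^ i)"
    unfolding indep_count_def using prod.union_disjoint[of "{..<l}" "{l..<n}" "\<lambda>i. real q ^ n - real q ^ i"] by simp
  also have "(\<Prod>i=l..<n. real q ^ n - real q ^ i) = (\<Prod>i<n-l. real q ^ n - real q ^ (i + l))"
    by (rule prod.reindex_bij_witness[of _ "\<lambda>i. i + l" "\<lambda>i. i - l"]) (use assms in auto)
  also have "\<dots> = (\<Prod>i<n-l. real q ^ l * (real q ^ (n - l) - real q ^ i))"
    using assms by (intro prod.cong refl) (simp add: algebra_simps power_add[symmetric])
  also have "\<dots> = real q ^ (l * (n - l)) * indep_count q (n - l) (n - l)"
    by (simp add: prod.distrib indep_count_def power_mult)
  finally show ?thesis by simp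
qed

definition dens :: "'a::{field,finite} poly set \<Rightarrow> nat \<Rightarrow> real" where
  "dens S n = real (card (large_kernels S n)) / indep_count CARD('a) n n"

lemma dens_nonneg: "dens (S :: 'a::{field,finite} poly set) n \<ge> 0"
  unfolding dens_def using indep_count_pos[OF card_field_gt_1[where 'a='a], of n] by simp

lemma field_power_gt_1: "d > 0 \<Longrightarrow> CARD('a::{field,finite}) ^ d > 1"
  by (rule one_less_power[OF card_field_gt_1])

lemma prim_class_1:
  assumes "g \<notin> S"
  shows "prim_class S g n 1 \<subseteq> large_kernels S n"
proof
  fix X assume X: "X \<in> prim_class S g n 1"
  then have Xr: "X \<in> row_fams n n" and p: "prim_size n X g = 1"
    and large_or_trivial: "\<And>g'. mirr g' \<Longrightarrow> g' \<noteq> g \<Longrightarrow> large_or_trivial S n X g'" by (auto simp: prim_class_def large_kernels_off_def)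
  obtain x where "prim (lcomb n X) (cspace n) g = {x}" using p unfolding prim_size_def by (rule card_1_singletonE)
  then have "kern (lcomb n X) (cspace n) g = {0}" using prim_0[OF Xr, of g] by auto
  then have "large_or_trivial S n X g" by (simp add: large_or_trivial_def ker_size_def)
  then show "X \<in> large_kernels S n" using large_or_trivial Xr unfolding large_kernels_def by blast
qed

text \<open>If \<open>N > 1\<close> is not a power of \<open>Q = q^(deg g)\<close>, neither is any
  \<open>N / Q^i\<close>, so by induction the right side of \<open>prim_class_step\<close> vanishes
  while \<open>N - 1\<close> is positive.\<close>

lemma prim_class_not_power:
  fixes g :: "'a::{field,finite} poly"
  assumes g: "mirr g"
  shows "(\<And>k. N \<noteq> CARD('a) ^ (degree g * k)) \<Longrightarrow> card (prim_class S g n N) = 0"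
proof (induction N arbitrary: n rule: less_induct)
  case (less N)
  show ?case
  proof (cases "N = 0")
    case True
    then show ?thesis by (simp add: prim_class_0)
  next
    case False
    have N1: "N \<noteq> 1" using less.prems[of 0] by simp
    have z: "card (prim_class S g m (N div CARD('a) ^ (degree g * i))) = 0"
      if i: "i \<ge> 1" "CARD('a) ^ (degree g * i) dvd N" for i m
    proof (rule less.IH)
      obtain M where M: "N = CARD('a) ^ (degree g * i) * M" using i(2) by (rule dvdE)
      have gt: "CARD('a) ^ (degree g * i) > 1"
        using mirr_degree[OF g] i(1) by (intro field_power_gt_1) simp
      show "N div CARD('a) ^ (degree g * i) < N" using gt False by (intro div_less_dividend) auto
      show "N div CARD('a) ^ (degree g * i) \<noteq> CARD('a) ^ (degree g * k)" for k
        using less.prems[of "i + k"] M gt by (auto simp: power_add distrib_left)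
    qed
    have "(real N - 1) * real (card (prim_class S g n N)) \<le> 0"
      by (rule order_trans[OF prim_class_step[OF g]]) (auto intro!: sum_nonpos simp: z)
    moreover have "real N - 1 > 0" using False N1 by linarith
    ultimately have "real (card (prim_class S g n N)) \<le> 0" by (simp add: mult_le_0_iff)
    then show ?thesis by simp
  qed
qed

text \<open>Strong induction on \<open>k\<close>. Whichever \<open>F[t]/g^i\<close> is split off
  first, stripping the remaining \<open>k - i\<close> layers ends in dimension
  \<open>n - d k\<close>; the density there is a common factor, and the coefficients obey the
  recursion solved by \<open>nilp_weight\<close>.\<close>

lemma prim_class_power:
  fixes g :: "'a::{field,finite} poly"
  assumes g: "mirr g" "g \<notin> S" and d: "degree g = d"
  defines "Q \<equiv> real CARD('a) ^ d"
  shows "real (card (prim_class S g n (CARD('a) ^ (d * k)))) \<le>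
    indep_count CARD('a) n n * (if d * k \<le> n then nilp_weight Q k * dens S (n - d * k) else 0)"
proof (induction k arbitrary: n rule: less_induct)
  case (less k)
  let ?q = "CARD('a)"
  have d0: "d > 0" using mirr_degree[OF g(1)] d by simp
  have Q1: "Q > 1" unfolding Q_def using field_power_gt_1[OF d0, where 'a='a] by (metis of_nat_1 of_nat_less_iff of_nat_power)
  have Gpos: "indep_count ?q m m > 0" for m by (rule indep_count_pos[OF card_field_gt_1])
  show ?case
  proof (cases "k = 0")
    case True
    have "card (prim_class S g n 1) \<le> card (large_kernels S n)" by (intro card_mono prim_class_1[OF g(2)]) simp
    then show ?thesis using True Gpos[of n] by (simp add: dens_def nilp_weight_def)
  next
    case False
    define R where "R = (if d * k \<le> n then dens S (n - d * k) else 0)"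
    have R0: "R \<ge> 0" by (simp add: R_def dens_nonneg)
    have bound: "(if ?q ^ (degree g * i) dvd ?q ^ (d * k) \<and> degree g * i \<le> n then
      indep_count ?q n (degree g * i) * real ?q ^ (degree g * i * (n - degree g * i)) *
      real (card (prim_class S g (n - degree g * i) (?q ^ (d * k) div ?q ^ (degree g * i)))) else 0)
      \<le> (if i \<le> k then indep_count ?q n n * (nilp_weight Q (k - i) * R) else 0)" if i: "i \<in> {1..n}" for i
    proof (cases "?q ^ (d * i) dvd ?q ^ (d * k) \<and> d * i \<le> n")
      case True
      have "d * i \<le> d * k" using True card_field_gt_1[where 'a='a] power_dvd_imp_le by blast
      then have ik: "i \<le> k" using d0 by simp
      have div: "?q ^ (d * k) div ?q ^ (d * i) = ?q ^ (d * (k - i))"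
        using ik by (simp add: power_diff[symmetric] diff_mult_distrib2)
      have eq: "n - d * i - d * (k - i) = n - d * k" using ik by (simp add: diff_mult_distrib2)
      have iff: "d * (k - i) \<le> n - d * i \<longleftrightarrow> d * k \<le> n"
        using ik True by (simp add: diff_mult_distrib2) linarith
      have "real (card (prim_class S g (n - d * i) (?q ^ (d * (k - i))))) \<le>
        indep_count ?q (n - d * i) (n - d * i) * (if d * (k - i) \<le> n - d * i then nilp_weight Q (k - i) * dens S (n - d * i - d * (k - i)) else 0)"
        using less.IH[of "k - i"] False i by simp
      also have "\<dots> = indep_count ?q (n - d * i) (n - d * i) * (nilp_weight Q (k - i) * R)"
        unfolding iff eq by (simp add: R_def)
      finally have "indep_count ?q n (d * i) * real ?q ^ (d * i * (n - d * i)) * real (card (prim_class S g (n - d * i) (?q ^ (d * (k - i)))))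
        \<le> indep_count ?q n (d * i) * real ?q ^ (d * i * (n - d * i)) * (indep_count ?q (n - d * i) (n - d * i) * (nilp_weight Q (k - i) * R))"
      proof (rule mult_left_mono)
        have "indep_count ?q n (d * i) * real ?q ^ (d * i * (n - d * i)) * indep_count ?q (n - d * i) (n - d * i) > 0"
          using Gpos[of n] indep_count_split[of "d * i" n ?q] True by simp
        then show "0 \<le> indep_count ?q n (d * i) * real ?q ^ (d * i * (n - d * i))"
          using Gpos[of "n - d * i"] by (metis less_eq_real_def zero_less_mult_pos2)
      qed
      also have "\<dots> = indep_count ?q n n * (nilp_weight Q (k - i) * R)"
        using indep_count_split[of "d * i" n ?q] True by simp
      finally show ?thesis using True ik d by (simp add: div)
    next
      case False
      then show ?thesis using d Gpos[of n] nilp_weight_nonneg[OF Q1] R0 by auto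
    qed
    have "(real (?q ^ (d * k)) - 1) * real (card (prim_class S g n (?q ^ (d * k))))
      \<le> (\<Sum>i=1..n. if i \<le> k then indep_count ?q n n * (nilp_weight Q (k - i) * R) else 0)"
      by (rule order_trans[OF prim_class_step[OF g(1)]]) (rule sum_mono[OF bound])
    also have "\<dots> = (\<Sum>i\<in>{1..n} \<inter> {1..k}. indep_count ?q n n * (nilp_weight Q (k - i) * R))"
      by (subst sum.inter_restrict) (auto intro!: sum.cong)
    also have "\<dots> \<le> (\<Sum>i=1..k. indep_count ?q n n * (nilp_weight Q (k - i) * R))"
      using Gpos[of n] nilp_weight_nonneg[OF Q1] R0 by (intro sum_mono2) auto
    also have "\<dots> = indep_count ?q n n * (\<Sum>i=1..k. nilp_weight Q (k - i)) * R"
      by (simp add: sum_distrib_left sum_distrib_right mult.assoc)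
    also have "(\<Sum>i=1..k. nilp_weight Q (k - i)) = (\<Sum>j<k. nilp_weight Q j)"
      by (rule sum.reindex_bij_witness[of _ "\<lambda>j. k - j" "\<lambda>i. k - i"]) auto
    also have "\<dots> = (Q ^ k - 1) * nilp_weight Q k" by (rule sum_nilp_weight_less[OF Q1])
    also have "real (?q ^ (d * k)) = Q ^ k" by (simp add: Q_def power_mult)
    finally have "(Q ^ k - 1) * real (card (prim_class S g n (?q ^ (d * k)))) \<le> (Q ^ k - 1) * (indep_count ?q n n * (nilp_weight Q k * R))"
      by (simp add: mult_ac)
    moreover have "Q ^ k - 1 > 0" using Q1 False by simp
    ultimately have "real (card (prim_class S g n (?q ^ (d * k)))) \<le> indep_count ?q n n * (nilp_weight Q k * R)"
      using mult_le_cancel_left_pos by blast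
    then show ?thesis by (cases "d * k \<le> n") (simp_all add: R_def)
  qed
qed

lemma large_kernels_off_bound:
  fixes g :: "'a::{field,finite} poly"
  assumes g: "mirr g" "g \<notin> S" and d: "degree g = d"
  defines "Q \<equiv> real CARD('a) ^ d"
  shows "real (card (large_kernels_off S g n)) \<le>
    indep_count CARD('a) n n * (\<Sum>k\<le>n. if d * k \<le> n then nilp_weight Q k * dens S (n - d * k) else 0)"
proof -
  let ?q = "CARD('a)"
  have d0: "d > 0" using mirr_degree[OF g(1)] d by simp
  have "large_kernels_off S g n \<subseteq> (\<Union>k\<in>{..n}. prim_class S g n (?q ^ (d * k)))"
  proof
    fix X assume X: "X \<in> large_kernels_off S g n"
    define N where "N = prim_size n X g"
    have XD: "X \<in> prim_class S g n N" using X by (simp add: prim_class_def N_def)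
    then have "card (prim_class S g n N) \<noteq> 0" by (auto simp: card_eq_0_iff)
    then obtain k where k: "N = ?q ^ (d * k)" using prim_class_not_power[OF g(1), of N S n] d by auto
    have "N \<le> card (cspace n :: 'a poly set)" unfolding N_def prim_size_def
      by (rule card_mono) (auto simp: prim_def)
    then have "?q ^ (d * k) \<le> ?q ^ n" by (simp add: k card_cspace)
    then have "d * k \<le> n" using card_field_gt_1[where 'a='a] by simp
    moreover have "k \<le> d * k" using d0 by simp
    ultimately have "k \<le> n" by linarith
    then show "X \<in> (\<Union>k\<in>{..n}. prim_class S g n (?q ^ (d * k)))" using XD k by blast
  qed
  then have "card (large_kernels_off S g n) \<le> card (\<Union>k\<in>{..n}. prim_class S g n (?q ^ (d * k)))" by (intro card_mono) auto
  also have "\<dots> \<le> (\<Sum>k\<le>n. card (prim_class S g n (?q ^ (d * k))))" by (rule card_UN_le) simp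
  finally have "real (card (large_kernels_off S g n)) \<le> (\<Sum>k\<le>n. real (card (prim_class S g n (?q ^ (d * k)))))"
    by (simp only: of_nat_le_iff of_nat_sum[symmetric])
  also have "\<dots> \<le> (\<Sum>k\<le>n. indep_count ?q n n * (if d * k \<le> n then nilp_weight Q k * dens S (n - d * k) else 0))"
    unfolding Q_def by (intro sum_mono prim_class_power[OF g d])
  finally show ?thesis by (simp only: sum_distrib_left)
qed

text \<open>The factor \<open>q^n\<close> absorbs the power \<open>Q^k\<close> in the denominator of
  \<open>nilp_weight\<close>, so the weight of a new irreducible can be bounded independently of
  \<open>k\<close>.\<close>

definition scaled_dens :: "'a::{field,finite} poly set \<Rightarrow> nat \<Rightarrow> real" where
  "scaled_dens S n = real CARD('a) ^ n * dens S n"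

text \<open>The first two factors of the denominator count pairs spanning \<open>(F[t]/g)\<^sup>2\<close>; the third is
  Euler's lower bound for \<open>omega k Q\<close>.\<close>
definition prime_weight :: "real \<Rightarrow> real" where
  "prime_weight Q = Q\<^sup>2 / ((Q\<^sup>2 - 1) * (Q\<^sup>2 - Q) * (1 - 1 / Q - 1 / Q\<^sup>2))"

lemma scaled_dens_nonneg: "scaled_dens S n \<ge> 0"
  by (simp add: scaled_dens_def dens_nonneg)

lemma prime_weight_nonneg: "Q \<ge> 2 \<Longrightarrow> prime_weight Q \<ge> 0"
  unfolding prime_weight_def using omega_lower_pos[of Q]
  by (intro divide_nonneg_nonneg mult_nonneg_nonneg) (auto simp: power2_eq_square intro: order_trans[OF _ mult_mono[of 1 Q 1 Q]])

lemma large_kernels_insert: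
  fixes g :: "'a::{field,finite} poly"
  shows "large_kernels (insert g S) n \<subseteq> large_kernels S n \<union> {X \<in> large_kernels (insert g S) n. CARD('a) ^ (2 * degree g) \<le> ker_size n X g}"
  by (auto simp: large_kernels_def large_or_trivial_def)

text \<open>The additional matrices have a large kernel at \<open>g\<close>. Two chains remove
  \<open>2 d\<close> dimensions, and stripping the \<open>g\<close>-primary part of the quotient,
  \<open>d k\<close> dimensions more, leads back to \<open>S\<close>.\<close>

lemma dens_insert:
  fixes g :: "'a::{field,finite} poly"
  assumes g: "mirr g" "g \<notin> S" and d: "degree g = d"
  defines "Q \<equiv> real CARD('a) ^ d"
  shows "dens (insert g S) n \<le> dens S n + (if 2 * d \<le> n then
    (\<Sum>k\<le>n - 2 * d. if d * k \<le> n - 2 * d then nilp_weight Q k * dens S (n - 2 * d - d * k) else 0) / ((Q\<^sup>2 - 1) * (Q\<^sup>2 - Q)) else 0)"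
proof -
  let ?q = "CARD('a)"
  define A where "A = {X \<in> large_kernels (insert g S) n. CARD('a) ^ (2 * degree g) \<le> ker_size n X g}"
  define G where "G = indep_count ?q n n"
  define D where "D = (Q\<^sup>2 - 1) * (Q\<^sup>2 - Q)"
  define \<Sigma> where "\<Sigma> = (\<Sum>k\<le>n - 2 * d. if d * k \<le> n - 2 * d then nilp_weight Q k * dens S (n - 2 * d - d * k) else 0)"
  have d0: "d > 0" using mirr_degree[OF g(1)] d by simp
  have Q1: "Q > 1" unfolding Q_def using field_power_gt_1[OF d0, where 'a='a] by (metis of_nat_1 of_nat_less_iff of_nat_power)
  have "Q * 1 < Q * Q" using Q1 by (intro mult_strict_left_mono) auto
  then have "Q < Q\<^sup>2" by (simp add: power2_eq_square)
  then have Dpos: "D > 0" using Q1 by (simp add: D_def)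
  have Gpos: "G > 0" unfolding G_def by (rule indep_count_pos[OF card_field_gt_1])
  have "card (large_kernels (insert g S) n) \<le> card (large_kernels S n \<union> A)"
    unfolding A_def by (intro card_mono large_kernels_insert) auto
  also have "\<dots> \<le> card (large_kernels S n) + card A" by (rule card_Un_le)
  finally have le: "real (card (large_kernels (insert g S) n)) \<le> real (card (large_kernels S n)) + real (card A)" by linarith
  have A: "real (card A) * D \<le> indep_count ?q n (2 * d) * real ?q ^ (2 * d * (n - 2 * d)) * real (card (large_kernels_off S g (n - 2 * d)))"
    using count_krylov2[OF g(1) d, of S n] unfolding A_def D_def Q_def d .
  have "real (card A) / G \<le> (if 2 * d \<le> n then \<Sigma> / D else 0)"
  proof (cases "2 * d \<le> n")
    case True
    have "indep_count ?q n (2 * d) * real ?q ^ (2 * d * (n - 2 * d)) * indep_count ?q (n - 2 * d) (n - 2 * d) > 0"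
      using Gpos indep_count_split[OF True, of ?q] by (simp add: G_def)
    then have p: "indep_count ?q n (2 * d) * real ?q ^ (2 * d * (n - 2 * d)) \<ge> 0"
      using indep_count_pos[OF card_field_gt_1[where 'a='a], of "n - 2 * d"] by (metis less_eq_real_def zero_less_mult_pos2)
    have "real (card A) * D \<le> indep_count ?q n (2 * d) * real ?q ^ (2 * d * (n - 2 * d)) * (indep_count ?q (n - 2 * d) (n - 2 * d) * \<Sigma>)"
      using A large_kernels_off_bound[OF g d, of "n - 2 * d"] p unfolding \<Sigma>_def Q_def by (meson mult_left_mono order_trans)
    also have "\<dots> = G * \<Sigma>" using indep_count_split[OF True, of ?q] by (simp add: G_def)
    finally have "real (card A) / G \<le> \<Sigma> / D" using Gpos Dpos by (simp add: field_simps)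
    then show ?thesis using True by simp
  next
    case False
    then have "indep_count ?q n (2 * d) = 0" unfolding indep_count_def by (intro prod_zero) auto
    then have "real (card A) * D \<le> 0" using A by simp
    then have "card A = 0" using Dpos by (simp add: mult_le_0_iff)
    then show ?thesis using False by simp
  qed
  moreover have "dens (insert g S) n \<le> dens S n + real (card A) / G"
    using le Gpos by (simp add: dens_def G_def add_divide_distrib[symmetric] divide_right_mono)
  ultimately show ?thesis unfolding \<Sigma>_def D_def by linarith
qed

text \<open>Bounding \<open>omega k Q\<close> from below gives all \<open>k\<close> the same weight.
  The dimensions \<open>n - 2 d - d k\<close> are distinct and at most \<open>n - 2\<close>, and all
  terms are nonnegative, so the sum may run over all \<open>m \<le> n - 2\<close>; then
  \<open>g\<close> enters only through its weight.\<close>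

lemma scaled_dens_insert:
  fixes g :: "'a::{field,finite} poly"
  assumes g: "mirr g" "g \<notin> S"
  shows "scaled_dens (insert g S) n \<le> scaled_dens S n + (if n \<ge> 2 then
    prime_weight (real CARD('a) ^ degree g) * (\<Sum>m\<le>n-2. scaled_dens S m) else 0)"
proof -
  let ?q = "CARD('a)"
  define d where "d = degree g"
  define Q where "Q = real ?q ^ d"
  define D where "D = (Q\<^sup>2 - 1) * (Q\<^sup>2 - Q)"
  define t where "t = (1 - 1 / Q - 1 / Q\<^sup>2)"
  have d0: "d > 0" using mirr_degree[OF g(1)] d_def by simp
  have Qn: "?q ^ d \<ge> 2" using field_power_gt_1[OF d0, where 'a='a] by linarith
  have Q2: "Q \<ge> 2" using Qn unfolding Q_def by (metis of_nat_le_iff of_nat_numeral of_nat_power)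
  have t0: "t > 0" unfolding t_def by (rule omega_lower_pos[OF Q2])
  have "Q * 1 < Q * Q" using Q2 by (intro mult_strict_left_mono) auto
  then have "Q < Q\<^sup>2" by (simp add: power2_eq_square)
  then have Dpos: "D > 0" using Q2 by (simp add: D_def)
  have b: "prime_weight Q = Q\<^sup>2 / (D * t)" by (simp add: prime_weight_def D_def t_def)
  have b0: "prime_weight Q \<ge> 0" by (rule prime_weight_nonneg[OF Q2])
  show ?thesis
  proof (cases "2 * d \<le> n")
    case True
    let ?K = "{k. k \<le> n - 2 * d \<and> d * k \<le> n - 2 * d}"
    have finK: "finite ?K" by simp
    have "scaled_dens (insert g S) n \<le> scaled_dens S n + real ?q ^ n * ((\<Sum>k\<le>n - 2 * d. if d * k \<le> n - 2 * d then nilp_weight Q k * dens S (n - 2 * d - d * k) else 0) / D)"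
      using mult_left_mono[OF dens_insert[OF g d_def[symmetric], of n] zero_le_power[OF of_nat_0_le_iff[of ?q], of n]] True
      unfolding scaled_dens_def Q_def D_def by (simp only: distrib_left if_True)
    also have "(\<Sum>k\<le>n - 2 * d. if d * k \<le> n - 2 * d then nilp_weight Q k * dens S (n - 2 * d - d * k) else 0)
      = (\<Sum>k\<in>?K. nilp_weight Q k * dens S (n - 2 * d - d * k))"
      by (rule sum.mono_neutral_cong_right) auto
    also have "real ?q ^ n * ((\<Sum>k\<in>?K. nilp_weight Q k * dens S (n - 2 * d - d * k)) / D)
      = (\<Sum>k\<in>?K. real ?q ^ n * (nilp_weight Q k * dens S (n - 2 * d - d * k) / D))"
      by (simp add: sum_divide_distrib sum_distrib_left)
    also have "\<dots> \<le> (\<Sum>k\<in>?K. prime_weight Q * scaled_dens S (n - 2 * d - d * k))"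
    proof (rule sum_mono)
      fix k assume k: "k \<in> ?K"
      define m where "m = n - 2 * d - d * k"
      have nm: "n = d * (k + 2) + m" 
      proof -
        have e: "d * (k + 2) = d * k + 2 * d" by (simp add: algebra_simps)
        have "d * k \<le> n - 2 * d" using k by simp
        then show ?thesis unfolding e m_def using True by linarith
      qed
      have "real ?q ^ n = Q ^ k * Q\<^sup>2 * real ?q ^ m"
        unfolding nm Q_def by (simp only: power_add power_mult distrib_left mult.commute)
      moreover have "omega k Q > 0" using Q2 by (intro omega_pos) simp
      moreover have "Q ^ k > 0" using Q2 by simp
      ultimately have "real ?q ^ n * (nilp_weight Q k * dens S m / D) = (Q\<^sup>2 / (D * omega k Q)) * scaled_dens S m"
        using Dpos by (simp add: nilp_weight_def scaled_dens_def field_simps)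
      also have "\<dots> \<le> prime_weight Q * scaled_dens S m"
      proof (rule mult_right_mono[OF _ scaled_dens_nonneg])
        have "t \<le> omega k Q" unfolding t_def using Q2 by (intro omega_lower) simp
        then have "D * t \<le> D * omega k Q" using Dpos by simp
        then show "Q\<^sup>2 / (D * omega k Q) \<le> prime_weight Q" unfolding b
          using Dpos t0 by (intro divide_left_mono mult_pos_pos) (auto intro: omega_pos Q2 less_le_trans[OF t0])
      qed
      finally show "real ?q ^ n * (nilp_weight Q k * dens S (n - 2 * d - d * k) / D) \<le> prime_weight Q * scaled_dens S (n - 2 * d - d * k)"
        unfolding m_def .
    qed
    also have "\<dots> = prime_weight Q * (\<Sum>k\<in>?K. scaled_dens S (n - 2 * d - d * k))" by (simp add: sum_distrib_left)
    also have "(\<Sum>k\<in>?K. scaled_dens S (n - 2 * d - d * k)) = sum (scaled_dens S) ((\<lambda>k. n - 2 * d - d * k) ` ?K)"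
    proof -
      have "inj_on (\<lambda>k. n - 2 * d - d * k) ?K"
      proof (rule inj_onI)
        fix x y assume "x \<in> ?K" "y \<in> ?K" and eq: "n - 2 * d - d * x = n - 2 * d - d * y"
        then have "d * x \<le> n - 2 * d" "d * y \<le> n - 2 * d" by simp_all
        then have "d * x = d * y" using eq by linarith
        then show "x = y" using d0 by simp
      qed
      then show ?thesis by (simp add: sum.reindex)
    qed
    also have "prime_weight Q * sum (scaled_dens S) ((\<lambda>k. n - 2 * d - d * k) ` ?K) \<le> prime_weight Q * (\<Sum>m\<le>n-2. scaled_dens S m)"
      using d0 by (intro mult_left_mono[OF _ b0] sum_mono2) (auto simp: scaled_dens_nonneg)
    finally show ?thesis using True d0 by (simp add: Q_def d_def)
  next
    case False
    have "scaled_dens (insert g S) n \<le> scaled_dens S n"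
      using mult_left_mono[OF dens_insert[OF g d_def[symmetric], of n], of "real ?q ^ n"] False
      by (simp add: scaled_dens_def)
    moreover have "0 \<le> prime_weight Q * (\<Sum>m\<le>n-2. scaled_dens S m)" by (intro mult_nonneg_nonneg b0 sum_nonneg scaled_dens_nonneg)
    ultimately show ?thesis by (simp add: Q_def d_def)
  qed
qed

text \<open>The left side is what the recursion yields from total weight \<open>s\<close> after
  admitting weight \<open>b\<close>. With \<open>y = 1 + s/2\<close> and \<open>Y = y^N\<close> the
  induction step reduces to \<open>b ((y-1) (Y-1) + (b/2) (2Y-1)) \<ge> 0\<close>.\<close>

lemma growth_step:
  fixes s b :: real
  assumes "s \<ge> 0" "b \<ge> 0"
  shows "s * (1 + s / 2) ^ N + b * (2 * (1 + s / 2) ^ N - 1) \<le> (s + b) * (1 + (s + b) / 2) ^ N"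
proof (induction N)
  case (Suc N)
  define y where "y = 1 + s / 2"
  define Y where "Y = y ^ N"
  have y: "y \<ge> 1" and Y: "Y \<ge> 1" and s: "s = 2 * (y - 1)" using assms by (simp_all add: y_def Y_def)
  have yb: "1 + (s + b) / 2 = y + b / 2" by (simp add: y_def)
  have "s * (y * Y) + b * (2 * (y * Y) - 1) \<le> (y + b / 2) * (s * Y + b * (2 * Y - 1))"
  proof -
    have "(y + b / 2) * (s * Y + b * (2 * Y - 1)) - (s * (y * Y) + b * (2 * (y * Y) - 1))
      = b * ((y - 1) * (Y - 1) + (b / 2) * (2 * Y - 1))" unfolding s by (simp add: field_simps)
    also have "\<dots> \<ge> 0" using assms y Y by (intro mult_nonneg_nonneg add_nonneg_nonneg) auto
    finally show ?thesis by linarith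
  qed
  also have "\<dots> \<le> (y + b / 2) * ((s + b) * (y + b / 2) ^ N)"
    using Suc y assms unfolding yb y_def[symmetric] Y_def by (intro mult_left_mono) auto
  finally show ?case unfolding yb y_def[symmetric] by (simp add: Y_def mult_ac)
qed simp

lemma scaled_dens_bound:
  fixes S :: "'a::{field,finite} poly set"
  assumes "finite S" "\<forall>g\<in>S. mirr g"
  defines "s \<equiv> \<lambda>S. \<Sum>g\<in>S. prime_weight (real CARD('a) ^ degree g)"
  shows "scaled_dens S 0 \<le> 1 \<and> scaled_dens S 1 \<le> 0 \<and> (\<forall>n\<ge>2. scaled_dens S n \<le> s S * (1 + s S / 2) ^ (n - 2))"
  using assms(1,2)
proof (induction S rule: finite_induct)
  case empty
  have "large_kernels ({} :: 'a poly set) n = {}" if n: "n \<ge> 1" for n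
  proof -
    have False if X: "X \<in> large_kernels {} n" for X :: "nat \<Rightarrow> 'a poly"
    proof -
      have Xr: "X \<in> row_fams n n" using X by (simp add: large_kernels_def)
      interpret fmod "lcomb n X" "cspace n" by (rule fmod_rows[OF Xr])
      obtain g where "mirr g" "card (kern (lcomb n X) (cspace n) g) \<noteq> 1"
        using ex_prime[of 1] n by (auto simp: cspace_iff)
      then show False using X by (simp add: large_kernels_def large_or_trivial_def ker_size_def)
    qed
    then show ?thesis by blast
  qed
  then have "scaled_dens ({} :: 'a poly set) n = 0" if "n \<ge> 1" for n using that by (simp add: scaled_dens_def dens_def)
  moreover have "scaled_dens ({} :: 'a poly set) 0 \<le> 1"
  proof -
    have "row_fams 0 0 = {\<lambda>_. 0 :: 'a poly}" by (auto simp: row_fams_def)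
    then have "large_kernels {} 0 \<subseteq> {\<lambda>_. 0 :: 'a poly}" by (auto simp: large_kernels_def)
    then have "card (large_kernels ({} :: 'a poly set) 0) \<le> 1"
      using card_mono[of "{\<lambda>_. 0 :: 'a poly}" "large_kernels {} 0"] by simp
    then show ?thesis by (simp add: scaled_dens_def dens_def indep_count_def)
  qed
  ultimately show ?case by (simp add: s_def)
next
  case (insert g S)
  define b where "b = prime_weight (real CARD('a) ^ degree g)"
  have g: "mirr g" using insert.prems by simp
  have pw: "prime_weight (real CARD('a) ^ degree h) \<ge> 0" if "mirr h" for h :: "'a poly"
  proof (rule prime_weight_nonneg)
    have "CARD('a) ^ degree h \<ge> 2" using field_power_gt_1[OF mirr_degree[OF that], where 'a='a] by linarith
    then show "real CARD('a) ^ degree h \<ge> 2" by (metis of_nat_le_iff of_nat_numeral of_nat_power)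
  qed
  have b0: "b \<ge> 0" unfolding b_def by (rule pw[OF g])
  have s0: "s S \<ge> 0" unfolding s_def using insert.prems by (intro sum_nonneg pw) auto
  have ss: "s (insert g S) = s S + b" using insert.hyps by (simp add: s_def b_def)
  have IH: "scaled_dens S 0 \<le> 1" "scaled_dens S 1 \<le> 0" "\<And>n. n \<ge> 2 \<Longrightarrow> scaled_dens S n \<le> s S * (1 + s S / 2) ^ (n - 2)"
    using insert by auto
  define y where "y = 1 + s S / 2"
  have y1: "y \<ge> 1" using s0 by (simp add: y_def)
  \<comment> \<open>The bound reproduces itself: \<open>2 y^N - 1 + s y^N = 2 y^(N+1) - 1\<close>,
    because \<open>s = 2 (y - 1)\<close>.\<close>
  have sum: "(\<Sum>m\<le>N. scaled_dens S m) \<le> 2 * y ^ N - 1" for N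
  proof (induction N)
    case 0
    then show ?case using IH(1) by simp
  next
    case (Suc N)
    show ?case
    proof (cases N)
      case 0
      have "(\<Sum>m\<le>Suc N. scaled_dens S m) \<le> 1" using 0 IH(1,2) by simp
      then show ?thesis using y1 0 by simp
    next
      case (Suc M)
      have "scaled_dens S (Suc N) \<le> s S * y ^ M" using IH(3)[of "Suc N"] Suc by (simp add: y_def)
      also have "\<dots> \<le> s S * y ^ N" using y1 s0 Suc by (intro mult_left_mono power_increasing) auto
      finally have "(\<Sum>m\<le>Suc N. scaled_dens S m) \<le> 2 * y ^ N - 1 + s S * y ^ N" using Suc.IH by simp
      also have "\<dots> = 2 * y ^ Suc N - 1" by (simp add: y_def algebra_simps)
      finally show ?thesis .
    qed
  qed
  have "scaled_dens (insert g S) n \<le> s (insert g S) * (1 + s (insert g S) / 2) ^ (n - 2)" if n: "n \<ge> 2" for n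
  proof -
    have "scaled_dens (insert g S) n \<le> scaled_dens S n + b * (\<Sum>m\<le>n-2. scaled_dens S m)"
      using scaled_dens_insert[OF g insert.hyps(2), of n] n by (simp add: b_def)
    also have "\<dots> \<le> s S * y ^ (n - 2) + b * (2 * y ^ (n - 2) - 1)"
      using IH(3)[OF n] mult_left_mono[OF sum b0, of "n - 2"] unfolding y_def by linarith
    also have "\<dots> \<le> (s S + b) * (1 + (s S + b) / 2) ^ (n - 2)"
      unfolding y_def by (rule growth_step[OF s0 b0])
    finally show ?thesis by (simp only: ss)
  qed
  moreover have "scaled_dens (insert g S) 0 \<le> 1" "scaled_dens (insert g S) 1 \<le> 0"
    using scaled_dens_insert[OF g insert.hyps(2), of 0] scaled_dens_insert[OF g insert.hyps(2), of 1] IH by simp_all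
  ultimately show ?case by blast
qed

section \<open>Bounds for the constant\<close>

text \<open>Covers \<open>omega_inf\<close> with \<open>m = 1\<close> and \<open>c0_inf\<close> with
  \<open>m = 2\<close>; keeping \<open>m\<close> variable allows leading factors to be split off
  before the rest is estimated.\<close>

definition tail_prod :: "nat \<Rightarrow> real \<Rightarrow> real" where
  "tail_prod m Q = (\<Prod>i. 1 - inverse (Q ^ (i + m)))"

lemma tail_factor:
  assumes "Q > (1::real)" "m \<ge> 1"
  shows "0 < 1 - inverse (Q ^ (i + m))" "1 - inverse (Q ^ (i + m)) \<le> 1"
proof -
  have "Q ^ (i + m) > 1" using assms by (intro one_less_power) auto
  then show "0 < 1 - inverse (Q ^ (i + m))" "1 - inverse (Q ^ (i + m)) \<le> 1"
    by (simp_all add: inverse_less_1_iff)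
qed

lemma convergent_tail:
  assumes "Q > (1::real)" "m \<ge> 1"
  shows "convergent_prod (\<lambda>i. 1 - inverse (Q ^ (i + m)))"
proof -
  have "summable (\<lambda>i. inverse Q ^ m * inverse Q ^ i)"
    using assms by (intro summable_mult summable_geometric) (simp add: inverse_less_1_iff)
  then have "summable (\<lambda>i. \<bar>- inverse (Q ^ (i + m))\<bar>)"
    using assms by (simp add: power_add power_inverse mult.commute abs_mult)
  then have "convergent_prod (\<lambda>i. 1 + (- inverse (Q ^ (i + m))))"
  proof (rule summable_imp_convergent_prod_real)
    show "- inverse (Q ^ (i + m)) \<noteq> - 1" for i using tail_factor(1)[OF assms, of i] by linarith
  qed
  then show ?thesis by simp
qed

lemma tail_prod_split:
  assumes "Q > 1" "m \<ge> 1"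
  shows "tail_prod m Q = (1 - inverse (Q ^ m)) * tail_prod (Suc m) Q"
proof -
  have e: "1 - inverse (Q ^ (Suc i + m)) = 1 - inverse (Q ^ (i + Suc m))" for i by simp
  have nz: "1 - inverse (Q ^ (0 + m)) \<noteq> 0" using tail_factor(1)[OF assms, of 0] by linarith
  have "tail_prod (Suc m) Q = tail_prod m Q / (1 - inverse (Q ^ (0 + m)))"
    unfolding tail_prod_def e[symmetric] by (rule prodinf_split_head[OF convergent_tail[OF assms] nz])
  then show ?thesis using nz by simp
qed

text \<open>Weierstrass' product inequality; the bounds 0 and 1 are carried along because the step
  multiplies \<open>f n\<close> by the product so far.\<close>

lemma prod_ge_one_minus_sum:
  fixes f :: "nat \<Rightarrow> real"
  assumes "\<And>i. 0 \<le> f i" "\<And>i. f i \<le> 1"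
  shows "1 - (\<Sum>i<n. f i) \<le> (\<Prod>i<n. 1 - f i) \<and> (\<Prod>i<n. 1 - f i) \<le> 1 \<and> 0 \<le> (\<Prod>i<n. 1 - f i)"
proof (induction n)
  case (Suc n)
  define p where "p = (\<Prod>i<n. 1 - f i)"
  have p: "1 - (\<Sum>i<n. f i) \<le> p" "p \<le> 1" "0 \<le> p" using Suc by (simp_all add: p_def)
  have f: "0 \<le> f n" "f n \<le> 1" using assms by auto
  have "p * f n \<le> 1 * f n" using p f by (intro mult_right_mono) auto
  moreover have "p * (1 - f n) \<le> 1 * 1" using p f by (intro mult_mono) auto
  moreover have "0 \<le> p * (1 - f n)" using p f by simp
  ultimately show ?case using p by (simp add: p_def[symmetric] algebra_simps)
qed simp

text \<open>Weierstrass' inequality with the geometric series as the sum, passed to the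
  limit.\<close>

lemma tail_prod_ge:
  assumes "Q > 1" "m \<ge> 1"
  shows "1 - inverse (Q ^ m) / (1 - inverse Q) \<le> tail_prod m Q"
proof -
  let ?f = "\<lambda>i. inverse (Q ^ (i + m))"
  have z: "0 < inverse Q" "inverse Q < 1" using assms by (auto simp: inverse_less_1_iff)
  have "(\<lambda>n. \<Prod>i<n. 1 - ?f i) \<longlonglongrightarrow> tail_prod m Q"
    unfolding tail_prod_def
    by (rule has_prod_imp_tendsto') (rule convergent_prod_has_prod[OF convergent_tail[OF assms]])
  moreover have "1 - inverse (Q ^ m) / (1 - inverse Q) \<le> (\<Prod>i<n. 1 - ?f i)" for n
  proof -
    have "(\<Sum>i<n. ?f i) = inverse Q ^ m * (\<Sum>i<n. inverse Q ^ i)"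
      by (simp add: sum_distrib_left power_add power_inverse mult.commute)
    also have "(\<Sum>i<n. inverse Q ^ i) = (1 - inverse Q ^ n) / (1 - inverse Q)"
      using z by (subst sum_gp_strict) auto
    also have "inverse Q ^ m * ((1 - inverse Q ^ n) / (1 - inverse Q)) \<le> inverse Q ^ m * (1 / (1 - inverse Q))"
      using z by (intro mult_left_mono divide_right_mono) auto
    finally have "(\<Sum>i<n. ?f i) \<le> inverse (Q ^ m) / (1 - inverse Q)" by (simp add: power_inverse)
    moreover have "1 - (\<Sum>i<n. ?f i) \<le> (\<Prod>i<n. 1 - ?f i)"
      using tail_factor[OF assms] less_imp_le by (intro prod_ge_one_minus_sum[THEN conjunct1]) (auto intro: less_imp_le simp: algebra_simps)
    ultimately show ?thesis by linarith
  qed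
  ultimately show ?thesis by (intro LIMSEQ_le_const) auto
qed

lemma tail_prod_le_1:
  assumes "Q > 1" "m \<ge> 1"
  shows "tail_prod m Q \<le> 1"
proof -
  have "(\<lambda>n. \<Prod>i<n. 1 - inverse (Q ^ (i + m))) \<longlonglongrightarrow> tail_prod m Q"
    unfolding tail_prod_def
    by (rule has_prod_imp_tendsto') (rule convergent_prod_has_prod[OF convergent_tail[OF assms]])
  moreover have "(\<Prod>i<n. 1 - inverse (Q ^ (i + m))) \<le> 1" for n
    using tail_factor[OF assms] by (intro prod_le_1) (auto intro: less_imp_le)
  ultimately show ?thesis by (intro LIMSEQ_le_const2) auto
qed

lemma omega_inf_tail: "omega_inf Q = tail_prod 1 Q"
  by (simp add: omega_inf_def tail_prod_def)

lemma c0_tail: "c0_inf Q = Q\<^sup>2 * (1 - tail_prod 2 Q)"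
  by (simp add: c0_inf_def tail_prod_def)

text \<open>Taylor polynomial of order 3 with a geometric bound for the tail: the derivative of the
  difference is \<open>(1/(1-z) - 1/(1-t)) t^3\<close>, nonnegative for
  \<open>t \<le> z\<close>.\<close>

lemma ln_upper:
  fixes z :: real
  assumes "0 \<le> z" "z < 1"
  shows "- ln (1 - z) \<le> z + z\<^sup>2 / 2 + z ^ 3 / 3 + z ^ 4 / (4 * (1 - z))"
proof -
  define K where "K = 1 / (1 - z)"
  define f where "f t = t + t\<^sup>2 / 2 + t ^ 3 / 3 + K * t ^ 4 / 4 + ln (1 - t)" for t :: real
  have "f 0 \<le> f z"
  proof (rule DERIV_nonneg_imp_nondecreasing[OF assms(1)])
    fix t assume t: "0 \<le> t" "t \<le> z"
    then have t1: "1 - t > 0" using assms by simp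
    have "DERIV f t :> 1 + t + t\<^sup>2 + K * t ^ 3 - 1 / (1 - t)"
      unfolding f_def using t1 by (auto intro!: derivative_eq_intros simp: power2_eq_square)
    moreover have "1 + t + t\<^sup>2 + K * t ^ 3 - 1 / (1 - t) = (K - 1 / (1 - t)) * t ^ 3"
      using t1 by (simp add: field_simps power2_eq_square power3_eq_cube)
    moreover have "1 / (1 - t) \<le> K" unfolding K_def using t assms by (intro divide_left_mono) auto
    then have "(K - 1 / (1 - t)) * t ^ 3 \<ge> 0" using t by simp
    ultimately show "\<exists>y. DERIV f t :> y \<and> 0 \<le> y" by metis
  qed
  then show ?thesis using assms by (simp add: f_def K_def mult.commute)
qed

lemma ln_lower:
  fixes z :: real
  assumes "0 \<le> z" "z < 1"
  shows "z + z\<^sup>2 / 2 \<le> - ln (1 - z)"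
proof -
  define f where "f t = - ln (1 - t) - t - t\<^sup>2 / 2" for t :: real
  have "f 0 \<le> f z"
  proof (rule DERIV_nonneg_imp_nondecreasing[OF assms(1)])
    fix t assume t: "0 \<le> t" "t \<le> z"
    then have t1: "1 - t > 0" using assms by simp
    have "DERIV f t :> 1 / (1 - t) - 1 - t" unfolding f_def using t1
      by (auto intro!: derivative_eq_intros)
    moreover have "1 / (1 - t) - 1 - t = t\<^sup>2 / (1 - t)" using t1 by (simp add: field_simps power2_eq_square)
    moreover have "t\<^sup>2 / (1 - t) \<ge> 0" using t1 by simp
    ultimately show "\<exists>y. DERIV f t :> y \<and> 0 \<le> y" by metis
  qed
  then show ?thesis by (simp add: f_def)
qed

lemma cstar_bounds_aux:
  fixes q :: real
  assumes q: "q \<ge> 3"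
  defines "z \<equiv> 1 / q"
  shows "1 \<le> c0_inf q" "c0_inf q \<le> 1 / (1 - z)" "1 \<le> c0_inf (q\<^sup>2)" "c0_inf (q\<^sup>2) \<le> 1 / (1 - z\<^sup>2)"
    "1 - z\<^sup>2 - z ^ 4 \<le> omega_inf (q\<^sup>2)"
proof -
  \<comment> \<open>The lower bound keeps only the factor \<open>1 - Q^(-2)\<close> of the product;
    the upper bound is \<open>tail_prod_ge\<close>.\<close>
  have c0: "1 \<le> c0_inf Q \<and> c0_inf Q \<le> 1 / (1 - 1 / Q)" if Q: "Q > 1" for Q :: real
  proof -
    have t: "tail_prod 2 Q = (1 - inverse (Q\<^sup>2)) * tail_prod 3 Q"
      using tail_prod_split[of Q 2] Q by (simp add: numeral_3_eq_3)
    have "Q\<^sup>2 > 1" using Q by (intro one_less_power) auto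
    then have f: "0 < 1 - inverse (Q\<^sup>2)" by (simp add: inverse_less_1_iff)
    have "tail_prod 3 Q \<le> 1" using Q by (intro tail_prod_le_1) auto
    then have "tail_prod 2 Q \<le> (1 - inverse (Q\<^sup>2)) * 1" unfolding t using f by (intro mult_left_mono) auto
    then have "Q\<^sup>2 * inverse (Q\<^sup>2) \<le> Q\<^sup>2 * (1 - tail_prod 2 Q)" by (intro mult_left_mono) auto
    moreover have "Q\<^sup>2 * inverse (Q\<^sup>2) = 1" using Q by simp
    moreover have "1 - inverse (Q\<^sup>2) / (1 - inverse Q) \<le> tail_prod 2 Q" using Q by (intro tail_prod_ge) auto
    then have "Q\<^sup>2 * (1 - tail_prod 2 Q) \<le> Q\<^sup>2 * (inverse (Q\<^sup>2) / (1 - inverse Q))" by (intro mult_left_mono) auto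
    moreover have "Q\<^sup>2 * (inverse (Q\<^sup>2) / (1 - inverse Q)) = 1 / (1 - 1 / Q)" using Q by (simp add: inverse_eq_divide)
    ultimately show ?thesis unfolding c0_tail by linarith
  qed
  have q2: "q\<^sup>2 > 1" using q by (intro one_less_power) auto
  show "1 \<le> c0_inf q" "c0_inf q \<le> 1 / (1 - z)" using c0[of q] q by (simp_all add: z_def)
  show "1 \<le> c0_inf (q\<^sup>2)" "c0_inf (q\<^sup>2) \<le> 1 / (1 - z\<^sup>2)"
    using c0[OF q2] by (simp_all add: z_def power_divide)
  define y where "y = z\<^sup>2"
  have iq: "inverse (q\<^sup>2) = y" by (simp add: y_def z_def power_divide inverse_eq_divide)
  have "q\<^sup>2 \<ge> 3\<^sup>2" using q by (intro power_mono) auto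
  then have q9: "9 \<le> q\<^sup>2" by simp
  have y: "0 < y" "y \<le> 1 / 9" unfolding iq[symmetric] inverse_eq_divide
    using q q9 frac_le[of 1 1 9 "q\<^sup>2"] by simp_all
  have oy: "omega_inf (q\<^sup>2) = (1 - y) * tail_prod 2 (q\<^sup>2)"
    using tail_prod_split[OF q2, of 1] iq by (simp add: omega_inf_tail numeral_2_eq_2)
  have "1 - inverse ((q\<^sup>2)\<^sup>2) / (1 - inverse (q\<^sup>2)) \<le> tail_prod 2 (q\<^sup>2)" by (intro tail_prod_ge q2) auto
  moreover have "inverse ((q\<^sup>2)\<^sup>2) = y\<^sup>2" unfolding power_inverse[of "q\<^sup>2" 2, symmetric] iq ..
  ultimately have "1 - y\<^sup>2 / (1 - y) \<le> tail_prod 2 (q\<^sup>2)" unfolding iq by simp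
  then have "(1 - y) * (1 - y\<^sup>2 / (1 - y)) \<le> (1 - y) * tail_prod 2 (q\<^sup>2)" using y by (intro mult_left_mono) auto
  moreover have "(1 - y) * (1 - y\<^sup>2 / (1 - y)) = 1 - y - y\<^sup>2" using y by (simp add: field_simps)
  ultimately show "1 - z\<^sup>2 - z ^ 4 \<le> omega_inf (q\<^sup>2)"
    unfolding oy by (simp add: y_def power_mult[symmetric])
qed

text \<open>\<open>c0_inf q\<close> is at least 1, so the lower bound needs only that the
  logarithmic bracket \<open>L\<close> is positive. For the upper bound \<open>q = 3\<close> is
  numerically tight and gets finer estimates.\<close>

lemma cstar_bounds:
  fixes q :: real
  assumes q: "q = 3 \<or> q \<ge> 4"
  shows "1 < cstar q" "cstar q < 1.56"
proof -
  define z where "z = 1 / q"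
  define L where "L = q * ln (1 - inverse (q\<^sup>2)) - ln (1 - inverse q)"
  define W where "W = omega 4 q * c0_inf (q\<^sup>2) / omega_inf (q\<^sup>2)"
  have q3: "q \<ge> 3" using q by auto
  have z: "0 < z" "z \<le> 1 / 3" using q3 by (auto simp: z_def field_simps)
  have qz: "q = 1 / z" using q3 by (simp add: z_def)
  have iq: "inverse q = z" "inverse (q\<^sup>2) = z\<^sup>2" "inverse (q ^ k) = z ^ k" for k
    by (simp_all add: z_def power_divide inverse_eq_divide)
  note aux = cstar_bounds_aux[OF q3, folded z_def]
  have z2: "z\<^sup>2 \<le> 1 / 9" using power_mono[of z "1/3" 2] z by (simp add: power2_eq_square)
  have z4: "z ^ 4 \<le> 1 / 81" using power_mono[of z "1/3" 4] z by (simp add: power4_eq_xxxx)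
  have z2p: "0 < z\<^sup>2" "0 < z ^ 4" using z by simp_all
  have oi: "omega_inf (q\<^sup>2) > 0" using aux(5) z2 z4 by linarith
  have om: "omega 4 q = (1 - z) * (1 - z\<^sup>2) * (1 - z ^ 3) * (1 - z ^ 4)"
    unfolding omega_def iq by (simp add: numeral_eq_Suc prod.atLeastAtMost_shift_bounds)
  have p: "0 < 1 - z ^ k" "1 - z ^ k \<le> 1" if "k \<ge> 1" for k
  proof -
    have "z ^ k < 1 ^ k" using z that by (intro power_strict_mono) auto
    then show "0 < 1 - z ^ k" by simp
    show "1 - z ^ k \<le> 1" using z by simp
  qed
  have ompos: "omega 4 q > 0" unfolding om using z p[of 2] p[of 3] p[of 4] by simp
  have Wpos: "W > 0" unfolding W_def using ompos oi aux(3) by simp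
  have Lz: "L = - ln (1 - z) - (- ln (1 - z\<^sup>2)) / z" unfolding L_def iq using qz by simp
  have z21: "0 \<le> z\<^sup>2" "z\<^sup>2 < 1" using z2 by auto
  have l1: "z + z\<^sup>2 / 2 \<le> - ln (1 - z)" "- ln (1 - z) \<le> z + z\<^sup>2 / 2 + z ^ 3 / 3 + z ^ 4 / (4 * (1 - z))"
    using ln_lower[of z] ln_upper[of z] z by auto
  have l2: "z\<^sup>2 + z ^ 4 / 2 \<le> - ln (1 - z\<^sup>2)"
    "- ln (1 - z\<^sup>2) \<le> z\<^sup>2 + z ^ 4 / 2 + z ^ 6 / 3 + z ^ 8 / (4 * (1 - z\<^sup>2))"
    using ln_lower[OF z21] ln_upper[OF z21] by (simp_all add: power_mult[symmetric])
  \<comment> \<open>This gives \<open>L > 0\<close>. Both sides agree to first order in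
    \<open>z\<close>, and the term \<open>z^2 / 2\<close> leaves the room that suffices for
    \<open>z \<le> 1/3\<close>.\<close>
  have "- ln (1 - z\<^sup>2) / z < z + z\<^sup>2 / 2"
  proof -
    have "z ^ 8 / (4 * (1 - z\<^sup>2)) \<le> z ^ 8 / 1"
      using z2 z by (intro divide_left_mono) auto
    moreover have "z ^ 6 = z ^ 4 * z\<^sup>2" "z ^ 8 = z ^ 4 * z ^ 4" by (simp_all add: power_add[symmetric])
    moreover have "z ^ 4 * z\<^sup>2 \<le> z ^ 4 * (1 / 9)" "z ^ 4 * z ^ 4 \<le> z ^ 4 * (1 / 81)"
      by (rule mult_left_mono[OF z2], use z in simp, rule mult_left_mono[OF z4], use z in simp)
    ultimately have "- ln (1 - z\<^sup>2) \<le> z\<^sup>2 + (3 / 5) * z ^ 4" using l2(2) z2p by linarith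
    moreover have "z ^ 4 = z ^ 3 * z" by (simp add: power4_eq_xxxx power3_eq_cube)
    moreover have "z ^ 3 * z \<le> z ^ 3 * (1 / 3)" "z ^ 3 > 0" using z by (auto intro!: mult_left_mono)
    ultimately have "- ln (1 - z\<^sup>2) < z\<^sup>2 + z ^ 3 / 2" by linarith
    also have "z\<^sup>2 + z ^ 3 / 2 = (z + z\<^sup>2 / 2) * z" by (simp add: power2_eq_square power3_eq_cube algebra_simps)
    finally have "- ln (1 - z\<^sup>2) < (z + z\<^sup>2 / 2) * z" .
    then show ?thesis using pos_divide_less_eq[OF z(1)] by blast
  qed
  then have Lpos: "L > 0" using l1(1) unfolding Lz by linarith
  have cs: "cstar q = c0_inf q + q * W * L" by (simp add: cstar_def W_def L_def)
  have "q * W * L > 0" using q3 Wpos Lpos by simp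
  then show "1 < cstar q" using aux(1) cs by linarith
  have "(z\<^sup>2 + z ^ 4 / 2) / z \<le> - ln (1 - z\<^sup>2) / z" using l2(1) z by (intro divide_right_mono) auto
  moreover have "(z\<^sup>2 + z ^ 4 / 2) / z = z + z ^ 3 / 2"
    using z by (simp add: field_simps power2_eq_square power3_eq_cube power4_eq_xxxx)
  ultimately have Lup: "L \<le> z\<^sup>2 / 2 - z ^ 3 / 6 + z ^ 4 / (4 * (1 - z))" using l1(2) unfolding Lz by linarith
  have Wup: "W \<le> omega 4 q * (1 / (1 - z\<^sup>2)) / (1 - z\<^sup>2 - z ^ 4)"
    unfolding W_def using ompos aux(3-5) z2 z4 oi
    by (intro frac_le mult_nonneg_nonneg mult_left_mono) auto
  show "cstar q < 1.56"
  proof (cases "q \<ge> 4")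
    \<comment> \<open>Here \<open>W \<le> 1\<close> and \<open>L \<le> z^2 / 2\<close>, so the total
      is at most 4/3 + 1/8, below 1.56.\<close>
    case True
    then have z': "z \<le> 1 / 4" by (simp add: z_def field_simps)
    have "z ^ 4 / (4 * (1 - z)) \<le> z ^ 4 / 3" using z z' by (intro divide_left_mono) auto
    moreover have "z ^ 4 = z ^ 3 * z" by (simp add: power4_eq_xxxx power3_eq_cube)
    moreover have "z ^ 3 * z \<le> z ^ 3 * (1 / 4)" "z ^ 3 > 0" using z z' by (auto intro!: mult_left_mono)
    ultimately have L2: "L \<le> z\<^sup>2 / 2" using Lup by linarith
    have "omega 4 q \<le> (1 - z) * (1 - z\<^sup>2)"
    proof -
      have "(1 - z ^ 3) * (1 - z ^ 4) \<le> 1" using p[of 3] p[of 4] by (intro mult_le_one) auto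
      then have "(1 - z) * (1 - z\<^sup>2) * ((1 - z ^ 3) * (1 - z ^ 4)) \<le> (1 - z) * (1 - z\<^sup>2) * 1"
        using z z2 by (intro mult_left_mono mult_nonneg_nonneg) auto
      then show ?thesis unfolding om by (simp add: mult.assoc)
    qed
    then have "omega 4 q * (1 / (1 - z\<^sup>2)) \<le> 1 - z" using z2 by (simp add: field_simps)
    moreover have "z\<^sup>2 + z ^ 4 \<le> z"
    proof -
      have "z * z \<le> z * (1 / 4)" using z z' by (intro mult_left_mono) auto
      moreover have "z ^ 4 \<le> z\<^sup>2" using z by (intro power_decreasing) auto
      ultimately show ?thesis using z unfolding power2_eq_square by linarith
    qed
    ultimately have "omega 4 q * (1 / (1 - z\<^sup>2)) / (1 - z\<^sup>2 - z ^ 4) \<le> 1"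
      using z2 z4 by (subst divide_le_eq_1_pos) auto
    then have "W \<le> 1" using Wup by linarith
    then have "W * L \<le> 1 * (z\<^sup>2 / 2)" using L2 Lpos Wpos by (intro mult_mono) auto
    then have "q * (W * L) \<le> q * (z\<^sup>2 / 2)" using q3 by (intro mult_left_mono) auto
    moreover have "q * (z\<^sup>2 / 2) = z / 2" unfolding qz using z by (simp add: power2_eq_square)
    moreover have "1 / (1 - z) \<le> 4 / 3" using z' by (simp add: field_simps)
    ultimately show ?thesis using cs aux(2) z' by (simp add: mult.assoc)
  next
    \<comment> \<open>The geometric estimate \<open>c0_inf 3 \<le> 3/2\<close> would give only about
      1.617; three factors of the product are therefore kept exactly.\<close>
    case False
    then have q: "q = 3" and z: "z = 1 / 3" using q by (auto simp: z_def)
    have "L \<le> 0.05402" using Lup unfolding z by (simp add: power_divide)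
    moreover have "W \<le> 0.7234" using Wup unfolding om z by (simp add: power_divide)
    ultimately have "W * L \<le> 0.7234 * 0.05402" using Lpos Wpos by (intro mult_mono) auto
    moreover have "c0_inf q \<le> 1.4384"
    proof -
      have "tail_prod 2 q = (8 / 9) * ((26 / 27) * ((80 / 81) * tail_prod 5 q))"
        using tail_prod_split[of q 2] tail_prod_split[of q 3] tail_prod_split[of q 4] q by (simp add: numeral_eq_Suc)
      moreover have "1 - inverse (q ^ 5) / (1 - inverse q) \<le> tail_prod 5 q" using q by (intro tail_prod_ge) auto
      then have "161 / 162 \<le> tail_prod 5 q" unfolding q by simp
      ultimately show ?thesis unfolding c0_tail q by simp
    qed
    ultimately show ?thesis using cs q by simp
  qed
qed

section \<open>From uncyclic matrices to large kernels\<close>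

definition vpoly :: "'a::comm_ring_1 vec \<Rightarrow> 'a poly" where
  "vpoly v = (\<Sum>j<dim_vec v. monom (v $ j) j)"

definition mrows :: "'a::comm_ring_1 mat \<Rightarrow> nat \<Rightarrow> 'a poly" where
  "mrows X = (\<lambda>i. if i < dim_row X then \<Sum>j<dim_col X. monom (X $$ (i, j)) j else 0)"

lemma coeff_vpoly: "coeff (vpoly v) j = (if j < dim_vec v then v $ j else 0)"
  unfolding vpoly_def by (rule coeff_sum_monom)

lemma coeff_mrows:
  assumes "X \<in> carrier_mat n n"
  shows "coeff (mrows X i) j = (if i < n \<and> j < n then X $$ (i, j) else 0)"
  using assms coeff_sum_monom[of "\<lambda>j. X $$ (i, j)" n j] by (simp add: mrows_def carrier_matD)

lemma mrows_rows: "X \<in> carrier_mat n n \<Longrightarrow> mrows X \<in> row_fams n n"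
  unfolding row_fams_def cspace_def by (simp add: coeff_mrows) (simp add: mrows_def carrier_matD)

lemma vpoly_cspace: "v \<in> carrier_vec n \<Longrightarrow> vpoly v \<in> cspace n"
  unfolding cspace_def by (simp add: coeff_vpoly carrier_vecD)

lemma vpoly_inj:
  assumes "v \<in> carrier_vec n" "w \<in> carrier_vec n" "vpoly v = vpoly w"
  shows "v = w"
proof (rule eq_vecI)
  show "dim_vec v = dim_vec w" using assms by (simp add: carrier_vecD)
  fix i assume "i < dim_vec w"
  then show "v $ i = w $ i" using assms coeff_vpoly[of v i] coeff_vpoly[of w i] by (simp add: carrier_vecD)
qed

lemma vpoly_surj:
  assumes "x \<in> cspace n"
  obtains v where "v \<in> carrier_vec n" "vpoly v = x"
proof (rule that[of "vec n (coeff x)"])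
  show "vpoly (vec n (coeff x)) = x"
    using assms unfolding cspace_def by (intro poly_eqI) (simp add: coeff_vpoly)
qed simp

lemma vpoly_0: "vpoly (0\<^sub>v n) = 0"
  by (rule poly_eqI) (simp add: coeff_vpoly)

lemma mrows_inj: "inj_on mrows (carrier_mat n n)"
proof (rule inj_onI)
  fix X Y assume X: "X \<in> carrier_mat n n" and Y: "Y \<in> carrier_mat n n" and eq: "mrows X = mrows Y"
  show "X = Y"
  proof (rule eq_matI)
    fix i j assume "i < dim_row Y" "j < dim_col Y"
    then have ij: "i < n" "j < n" using Y by auto
    have "coeff (mrows X i) j = coeff (mrows Y i) j" using eq by simp
    then show "X $$ (i, j) = Y $$ (i, j)" unfolding coeff_mrows[OF X] coeff_mrows[OF Y] using ij by simp
  qed (use X Y in auto)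
qed

lemma coeff_lcomb: "coeff (lcomb l E c) j = (\<Sum>i<l. coeff c i * coeff (E i) j)"
  by (simp add: lcomb_def coeff_sum)

text \<open>Iterating the row map is right multiplication by a power of the matrix; this links
  \<open>pact\<close> with \<open>mat_poly_eval\<close>.\<close>

lemma coeff_funpow_mrows:
  assumes X: "X \<in> carrier_mat n n" and v: "v \<in> carrier_vec n" and j: "j < n"
  shows "coeff ((lcomb n (mrows X) ^^ k) (vpoly v)) j = (\<Sum>i<n. v $ i * (X ^\<^sub>m k) $$ (i, j))"
  using j
proof (induction k arbitrary: j)
  case 0
  have "(\<Sum>i<n. v $ i * (1\<^sub>m n) $$ (i, j)) = (\<Sum>i<n. if i = j then v $ i else 0)"
    using 0 by (intro sum.cong) auto
  also have "\<dots> = v $ j" using 0 by simp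
  finally show ?case using 0 X v by (simp add: coeff_vpoly carrier_vecD carrier_matD)
next
  case (Suc k)
  have Xk: "X ^\<^sub>m k \<in> carrier_mat n n" using X by (rule pow_carrier_mat)
  have mult: "(X ^\<^sub>m Suc k) $$ (l, j) = (\<Sum>i<n. (X ^\<^sub>m k) $$ (l, i) * X $$ (i, j))" if "l < n" for l
    using that Suc.prems X Xk by (simp add: scalar_prod_def lessThan_atLeast0 carrier_matD)
  have "coeff ((lcomb n (mrows X) ^^ Suc k) (vpoly v)) j =
      (\<Sum>i<n. coeff ((lcomb n (mrows X) ^^ k) (vpoly v)) i * coeff (mrows X i) j)"
    by (simp add: coeff_lcomb)
  also have "\<dots> = (\<Sum>i<n. (\<Sum>l<n. v $ l * (X ^\<^sub>m k) $$ (l, i)) * X $$ (i, j))"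
    using Suc.prems by (intro sum.cong refl) (simp add: Suc.IH coeff_mrows[OF X])
  also have "\<dots> = (\<Sum>i<n. \<Sum>l<n. v $ l * ((X ^\<^sub>m k) $$ (l, i) * X $$ (i, j)))"
    by (simp add: sum_distrib_right mult.assoc)
  also have "\<dots> = (\<Sum>l<n. \<Sum>i<n. v $ l * ((X ^\<^sub>m k) $$ (l, i) * X $$ (i, j)))" by (rule sum.swap)
  also have "\<dots> = (\<Sum>l<n. v $ l * (X ^\<^sub>m Suc k) $$ (l, j))"
    by (intro sum.cong refl) (simp only: mult sum_distrib_left lessThan_iff)
  finally show ?case .
qed

lemma row_mult_carrier: "X \<in> carrier_mat n n \<Longrightarrow> row_mult v (mat_poly_eval X p) \<in> carrier_vec n"
  by (rule carrier_vecI) (auto simp: row_mult_def mat_poly_eval_def)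

lemma vpoly_row_mult:
  assumes X: "X \<in> carrier_mat n n" and v: "v \<in> carrier_vec n"
  shows "vpoly (row_mult v (mat_poly_eval X p)) = pact (lcomb n (mrows X)) p (vpoly v)"
proof (rule poly_eqI)
  fix j
  have rc: "row_mult v (mat_poly_eval X p) \<in> carrier_vec n" by (rule row_mult_carrier[OF X])
  show "coeff (vpoly (row_mult v (mat_poly_eval X p))) j = coeff (pact (lcomb n (mrows X)) p (vpoly v)) j"
  proof (cases "j < n")
    case True
    have "coeff (pact (lcomb n (mrows X)) p (vpoly v)) j
      = (\<Sum>k\<le>degree p. coeff p k * (\<Sum>i<n. v $ i * (X ^\<^sub>m k) $$ (i, j)))"
      using coeff_funpow_mrows[OF X v True] by (simp add: pact_def coeff_sum)
    also have "\<dots> = (\<Sum>k\<le>degree p. \<Sum>i<n. v $ i * (coeff p k * (X ^\<^sub>m k) $$ (i, j)))"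
      by (simp add: sum_distrib_left mult_ac)
    also have "\<dots> = (\<Sum>i<n. \<Sum>k\<le>degree p. v $ i * (coeff p k * (X ^\<^sub>m k) $$ (i, j)))" by (rule sum.swap)
    also have "\<dots> = (\<Sum>i<n. v $ i * (\<Sum>k\<le>degree p. coeff p k * (X ^\<^sub>m k) $$ (i, j)))"
      by (simp add: sum_distrib_left)
    also have "\<dots> = row_mult v (mat_poly_eval X p) $ j"
      using X v True by (simp add: row_mult_def mat_poly_eval_def carrier_matD carrier_vecD)
    finally show ?thesis using True carrier_vecD[OF rc] by (simp add: coeff_vpoly)
  next
    case False
    have "pact (lcomb n (mrows X)) p (vpoly v) \<in> cspace n"
      by (rule pact_closed[OF subsp_cspace _ vpoly_cspace[OF v]]) (auto intro: lcomb_rows mrows_rows[OF X])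
    then show ?thesis using False carrier_vecD[OF rc] by (simp add: coeff_vpoly cspace_def)
  qed
qed

text \<open>Cayley--Hamilton: the rows of \<open>t I - X\<close> annihilate the vector of unit vectors; multiply by the
  adjugate.\<close>
lemma pact_char_poly:
  fixes X :: "'a::field mat"
  assumes X: "X \<in> carrier_mat n n" and u: "u \<in> cspace n"
  shows "pact (lcomb n (mrows X)) (char_poly X) u = 0"
proof -
  define T where "T = lcomb n (mrows X)"
  define M where "M = char_poly_matrix X"
  define A where "A = adj_mat M"
  have T: "lin T" unfolding T_def by (rule lin_lcomb)
  have M: "M \<in> carrier_mat n n" unfolding M_def using X by simp
  have A: "A \<in> carrier_mat n n" "A * M = det M \<cdot>\<^sub>m 1\<^sub>m n" unfolding A_def using adj_mat[OF M] by auto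
  have Mij: "M $$ (k, j) = (if k = j then [:0, 1:] else 0) + [:- (X $$ (k, j)):]" if "k < n" "j < n" for k j
    using that X unfolding M_def char_poly_matrix_def by (auto simp: carrier_matD)
  have row: "(\<Sum>j<n. pact T (M $$ (k, j)) (monom 1 j)) = 0" if k: "k < n" for k
  proof -
    have "(\<Sum>j<n. pact T (M $$ (k, j)) (monom 1 j))
      = (\<Sum>j<n. (if k = j then T (monom 1 j) else 0) - monom (X $$ (k, j)) j)"
    proof (intro sum.cong refl)
      fix j assume "j \<in> {..<n}"
      then have j: "j < n" by simp
      have "pact T [:- (X $$ (k, j)):] (monom 1 j) = - monom (X $$ (k, j)) j"
        by (simp add: pact_pCons[OF T] lin_0[OF T] smult_monom minus_monom)
      moreover have "pact T (if k = j then [:0, 1:] else 0) (monom 1 j) = (if k = j then T (monom 1 j) else 0)"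
        by (simp add: pact_pCons[OF T] lin_0[OF T])
      ultimately show "pact T (M $$ (k, j)) (monom 1 j) = (if k = j then T (monom 1 j) else 0) - monom (X $$ (k, j)) j"
        unfolding Mij[OF k j] pact_add by simp
    qed
    also have "\<dots> = T (monom 1 k) - mrows X k"
      using k X by (simp add: sum_subtractf mrows_def carrier_matD)
    also have "T (monom 1 k) = mrows X k" unfolding T_def by (rule lcomb_monom[OF k])
    finally show ?thesis by simp
  qed
  have unit: "pact T (char_poly X) (monom 1 i) = 0" if i: "i < n" for i
  proof -
    have AM: "(\<Sum>k<n. A $$ (i, k) * M $$ (k, j)) = (if i = j then char_poly X else 0)" if j: "j < n" for j
    proof -
      have "(A * M) $$ (i, j) = (\<Sum>k<n. A $$ (i, k) * M $$ (k, j))"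
        using A(1) M i j by (simp add: scalar_prod_def lessThan_atLeast0 carrier_matD)
      then show ?thesis unfolding A(2) char_poly_def M_def[symmetric]
        using i j by (cases "i = j") simp_all
    qed
    have "pact T (char_poly X) (monom 1 i) = (\<Sum>j<n. if i = j then pact T (char_poly X) (monom 1 j) else 0)"
      using i by simp
    also have "\<dots> = (\<Sum>j<n. pact T (\<Sum>k<n. A $$ (i, k) * M $$ (k, j)) (monom 1 j))"
      by (intro sum.cong refl) (simp add: AM)
    also have "\<dots> = (\<Sum>j<n. \<Sum>k<n. pact T (A $$ (i, k)) (pact T (M $$ (k, j)) (monom 1 j)))"
    proof (intro sum.cong refl)
      fix j
      have "pact T (sum f B) w = (\<Sum>k\<in>B. pact T (f k) w)" for f :: "nat \<Rightarrow> 'a poly" and B w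
        by (induction B rule: infinite_finite_induct) (simp_all add: pact_add)
      then show "pact T (\<Sum>k<n. A $$ (i, k) * M $$ (k, j)) (monom 1 j)
        = (\<Sum>k<n. pact T (A $$ (i, k)) (pact T (M $$ (k, j)) (monom 1 j)))"
        by (simp only: pact_mult[OF T])
    qed
    also have "\<dots> = (\<Sum>k<n. \<Sum>j<n. pact T (A $$ (i, k)) (pact T (M $$ (k, j)) (monom 1 j)))" by (rule sum.swap)
    also have "\<dots> = (\<Sum>k<n. pact T (A $$ (i, k)) (\<Sum>j<n. pact T (M $$ (k, j)) (monom 1 j)))"
      by (simp only: lin_sum[OF lin_pact[OF T]])
    also have "\<dots> = 0" by (rule sum.neutral) (simp add: row lin_0[OF lin_pact[OF T]])
    finally show ?thesis .
  qed
  have "u = lcomb n (\<lambda>j. monom 1 j) u" by (rule lcomb_unit[OF u, symmetric]) simp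
  then have "pact T (char_poly X) u = pact T (char_poly X) (lcomb n (\<lambda>j. monom 1 j) u)" by simp
  also have "\<dots> = lcomb n (pact T (char_poly X) \<circ> (\<lambda>j. monom 1 j)) u"
    by (rule lin_lcomb_commute[OF lin_pact[OF T]])
  also have "\<dots> = 0" unfolding lcomb_def by (rule sum.neutral) (simp add: unit)
  finally show ?thesis unfolding T_def .
qed

text \<open>A finite set, as the induction over irreducibles requires; it contains every irreducible
  with a large kernel in dimension \<open>n\<close>, since that forces
  \<open>2 deg g \<le> n\<close>.\<close>

definition mirrs :: "nat \<Rightarrow> 'a::field poly set" where
  "mirrs n = {g. mirr g \<and> degree g \<le> n}"

text \<open>By Cayley-Hamilton and coprimality, a nontrivial kernel of \<open>g\<close> forces
  \<open>g\<close> to divide the characteristic polynomial, so uncyclicity applies to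
  \<open>g\<close>; a nontrivial kernel that is not large would make \<open>V(g)\<close> cyclic by
  \<open>prim_cyclic\<close>.\<close>

lemma uncyclic_large_kernels:
  fixes X :: "'a::{field,finite} mat"
  assumes X: "X \<in> carrier_mat n n" and u: "uncyclic X"
  shows "mrows X \<in> large_kernels (mirrs n) n"
proof -
  let ?T = "lcomb n (mrows X)"
  have Xr: "mrows X \<in> row_fams n n" by (rule mrows_rows[OF X])
  interpret fmod ?T "cspace n" by (rule fmod_rows[OF Xr])
  have dim: "dim_row X = n" using X by simp
  have "large_or_trivial (mirrs n) n (mrows X) g" if g: "mirr g" for g
  proof (cases "ker_size n (mrows X) g = 1")
    case True
    then show ?thesis by (simp add: large_or_trivial_def)
  next
    case ne: False
    have dvd: "g dvd char_poly X"
    proof (rule ccontr)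
      assume nd: "\<not> g dvd char_poly X"
      have "kern ?T (cspace n) g \<subseteq> {0}"
      proof
        fix v assume v: "v \<in> kern ?T (cspace n) g"
        have "pact ?T (g ^ 1) v = 0" using v by (simp add: kern_def)
        moreover have "pact ?T (char_poly X) v = 0" using v by (intro pact_char_poly[OF X]) (simp add: kern_def)
        ultimately show "v \<in> {0}" using coprime_kern[OF g nd] by blast
      qed
      then have "kern ?T (cspace n) g = {0}" using prim_0(2)[OF Xr, of g] by blast
      then show False using ne by (simp add: ker_size_def)
    qed
    have nc: "\<not> cyclic_submodule X (gen_eigenspace X g)"
      using u g dvd unfolding uncyclic_def mirr_def by blast
    have big: "CARD('a) ^ (2 * degree g) \<le> ker_size n (mrows X) g"
    proof (rule ccontr)
      assume "\<not> ?thesis"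
      then have "card (kern ?T (cspace n) g) < CARD('a) ^ (2 * degree g)" by (simp add: ker_size_def)
      then obtain x where x: "x \<in> prim ?T (cspace n) g" "prim ?T (cspace n) g \<subseteq> cyclic_span ?T x"
        using prim_cyclic[OF g ne[unfolded ker_size_def]] by blast
      have xV: "x \<in> cspace n" using x(1) by (simp add: prim_def)
      obtain v where v: "v \<in> carrier_vec n" "vpoly v = x" by (rule vpoly_surj[OF xV])
      obtain i where i: "annp ?T x = g ^ i" using annp_prim(1)[OF g x(1)] by blast
      have deg: "degree (annp ?T x) = i * degree g"
        unfolding i using g by (simp add: degree_power_eq mirr_neq_0)
      \<comment> \<open>This matches the free exponent of \<open>prim\<close> with the exponent
        \<open>n\<close> of \<open>gen_eigenspace\<close>: the annihilator \<open>g^i\<close> has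
        degree at most \<open>n\<close>, hence \<open>i \<le> n\<close>.\<close>
      have "CARD('a) ^ (i * degree g) \<le> CARD('a) ^ n"
        using krylov_props(3)[OF xV deg] card_mono[OF finite_cspace cyclic_span_sub[OF xV]] by (simp add: card_cspace)
      then have "i * degree g \<le> n" using card_field_gt_1[where 'a='a] by simp
      moreover have "i \<le> i * degree g" using mirr_degree[OF g] by simp
      ultimately have "i \<le> n" by linarith
      then have "annp ?T x dvd g ^ n" unfolding i by (rule le_imp_power_dvd)
      then have xn: "pact ?T (g ^ n) x = 0" using annp_dvd[OF xV] by blast
      have gen: "w \<in> gen_eigenspace X g \<longleftrightarrow> w \<in> carrier_vec n \<and> pact ?T (g ^ n) (vpoly w) = 0" for w
      proof (cases "w \<in> carrier_vec n")
        case True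
        have "row_mult w (mat_poly_eval X (g ^ n)) = 0\<^sub>v n \<longleftrightarrow> vpoly (row_mult w (mat_poly_eval X (g ^ n))) = 0"
          using vpoly_inj[OF row_mult_carrier[OF X] zero_carrier_vec] vpoly_0[of n] by metis
        then show ?thesis using True by (simp add: gen_eigenspace_def dim vpoly_row_mult[OF X True])
      next
        case False
        then show ?thesis by (simp add: gen_eigenspace_def dim)
      qed
      have "cyclic_submodule X (gen_eigenspace X g)" unfolding cyclic_submodule_def
      proof (intro bexI[of _ v] ballI)
        show "v \<in> gen_eigenspace X g" using gen v xn by simp
        fix w assume w: "w \<in> gen_eigenspace X g"
        then have wc: "w \<in> carrier_vec n" and "pact ?T (g ^ n) (vpoly w) = 0" using gen by auto
        then have "vpoly w \<in> prim ?T (cspace n) g" using vpoly_cspace[OF wc] unfolding prim_def by blast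
        then obtain p where "vpoly w = pact ?T p x" using x(2) unfolding cyclic_span_def by blast
        then have "vpoly w = vpoly (row_mult v (mat_poly_eval X p))" using vpoly_row_mult[OF X v(1)] v(2) by simp
        then have "w = row_mult v (mat_poly_eval X p)" by (rule vpoly_inj[OF wc row_mult_carrier[OF X]])
        then show "\<exists>p. w = row_mult v (mat_poly_eval X p)" by blast
      qed
      then show False using nc by blast
    qed
    have "ker_size n (mrows X) g \<le> card (cspace n :: 'a poly set)"
      unfolding ker_size_def by (rule card_mono) (auto simp: kern_def)
    then have "CARD('a) ^ (2 * degree g) \<le> CARD('a) ^ n" using big by (simp add: card_cspace)
    then have "2 * degree g \<le> n" using card_field_gt_1[where 'a='a] by simp
    then show ?thesis using big g by (simp add: large_or_trivial_def mirrs_def)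
  qed
  then show ?thesis using Xr by (simp add: large_kernels_def)
qed

lemma unc_le: "unc n (F :: 'a::{field,finite} itself) \<le> card (large_kernels (mirrs n :: 'a poly set) n)"
  unfolding unc_def
proof (rule card_inj_on_le)
  show "inj_on mrows {X :: 'a mat. X \<in> carrier_mat n n \<and> uncyclic X}"
    by (rule inj_on_subset[OF mrows_inj[of n]]) auto
qed (auto intro: uncyclic_large_kernels)

section \<open>Counting irreducible polynomials and the final estimate\<close>

lemma finite_mirrs: "finite (mirrs n :: 'a::{field,finite} poly set)"
  by (rule finite_subset[of _ "cspace (Suc n)"]) (auto simp: mirrs_def cspace_iff)

lemma monic_cutoff_inj:
  fixes g h :: "'a::field poly"
  assumes "monic g" "degree g = d" "monic h" "degree h = d" "\<And>i. i < d \<Longrightarrow> coeff g i = coeff h i"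
  shows "g = h"
proof (rule poly_eqI)
  fix i
  consider "i < d" | "i = d" | "i > d" by linarith
  then show "coeff g i = coeff h i"
  proof cases
    case 2
    then show ?thesis using assms by simp
  qed (use assms in \<open>simp_all add: coeff_eq_0\<close>)
qed

lemma card_mirr_1: "card {g :: 'a::{field,finite} poly. mirr g \<and> degree g = 1} \<le> CARD('a)"
proof (rule card_inj_on_le[of "\<lambda>g. coeff g 0"])
  show "inj_on (\<lambda>g. coeff g 0) {g :: 'a poly. mirr g \<and> degree g = 1}"
  proof (rule inj_onI)
    fix g h :: "'a poly"
    assume g: "g \<in> {g. mirr g \<and> degree g = 1}" and h: "h \<in> {g. mirr g \<and> degree g = 1}"
      and eq: "coeff g 0 = coeff h 0"
    have m: "monic g" "degree g = 1" "monic h" "degree h = 1" using g h unfolding mirr_def by blast+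
    show "g = h" by (rule monic_cutoff_inj[OF m]) (use eq in simp)
  qed
qed simp_all

lemma mirr_coeff_0:
  fixes g :: "'a::field poly"
  assumes "mirr g" "degree g \<ge> 2"
  shows "coeff g 0 \<noteq> 0"
proof
  assume 0: "coeff g 0 = 0"
  obtain a h where g: "g = pCons a h" by (rule pCons_cases)
  then have gh: "g = [:0, 1:] * h" using 0 by simp
  have "irreducible g" using assms(1) by (simp add: mirr_def)
  then have "\<forall>a b. g = a * b \<longrightarrow> a dvd 1 \<or> b dvd 1" unfolding irreducible_def by blast
  from this[rule_format, OF gh] have "[:0, 1 :: 'a:] dvd 1 \<or> h dvd 1" .
  moreover have "\<not> [:0, 1 :: 'a:] dvd 1" by (subst is_unit_iff_degree) simp_all
  ultimately have "degree h = 0" using is_unit_iff_degree[of h] by (cases "h = 0") auto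
  then have "degree g \<le> 1" unfolding g using degree_pCons_le[of a h] by simp
  then show False using assms(2) by simp
qed

text \<open>For degree at least 2 the constant coefficient is nonzero. The factor
  \<open>1 - 1/q\<close> saved in this way cancels the denominator of the geometric series over
  \<open>d\<close> in \<open>sum_prime_weight_le\<close>.\<close>

lemma card_mirr:
  assumes "d \<ge> 2"
  shows "card {g :: 'a::{field,finite} poly. mirr g \<and> degree g = d} \<le> (CARD('a) - 1) * CARD('a) ^ (d - 1)"
proof -
  let ?M = "{g :: 'a poly. mirr g \<and> degree g = d}"
  let ?f = "\<lambda>g :: 'a poly. (coeff g 0, poly_cutoff (d - 1) (poly_shift 1 g))"
  have "card ?M \<le> card ((UNIV - {0 :: 'a}) \<times> (cspace (d - 1) :: 'a poly set))"
  proof (rule card_inj_on_le[of ?f])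
    show "inj_on ?f ?M"
    proof (rule inj_onI)
      fix g h assume g: "g \<in> ?M" and h: "h \<in> ?M" and eq: "?f g = ?f h"
      have e0: "coeff g 0 = coeff h 0" using eq by simp
      have e1: "poly_cutoff (d - 1) (poly_shift 1 g) = poly_cutoff (d - 1) (poly_shift 1 h)" using eq by simp
      have m: "monic g" "degree g = d" "monic h" "degree h = d" using g h unfolding mirr_def by blast+
      show "g = h"
      proof (rule monic_cutoff_inj[OF m])
        fix i assume i: "i < d"
        show "coeff g i = coeff h i"
        proof (cases i)
          case 0
          then show ?thesis using e0 by simp
        next
          case (Suc j)
          then have "coeff (poly_cutoff (d - 1) (poly_shift 1 g)) j = coeff g i"
            "coeff (poly_cutoff (d - 1) (poly_shift 1 h)) j = coeff h i"
            using i by (simp_all add: coeff_poly_cutoff coeff_poly_shift)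
          then show ?thesis using e1 by simp
        qed
      qed
    qed
    show "?f ` ?M \<subseteq> (UNIV - {0}) \<times> cspace (d - 1)"
    proof (rule image_subsetI)
      fix g assume "g \<in> ?M"
      then have "coeff g 0 \<noteq> 0" using mirr_coeff_0[of g] assms by simp
      then show "?f g \<in> (UNIV - {0}) \<times> cspace (d - 1)" using poly_cutoff_cspace by simp
    qed
  qed simp
  also have "\<dots> = (CARD('a) - 1) * CARD('a) ^ (d - 1)"
    by (simp add: card_cartesian_product card_cspace card_Diff_singleton)
  finally show ?thesis .
qed

lemma prime_weight_inverse:
  assumes "Q \<ge> 2" "z = 1 / Q"
  shows "prime_weight Q = z\<^sup>2 / ((1 - z\<^sup>2) * (1 - z) * (1 - z - z\<^sup>2))"
proof -
  have Q: "Q = 1 / z" and z: "z > 0" unfolding assms(2) using assms(1) by simp_all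
  have a: "(Q\<^sup>2 - 1) * (Q\<^sup>2 - Q) = (1 - z\<^sup>2) * (1 - z) / z ^ 4"
    unfolding Q using z by (simp add: field_simps power2_eq_square power4_eq_xxxx)
  have b: "1 - 1 / Q - 1 / Q\<^sup>2 = 1 - z - z\<^sup>2" unfolding Q using z by (simp add: power_divide)
  have c: "Q\<^sup>2 = z\<^sup>2 / z ^ 4" unfolding Q using z by (simp add: field_simps power2_eq_square power4_eq_xxxx)
  have prime_weight: "prime_weight Q = (z\<^sup>2 / z ^ 4) / ((1 - z\<^sup>2) * (1 - z) / z ^ 4 * (1 - z - z\<^sup>2))"
    unfolding prime_weight_def unfolding a unfolding b unfolding c ..
  have "(u / w) / (N / w * t) = u / (N * t)" if "w \<noteq> 0" for u w N t :: real using that by simp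
  note cancel = this
  show ?thesis unfolding prime_weight by (rule cancel) (use z in simp)
qed

text \<open>For \<open>y = 1/Q \<le> z^2\<close> each factor of the denominator is smallest at
  \<open>y = z^2\<close>. With \<open>z = 1/q\<close> one constant thus serves all degrees from 2
  on.\<close>

lemma prime_weight_le:
  fixes Q z :: real
  assumes z: "0 < z" "z \<le> 1 / 3" and Q: "1 / Q \<le> z\<^sup>2" "Q \<ge> 2"
  shows "prime_weight Q \<le> (1 / ((1 - z ^ 4) * (1 - z\<^sup>2) * (1 - z\<^sup>2 - z ^ 4))) * (1 / Q)\<^sup>2"
proof -
  define y where "y = 1 / Q"
  have y: "0 < y" "y \<le> z\<^sup>2" using Q by (simp_all add: y_def)
  have z2: "z\<^sup>2 \<le> 1 / 9" using power_mono[of z "1/3" 2] z by (simp add: power2_eq_square)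
  have z4: "z ^ 4 \<le> 1 / 81" using power_mono[of z "1/3" 4] z by (simp add: power4_eq_xxxx)
  have y2: "y\<^sup>2 \<le> z ^ 4" using power_mono[OF y(2), of 2] y by (simp add: power_mult[symmetric])
  have "(1 - z ^ 4) * (1 - z\<^sup>2) * (1 - z\<^sup>2 - z ^ 4) \<le> (1 - y\<^sup>2) * (1 - y) * (1 - y - y\<^sup>2)"
    using y y2 z2 z4 by (intro mult_mono mult_nonneg_nonneg) auto
  moreover have "0 < (1 - z ^ 4) * (1 - z\<^sup>2) * (1 - z\<^sup>2 - z ^ 4)"
    using z2 z4 by (intro mult_pos_pos) auto
  ultimately have "y\<^sup>2 / ((1 - y\<^sup>2) * (1 - y) * (1 - y - y\<^sup>2)) \<le> y\<^sup>2 / ((1 - z ^ 4) * (1 - z\<^sup>2) * (1 - z\<^sup>2 - z ^ 4))"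
    by (intro divide_left_mono) auto
  then show ?thesis using prime_weight_inverse[OF Q(2) y_def] by (simp add: y_def)
qed

text \<open>With \<open>z = 1/q\<close> the first summand is the weight of \<open>q\<close> linear
  polynomials, and the second bounds all higher degrees together. The expansion begins with z + 3
  z^2.\<close>

definition weight_bound :: "real \<Rightarrow> real" where
  "weight_bound z = z / ((1 - z) * (1 - z\<^sup>2) * (1 - z - z\<^sup>2)) + z\<^sup>2 / ((1 - z\<^sup>2) * (1 - z ^ 4) * (1 - z\<^sup>2 - z ^ 4))"

lemma sum_power_le:
  fixes z :: real
  assumes "0 < z" "z < 1"
  shows "(\<Sum>d=2..n. z ^ d) * (1 - z) \<le> z\<^sup>2"
proof -
  have "(\<Sum>d=2..n. z ^ d) * (1 - z) \<le> z\<^sup>2 - z ^ Suc n" if "n \<ge> 1" for n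
    using that
  proof (induction n rule: dec_induct)
    case base
    then show ?case by (simp add: power2_eq_square)
  next
    case (step n)
    then have "(\<Sum>d=2..Suc n. z ^ d) = (\<Sum>d=2..n. z ^ d) + z ^ Suc n" by (intro sum.cl_ivl_Suc[THEN trans]) simp
    then show ?case using step.IH by (simp add: algebra_simps)
  qed
  note * = this
  show ?thesis
  proof (cases "n \<ge> 1")
    case True
    then show ?thesis using *[OF True] zero_less_power[OF assms(1), of "Suc n"] by linarith
  qed simp
qed

lemma sum_prime_weight_le:
  defines "z \<equiv> 1 / real CARD('a::{field,finite})"
  assumes q: "CARD('a) \<ge> 3"
  shows "(\<Sum>g\<in>(mirrs n :: 'a poly set). prime_weight (real CARD('a) ^ degree g)) \<le> weight_bound z"
proof -
  let ?q = "real CARD('a)"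
  let ?M = "\<lambda>d. {g :: 'a poly. mirr g \<and> degree g = d}"
  define \<kappa> where "\<kappa> = 1 / ((1 - z ^ 4) * (1 - z\<^sup>2) * (1 - z\<^sup>2 - z ^ 4))"
  have q3: "?q \<ge> 3" using q by simp
  have z: "0 < z" "z \<le> 1 / 3" using q3 by (auto simp: z_def field_simps)
  have z2: "z\<^sup>2 \<le> 1 / 9" using power_mono[of z "1/3" 2] z by (simp add: power2_eq_square)
  have z4: "z ^ 4 \<le> 1 / 81" using power_mono[of z "1/3" 4] z by (simp add: power4_eq_xxxx)
  have \<kappa>: "\<kappa> > 0" unfolding \<kappa>_def using z2 z4 by (intro divide_pos_pos mult_pos_pos) auto
  have Q2: "?q ^ d \<ge> 2" if "d \<ge> 1" for d
  proof -
    have "?q ^ 1 \<le> ?q ^ d" using that q3 by (intro power_increasing) auto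
    then show ?thesis using q3 unfolding power_one_right by linarith
  qed
  have img: "degree ` (mirrs n :: 'a poly set) \<subseteq> {1..n}"
  proof (rule image_subsetI)
    fix g :: "'a poly" assume "g \<in> mirrs n"
    then show "degree g \<in> {1..n}" using mirr_degree[of g] by (simp add: mirrs_def)
  qed
  have "(\<Sum>g\<in>(mirrs n :: 'a poly set). prime_weight (?q ^ degree g))
    = (\<Sum>d=1..n. \<Sum>g\<in>{g \<in> (mirrs n :: 'a poly set). degree g = d}. prime_weight (?q ^ degree g))"
    by (rule sum.group[OF finite_mirrs _ img, symmetric]) simp
  also have "\<dots> = (\<Sum>d=1..n. real (card (?M d)) * prime_weight (?q ^ d))"
  proof (rule sum.cong[OF refl])
    fix d assume "d \<in> {1..n}"
    then have "{g \<in> (mirrs n :: 'a poly set). degree g = d} = ?M d" by (auto simp: mirrs_def)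
    then show "(\<Sum>g\<in>{g \<in> (mirrs n :: 'a poly set). degree g = d}. prime_weight (?q ^ degree g)) = real (card (?M d)) * prime_weight (?q ^ d)"
      by simp
  qed
  also have "\<dots> \<le> (\<Sum>d=1..n. if d = 1 then ?q * prime_weight ?q else \<kappa> * (1 - z) * z ^ d)"
  proof (rule sum_mono)
    fix d assume d: "d \<in> {1..n}"
    have b0: "prime_weight (?q ^ d) \<ge> 0" using Q2 d by (intro prime_weight_nonneg) simp
    show "real (card (?M d)) * prime_weight (?q ^ d) \<le> (if d = 1 then ?q * prime_weight ?q else \<kappa> * (1 - z) * z ^ d)"
    proof (cases "d = 1")
      case True
      have "real (card (?M 1)) \<le> ?q" using card_mirr_1[where 'a='a] by simp
      then have "real (card (?M 1)) * prime_weight (?q ^ 1) \<le> ?q * prime_weight (?q ^ 1)"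
        using b0 True by (intro mult_right_mono) auto
      then show ?thesis using True by simp
    next
      case False
      then have d2: "d \<ge> 2" using d by simp
      have iq: "1 / ?q ^ d = z ^ d" by (simp add: z_def power_divide)
      have "real (card (?M d)) \<le> real ((CARD('a) - 1) * CARD('a) ^ (d - 1))"
        using card_mirr[OF d2, where 'a='a] by (simp only: of_nat_le_iff)
      also have "\<dots> = (?q - 1) * ?q ^ (d - 1)" using q by (simp add: of_nat_diff)
      also have "\<dots> = (1 - z) * ?q ^ d"
      proof -
        have "?q ^ d = ?q * ?q ^ (d - 1)" using d2 by (simp add: power_eq_if)
        moreover have "(1 - z) * ?q = ?q - 1" using q3 by (simp add: z_def field_simps)
        ultimately show ?thesis by (simp add: mult.assoc[symmetric])
      qed
      finally have c: "real (card (?M d)) \<le> (1 - z) * ?q ^ d" .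
      have "z ^ d \<le> z\<^sup>2" using z d2 by (intro power_decreasing) auto
      then have "prime_weight (?q ^ d) \<le> \<kappa> * (1 / ?q ^ d)\<^sup>2"
        unfolding \<kappa>_def using d2 z Q2 iq by (intro prime_weight_le) auto
      then have "prime_weight (?q ^ d) \<le> \<kappa> * (z ^ d)\<^sup>2" by (simp only: iq)
      then have "real (card (?M d)) * prime_weight (?q ^ d) \<le> ((1 - z) * ?q ^ d) * (\<kappa> * (z ^ d)\<^sup>2)"
        using c b0 z by (intro mult_mono) auto
      also have "\<dots> = \<kappa> * (1 - z) * z ^ d * (?q ^ d * z ^ d)" by (simp add: power2_eq_square)
      also have "?q ^ d * z ^ d = 1" using q3 by (simp add: z_def power_divide)
      finally show ?thesis using False by simp
    qed
  qed
  also have "\<dots> \<le> ?q * prime_weight ?q + (\<Sum>d=2..n. \<kappa> * (1 - z) * z ^ d)"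
  proof (cases "n = 0")
    case True
    then show ?thesis using prime_weight_nonneg[of ?q] q3 by simp
  next
    case False
    then have e: "{1..n} = insert 1 {2..n}" by auto
    have "(\<Sum>d=2..n. if d = 1 then ?q * prime_weight ?q else \<kappa> * (1 - z) * z ^ d) = (\<Sum>d=2..n. \<kappa> * (1 - z) * z ^ d)"
      by (rule sum.cong) auto
    then show ?thesis unfolding e by (subst sum.insert) simp_all
  qed
  also have "(\<Sum>d=2..n. \<kappa> * (1 - z) * z ^ d) = \<kappa> * ((\<Sum>d=2..n. z ^ d) * (1 - z))"
    by (simp add: sum_distrib_left sum_distrib_right mult_ac)
  also have "\<dots> \<le> \<kappa> * z\<^sup>2" using sum_power_le[of z n] z \<kappa> by (intro mult_left_mono) auto
  also have "?q * prime_weight ?q = z / ((1 - z) * (1 - z\<^sup>2) * (1 - z - z\<^sup>2))"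
  proof -
    have "?q * z\<^sup>2 = z" using q3 by (simp add: z_def power2_eq_square)
    then show ?thesis using prime_weight_inverse[of ?q z] q3 by (simp add: z_def[symmetric] mult_ac)
  qed
  finally show ?thesis by (simp add: weight_bound_def \<kappa>_def mult_ac)
qed

text \<open>Of the factors \<open>1 - q^(-i)\<close> in |GL(n,q)| / q^(n^2) only those with
  \<open>i = 1\<close> and \<open>i = 2\<close> are kept; they come from the last two factors of
  \<open>indep_count\<close>.\<close>

lemma indep_count_le:
  assumes "q > 1" "n \<ge> 2"
  shows "indep_count q n n \<le> real q ^ (n * n) * ((1 - 1 / q) * (1 - 1 / (real q)\<^sup>2))"
proof -
  obtain m where n: "n = Suc (Suc m)" using assms(2) by (metis add_2_eq_Suc le_Suc_ex)
  have q: "real q > 1" using assms(1) by simp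
  have "indep_count q n n = (\<Prod>i<m. real q ^ n - real q ^ i) * ((real q ^ n - real q ^ m) * (real q ^ n - real q ^ Suc m))"
    unfolding indep_count_def n by (simp add: mult.assoc)
  also have "\<dots> \<le> (\<Prod>i<m. real q ^ n) * ((real q ^ n - real q ^ m) * (real q ^ n - real q ^ Suc m))"
  proof (rule mult_right_mono[OF prod_mono])
    have pw: "real q ^ i \<le> real q ^ n" if "i \<le> n" for i using q that by (intro power_increasing) auto
    show "0 \<le> real q ^ n - real q ^ i \<and> real q ^ n - real q ^ i \<le> real q ^ n" if "i \<in> {..<m}" for i
      using pw[of i] that q n by simp
    show "0 \<le> (real q ^ n - real q ^ m) * (real q ^ n - real q ^ Suc m)"
      using pw[of m] pw[of "Suc m"] n by (intro mult_nonneg_nonneg) auto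
  qed
  also have "\<dots> = real q ^ (n * m) * ((real q ^ n - real q ^ m) * (real q ^ n - real q ^ Suc m))"
    by (simp add: power_mult)
  also have "(real q ^ n - real q ^ m) * (real q ^ n - real q ^ Suc m)
      = real q ^ (2 * n) * ((1 - 1 / q) * (1 - 1 / (real q)\<^sup>2))"
  proof -
    define Y where "Y = real q ^ m"
    have e: "real q ^ n = Y * (real q)\<^sup>2" "real q ^ Suc m = Y * real q"
      unfolding Y_def n by (simp_all add: power2_eq_square)
    have e2: "real q ^ (2 * n) = (real q ^ n)\<^sup>2" by (simp only: power_mult mult.commute[of 2])
    show ?thesis unfolding e2 e Y_def[symmetric] using q by (simp add: field_simps power2_eq_square)
  qed
  also have "real q ^ (n * m) * (real q ^ (2 * n) * ((1 - 1 / q) * (1 - 1 / (real q)\<^sup>2)))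
    = real q ^ (n * m + 2 * n) * ((1 - 1 / q) * (1 - 1 / (real q)\<^sup>2))" by (simp add: power_add)
  also have "n * m + 2 * n = n * n" by (simp add: n)
  finally show ?thesis .
qed

text \<open>The growth bound has exponent \<open>n - 2\<close>; completing it to \<open>r^n\<close>
  puts \<open>r^2\<close> on the right of the second condition on \<open>c\<close> and
  \<open>r\<close>, and \<open>q^(n^2) = q^n q^(n^2-n-1) q\<close> puts the factor \<open>q\<close>
  on its left. The third condition makes \<open>r\<close> dominate \<open>1 + s/2\<close>.\<close>

lemma unc_bound:
  fixes F :: "'a::{field,finite} itself"
  defines "q \<equiv> real CARD('a)"
  assumes q: "CARD('a) \<ge> 3" and n: "n \<ge> 1"
    and c: "0 < c" "(1 - 1 / q) * (1 - 1 / q\<^sup>2) * (q * weight_bound (1 / q)) < c * r\<^sup>2" "1 + weight_bound (1 / q) / 2 \<le> r"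
  shows "real (unc n F) < c * q powr (real n ^ 2 - real n - 1) * r ^ n"
proof -
  define s where "s = (\<Sum>g\<in>(mirrs n :: 'a poly set). prime_weight (real CARD('a) ^ degree g))"
  define G where "G = indep_count CARD('a) n n"
  define P where "P = q powr (real n ^ 2 - real n - 1)"
  have q3: "q \<ge> 3" using q by (simp add: q_def)
  have Gpos: "G > 0" unfolding G_def by (rule indep_count_pos[OF card_field_gt_1])
  have ppos: "P > 0" using q3 by (simp add: P_def)
  have s0: "s \<ge> 0" unfolding s_def
  proof (rule sum_nonneg)
    fix g :: "'a poly" assume "g \<in> mirrs n"
    then have "CARD('a) ^ degree g \<ge> 2"
      using field_power_gt_1[OF mirr_degree, of g, where 'a='a] by (simp add: mirrs_def) 
    then have "real CARD('a) ^ degree g \<ge> 2" by (metis of_nat_le_iff of_nat_numeral of_nat_power)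
    then show "prime_weight (real CARD('a) ^ degree g) \<ge> 0" by (rule prime_weight_nonneg)
  qed
  have ss: "s \<le> weight_bound (1 / q)" unfolding s_def q_def by (rule sum_prime_weight_le[OF q])
  have r1: "r \<ge> 1" using c(3) s0 ss by linarith
  have wb: "scaled_dens (mirrs n :: 'a poly set) 1 \<le> 0" "\<And>k. k \<ge> 2 \<Longrightarrow> scaled_dens (mirrs n :: 'a poly set) k \<le> s * (1 + s / 2) ^ (k - 2)"
    using scaled_dens_bound[OF finite_mirrs, of n, where 'a='a] unfolding s_def by (auto simp: mirrs_def)
  have u: "real (unc n F) * q ^ n \<le> G * scaled_dens (mirrs n :: 'a poly set) n"
  proof -
    have "real (unc n F) \<le> real (card (large_kernels (mirrs n :: 'a poly set) n))" using unc_le[of n F] by simp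
    then have "real (unc n F) * q ^ n \<le> real (card (large_kernels (mirrs n :: 'a poly set) n)) * q ^ n"
      using q3 by (intro mult_right_mono) auto
    also have "\<dots> = G * scaled_dens (mirrs n :: 'a poly set) n" using Gpos by (simp add: scaled_dens_def dens_def G_def q_def)
    finally show ?thesis .
  qed
  show ?thesis
  proof (cases "n = 1")
    case True
    then have "G * scaled_dens (mirrs n :: 'a poly set) n \<le> 0" using wb(1) Gpos by (simp add: mult_le_0_iff)
    then have "real (unc n F) * q ^ n \<le> 0" using u by linarith
    moreover have "q ^ n > 0" using q3 by simp
    ultimately have "real (unc n F) \<le> 0" by (auto simp: mult_le_0_iff)
    moreover have "0 < c * P * r ^ n" using c(1) ppos r1 by simp
    ultimately show ?thesis unfolding P_def by linarith
  next
    case False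
    then have n2: "n \<ge> 2" using n by simp
    define K where "K = (1 - 1 / q) * (1 - 1 / q\<^sup>2)"
    have K0: "K \<ge> 0" unfolding K_def using q3 by (intro mult_nonneg_nonneg) (auto simp: field_simps power2_eq_square intro: order_trans[OF _ mult_mono[of 1 q 1 q]])
    have w: "scaled_dens (mirrs n :: 'a poly set) n \<le> weight_bound (1 / q) * r ^ (n - 2)"
    proof -
      have "s * (1 + s / 2) ^ (n - 2) \<le> weight_bound (1 / q) * r ^ (n - 2)"
        using s0 ss c(3) by (intro mult_mono power_mono) auto
      then show ?thesis using wb(2)[OF n2] by linarith
    qed
    have "real (unc n F) * q ^ n \<le> (q ^ (n * n) * K) * (weight_bound (1 / q) * r ^ (n - 2))"
    proof -
      have "G \<le> q ^ (n * n) * K" unfolding G_def q_def K_def by (rule indep_count_le[OF card_field_gt_1 n2])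
      then have "G * scaled_dens (mirrs n :: 'a poly set) n \<le> (q ^ (n * n) * K) * (weight_bound (1 / q) * r ^ (n - 2))"
        using w q3 K0 Gpos by (intro mult_mono scaled_dens_nonneg) auto
      then show ?thesis using u by linarith
    qed
    also have "q ^ (n * n) = q ^ n * P * q"
    proof -
      have "q ^ (n * n) = q powr (real n ^ 2)" using q3 by (simp add: powr_realpow[symmetric] power2_eq_square)
      also have "real n ^ 2 = real n + (real n ^ 2 - real n - 1) + 1" by simp
      also have "q powr (real n + (real n ^ 2 - real n - 1) + 1) = q ^ n * P * q"
        unfolding P_def powr_add using q3 by (simp add: powr_realpow)
      finally show ?thesis .
    qed
    finally have "q ^ n * real (unc n F) \<le> q ^ n * (P * (K * (q * weight_bound (1 / q))) * r ^ (n - 2))" by (simp add: mult_ac)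
    then have "real (unc n F) \<le> P * (K * (q * weight_bound (1 / q))) * r ^ (n - 2)"
      using q3 by simp
    also have "\<dots> < P * (c * r\<^sup>2) * r ^ (n - 2)"
      using c(2) ppos r1 unfolding K_def by (intro mult_strict_right_mono mult_strict_left_mono) auto
    also have "\<dots> = c * P * (r\<^sup>2 * r ^ (n - 2))" by simp
    also have "r\<^sup>2 * r ^ (n - 2) = r ^ (2 + (n - 2))" by (rule power_add[symmetric])
    also have "2 + (n - 2) = n" using n2 by simp
    finally show ?thesis unfolding P_def .
  qed
qed

text \<open>The factor \<open>(1-z) (1-z^2)\<close> reduces the first summand to
  \<open>1 / (1-z-z^2)\<close>, whose series is 1 + z + 2 z^2 + 3 z^3 + ...; raising the cubic
  coefficient to 6 covers the tail for \<open>z \<le> 1/4\<close>. The second summand is at most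
  \<open>z\<close>.\<close>

lemma weight_bound_scaled:
  fixes z :: real
  assumes z: "0 < z" "z \<le> 1 / 4"
  shows "(1 - z) * (1 - z\<^sup>2) * (weight_bound z / z) \<le> 1 + 2 * z + 2 * z\<^sup>2 + 6 * z ^ 3"
proof -
  have z2: "z\<^sup>2 \<le> 1 / 4 * z" "z ^ 3 \<le> 1 / 16 * z" "z ^ 4 \<le> 1 / 64 * z"
  proof -
    have "z * z \<le> (1 / 4) * z" "z\<^sup>2 * z \<le> (1 / 4)\<^sup>2 * z" "z ^ 3 * z \<le> (1 / 4) ^ 3 * z"
      using z by (auto intro!: mult_right_mono power_mono)
    then show "z\<^sup>2 \<le> 1 / 4 * z" "z ^ 3 \<le> 1 / 16 * z" "z ^ 4 \<le> 1 / 64 * z"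
      by (simp_all add: power2_eq_square power3_eq_cube power4_eq_xxxx)
  qed
  have p: "1 - z > 0" "1 - z\<^sup>2 > 0" "1 - z - z\<^sup>2 > 0" "1 - z ^ 4 > 0" "1 - z\<^sup>2 - z ^ 4 > 0"
    using z z2 by linarith+
  have "(1 - z) * (1 - z\<^sup>2) * (weight_bound z / z) = 1 / (1 - z - z\<^sup>2) + z * (1 - z) / ((1 - z ^ 4) * (1 - z\<^sup>2 - z ^ 4))"
    unfolding weight_bound_def using p z by (simp add: add_divide_distrib distrib_left power2_eq_square)
  also have "1 / (1 - z - z\<^sup>2) \<le> 1 + z + 2 * z\<^sup>2 + 6 * z ^ 3"
  proof -
    have "(1 + z + 2 * z\<^sup>2 + 6 * z ^ 3) * (1 - z - z\<^sup>2) - 1 = z\<^sup>2 * (3 * z - 8 * z\<^sup>2 - 6 * z ^ 3)"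
      by (simp add: algebra_simps power2_eq_square power3_eq_cube)
    also have "\<dots> \<ge> 0" using z z2 by (intro mult_nonneg_nonneg) auto
    finally show ?thesis using p(3) by (simp add: divide_le_eq)
  qed
  also have "z * (1 - z) / ((1 - z ^ 4) * (1 - z\<^sup>2 - z ^ 4)) \<le> z"
  proof -
    have "z ^ 4 * (z\<^sup>2 + z ^ 4) \<ge> 0" by simp
    then have "(1 - z ^ 4) * (1 - z\<^sup>2 - z ^ 4) \<ge> 1 - z\<^sup>2 - 2 * z ^ 4" by (simp add: algebra_simps)
    then have "1 - z \<le> (1 - z ^ 4) * (1 - z\<^sup>2 - z ^ 4)" using z z2 by linarith
    then have "z * (1 - z) \<le> z * ((1 - z ^ 4) * (1 - z\<^sup>2 - z ^ 4))" using z by (intro mult_left_mono) auto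
    then show ?thesis using p by (simp add: divide_le_eq)
  qed
  finally show ?thesis by simp
qed

text \<open>The square of \<open>r\<close> begins with 1 + 2 z + 5 z^2, which beats the bound 1 + 2
  z + 4 z^2 obtained from \<open>weight_bound_scaled\<close>; the second claim divides the same
  bound by \<open>(1-z) (1-z^2)\<close>.\<close>

lemma bounds_ge_4:
  fixes z r :: real
  assumes z: "0 < z" "z \<le> 1 / 4" and r: "r = 1 + z + 2 * z\<^sup>2"
  shows "(1 - z) * (1 - z\<^sup>2) * (weight_bound z / z) \<le> r\<^sup>2" "1 + weight_bound z / 2 \<le> r"
proof -
  have z2: "z\<^sup>2 \<le> 1 / 4 * z" "z ^ 3 \<le> 1 / 4 * z\<^sup>2" "0 < z\<^sup>2"
  proof -
    have "z * z \<le> (1 / 4) * z" "z * (z * z) \<le> (1 / 4) * (z * z)"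
      using z by (auto intro!: mult_right_mono)
    then show "z\<^sup>2 \<le> 1 / 4 * z" "z ^ 3 \<le> 1 / 4 * z\<^sup>2" "0 < z\<^sup>2"
      using z by (simp_all add: power2_eq_square power3_eq_cube)
  qed
  define A where "A = (1 - z) * (1 - z\<^sup>2) * (weight_bound z / z)"
  have A: "A \<le> 1 + 2 * z + 4 * z\<^sup>2" using weight_bound_scaled[OF z] z2 unfolding A_def by linarith
  have "r\<^sup>2 = 1 + 2 * z + 5 * z\<^sup>2 + 4 * z ^ 3 + 4 * z ^ 4"
    unfolding r by (simp add: algebra_simps power2_eq_square power3_eq_cube power4_eq_xxxx)
  moreover have "z ^ 3 \<ge> 0" "z ^ 4 \<ge> 0" using z by simp_all
  ultimately show "(1 - z) * (1 - z\<^sup>2) * (weight_bound z / z) \<le> r\<^sup>2" using A z2(3) unfolding A_def by linarith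
  have p: "(1 - z) * (1 - z\<^sup>2) > 0" using z z2 by (intro mult_pos_pos) linarith+
  have "(1 + 2 * z + 4 * z\<^sup>2) \<le> (2 + 4 * z) * ((1 - z) * (1 - z\<^sup>2))"
  proof -
    have "(2 + 4 * z) * (1 - z - z\<^sup>2) = 2 + 2 * z - 6 * z\<^sup>2 - 4 * z ^ 3"
      by (simp add: algebra_simps power2_eq_square power3_eq_cube)
    moreover have "(2 + 4 * z) * (1 - z - z\<^sup>2) \<le> (2 + 4 * z) * ((1 - z) * (1 - z\<^sup>2))"
    proof (rule mult_left_mono)
      have "z * z\<^sup>2 \<ge> 0" using z by simp
      then show "1 - z - z\<^sup>2 \<le> (1 - z) * (1 - z\<^sup>2)" by (simp add: algebra_simps)
    qed (use z in simp)
    ultimately show ?thesis using z z2 by linarith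
  qed
  then have "A \<le> (2 + 4 * z) * ((1 - z) * (1 - z\<^sup>2))" using A by linarith
  then have "((1 - z) * (1 - z\<^sup>2)) * (weight_bound z / z) \<le> ((1 - z) * (1 - z\<^sup>2)) * (2 + 4 * z)" by (simp add: A_def mult_ac)
  then have "weight_bound z / z \<le> 2 + 4 * z" using p by (rule mult_left_le_imp_le)
  then have "weight_bound z \<le> (2 + 4 * z) * z" using z by (simp add: divide_le_eq)
  then show "1 + weight_bound z / 2 \<le> r" unfolding r by (simp add: algebra_simps power2_eq_square)
qed

theorem theorem5p3:
  fixes F :: "'a :: {field,finite} itself"
  shows "(CARD('a) = 3 \<longrightarrow> (\<forall>n::nat. n \<ge> 1 \<longrightarrow>
            real (unc n F) < 1.56 * 3 powr (real n ^ 2 - real n - 1) * 1.59 ^ n))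
       \<and> (CARD('a) \<ge> 4 \<longrightarrow> (\<forall>n::nat. n \<ge> 1 \<longrightarrow>
            real (unc n F) < cstar (real CARD('a)) * real CARD('a) powr (real n ^ 2 - real n - 1)
                 * (1 + inverse (real CARD('a)) + 2 * inverse (real CARD('a) ^ 2)) ^ n))
       \<and> (\<forall>q::nat. prime_power q \<and> q \<ge> 3 \<longrightarrow> 1 < cstar (real q) \<and> cstar (real q) < 1.56)"
proof (intro conjI impI allI)
  fix n :: nat
  assume q: "CARD('a) = 3" and n: "n \<ge> 1"
  \<comment> \<open>The exact value, about 1.157; half of it stays below 0.59.\<close>
  have s: "weight_bound (1 / 3) = 1.0125 + 6561 / 45440"
    by (simp add: weight_bound_def power_divide)
  show "real (unc n F) < 1.56 * 3 powr (real n ^ 2 - real n - 1) * 1.59 ^ n"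
    using unc_bound[of n "1.56" "1.59" F] q n by (simp add: s power_divide)
next
  fix n :: nat
  assume q: "CARD('a) \<ge> 4" and n: "n \<ge> 1"
  define Q z r where "Q = real CARD('a)" and "z = 1 / Q" and "r = 1 + z + 2 * z\<^sup>2"
  have Q: "Q \<ge> 4" using q by (simp add: Q_def)
  then have z: "0 < z" "z \<le> 1 / 4" by (auto simp: z_def field_simps)
  note b = bounds_ge_4[OF z r_def]
  have c: "1 < cstar Q" using cstar_bounds(1) Q by blast
  have "r > 0" using z unfolding r_def by (intro add_pos_pos) auto
  \<comment> \<open>The strict inequality of the claim comes from
    \<open>cstar Q > 1\<close>.\<close>
  then have "r\<^sup>2 < cstar Q * r\<^sup>2" using c by simp
  moreover have "(1 - 1 / Q) * (1 - 1 / Q\<^sup>2) * (Q * weight_bound (1 / Q)) \<le> r\<^sup>2"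
    using b(1) Q by (simp add: z_def power_divide mult.commute)
  ultimately have c2: "(1 - 1 / Q) * (1 - 1 / Q\<^sup>2) * (Q * weight_bound (1 / Q)) < cstar Q * r\<^sup>2" by linarith
  have "real (unc n F) < cstar Q * Q powr (real n ^ 2 - real n - 1) * r ^ n"
    unfolding Q_def
    by (rule unc_bound) (use q n c c2 b(2) in \<open>simp_all add: Q_def z_def\<close>)
  moreover have "r = 1 + inverse Q + 2 * inverse (Q ^ 2)"
    by (simp add: r_def z_def inverse_eq_divide power_divide)
  ultimately show "real (unc n F) < cstar (real CARD('a)) * real CARD('a) powr (real n ^ 2 - real n - 1)
      * (1 + inverse (real CARD('a)) + 2 * inverse (real CARD('a) ^ 2)) ^ n"
    by (simp add: Q_def)
next
  fix q :: nat
  assume "prime_power q \<and> q \<ge> 3"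
  then have "q = 3 \<or> q \<ge> 4" by linarith
  then have "real q = 3 \<or> real q \<ge> 4" by auto
  then show "1 < cstar (real q)" "cstar (real q) < 1.56" using cstar_bounds by blast+
qed

end
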